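(* Let $G$ be a discrete group, $\Gamma$ a subgroup of $G$, and $d\geq 2$ an integer. The linear map $$f\in\mathbb{C}[G]\mapsto f|_\Gamma\in\mathbb{C}[\Gamma]$$ extends to a bounded map $\Upsilon:X_d(G)\to X_d(\Gamma)$ of norm $1$. Its dual map $\Upsilon^*:M_d(\Gamma)\to M_d(G)$ is given by $$\Upsilon^*(\varphi)(s)=\begin{cases}\varphi(s), & s\in\Gamma,\\ 0, & \text{otherwise},\end{cases}$$ for all $\varphi\in M_d(\Gamma)$.
   Context: Let $G$ be a discrete group and $d\ge 2$ an integer. A bounded function $\varphi:G\to\mathbb{C}$ is an $M_d$-multiplier of $G$ if there are Hilbert spaces $\mathcal{H}_0,\ldots,\mathcal{H}_d$ with $\mathcal{H}_0=\mathcal{H}_d=\mathbb{C}$ and bounded maps $\xi_i:G\to\mathbf{B}(\mathcal{H}_i,\mathcal{H}_{i-1})$ ($i=1,\ldots,d$) such that $$\varphi(t_1\cdots t_d)=\xi_1(t_1)\cdots\xi_d(t_d)1\quad\text{for all } t_1,\ldots,t_d\in G,$$ where $\mathbf{B}(E,F)$ denotes the bounded linear operators from $E$ to $F$. $M_d(G)$ is the space of all $M_d$-multipliers, with norm $\|\varphi\|_{M_d(G)}=\inf\{\sup_{t_1\in G}\|\xi_1(t_1)\|\cdots\sup_{t_d\in G}\|\xi_d(t_d)\|\}$, the infimum being over all such decompositions. $X_d(G)$ is the completion of $\ell^1(G)$ for the norm $\|g\|_{X_d(G)}=\sup\{|\sum_{t\in G}\varphi(t)g(t)| : \varphi\in M_d(G),\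 \|\varphi\|_{M_d(G)}\le 1\}$. It is known that $X_d(G)^*=M_d(G)$ for the duality $\langle\varphi,g\rangle=\sum_{t\in G}\varphi(t)g(t)$, $g\in\ell^1(G)$; dual maps are taken with respect to this identification. $\mathbb{C}[G]$ is the group algebra of $G$, viewed as the space of finitely supported functions $G\to\mathbb{C}$ (a dense subspace of $X_d(G)$), and $f|_\Gamma$ is the restriction of $f$ to $\Gamma$. *)

theory Defs
  imports "HOL-Analysis.Analysis" "HOL-Algebra.Algebra"
begin

section \<open>Complex normed spaces and Hilbert spaces with explicit carriers\<close>

text \<open>The Hilbert spaces in the definition of an \<open>M\<^sub>d\<close>-multiplier are existentially quantified, so
  they are values (records with a carrier set) and not types. They extend the modules of
  HOL-Algebra over the ring of complex numbers; the inherited multiplicative fields \<open>mult\<close> and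
  \<open>one\<close> play no role.\<close>

definition complex_ring :: "complex ring" where
  "complex_ring = \<lparr>carrier = UNIV, monoid.mult = (*), one = 1, ring.zero = 0, add = (+)\<rparr>"

record 'v cnormed = "(complex, 'v) module" +
  vnorm :: "'v \<Rightarrow> real"

record 'v chilbert = "'v cnormed" +
  cinner :: "'v \<Rightarrow> 'v \<Rightarrow> complex"

text \<open>The value outside the carrier is only there to satisfy the axioms of \<^locale>\<open>Metric_space\<close>,
  which are not all relativised to the carrier.\<close>

definition vdist :: "('v, 'm) cnormed_scheme \<Rightarrow> 'v \<Rightarrow> 'v \<Rightarrow> real" where
  "vdist V x y = (if x \<in> carrier V \<and> y \<in> carrier V then vnorm V (x \<ominus>\<^bsub>V\<^esub> y) else 0)"

locale complex_inner_space = Module.module complex_ring H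
  for H :: "('v, 'm) chilbert_scheme" (structure) +
  assumes cinner_add_left: "\<lbrakk>x \<in> carrier H; y \<in> carrier H; z \<in> carrier H\<rbrakk>
      \<Longrightarrow> cinner H (x \<oplus> y) z = cinner H x z + cinner H y z"
    and cinner_smult_left: "\<lbrakk>x \<in> carrier H; y \<in> carrier H\<rbrakk>
      \<Longrightarrow> cinner H (c \<odot> x) y = c * cinner H x y"
    and cinner_commute: "\<lbrakk>x \<in> carrier H; y \<in> carrier H\<rbrakk> \<Longrightarrow> cinner H x y = cnj (cinner H y x)"
    and cinner_pos: "\<lbrakk>x \<in> carrier H; x \<noteq> \<zero>\<rbrakk> \<Longrightarrow> 0 < Re (cinner H x x)"
    and vnorm_eq: "x \<in> carrier H \<Longrightarrow> vnorm H x = sqrt (Re (cinner H x x))"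

locale hilbert_space = complex_inner_space +
  assumes complete: "Metric_space.mcomplete (carrier H) (vdist H)"

text \<open>The one-dimensional Hilbert space \<open>\<complex>\<close>, copied into a type along an injection \<open>j\<close>;
  \<open>complex_space id\<close> is \<open>\<complex>\<close> itself.\<close>

definition complex_space :: "(complex \<Rightarrow> 'v) \<Rightarrow> 'v chilbert" where
  "complex_space j = \<lparr>
     carrier = range j,
     monoid.mult = (\<lambda>x y. j (inv_into UNIV j x * inv_into UNIV j y)),
     one = j 1,
     ring.zero = j 0,
     add = (\<lambda>x y. j (inv_into UNIV j x + inv_into UNIV j y)),
     smult = (\<lambda>c x. j (c * inv_into UNIV j x)),
     vnorm = (\<lambda>x. cmod (inv_into UNIV j x)),
     cinner = (\<lambda>x y. inv_into UNIV j x * cnj (inv_into UNIV j y))\<rparr>"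

text \<open>Only the values of an operator on the carrier of its domain matter.\<close>

definition bounded_op ::
  "('v, 'm) cnormed_scheme \<Rightarrow> ('w, 'n) cnormed_scheme \<Rightarrow> ('v \<Rightarrow> 'w) \<Rightarrow> bool" where
  "bounded_op V W T \<longleftrightarrow>
     T \<in> carrier V \<rightarrow> carrier W \<and>
     (\<forall>x\<in>carrier V. \<forall>y\<in>carrier V. T (x \<oplus>\<^bsub>V\<^esub> y) = T x \<oplus>\<^bsub>W\<^esub> T y) \<and>
     (\<forall>c. \<forall>x\<in>carrier V. T (c \<odot>\<^bsub>V\<^esub> x) = c \<odot>\<^bsub>W\<^esub> T x) \<and>
     (\<exists>C. \<forall>x\<in>carrier V. vnorm W (T x) \<le> C * vnorm V x)"

definition opnorm ::
  "('v, 'm) cnormed_scheme \<Rightarrow> ('w, 'n) cnormed_scheme \<Rightarrow> ('v \<Rightarrow> 'w) \<Rightarrow> real" where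
  "opnorm V W T = Inf {C. 0 \<le> C \<and> (\<forall>x\<in>carrier V. vnorm W (T x) \<le> C * vnorm V x)}"

definition dual_space :: "('v, 'm) cnormed_scheme \<Rightarrow> ('v \<Rightarrow> complex) set" where
  "dual_space V = {F \<in> extensional (carrier V). bounded_op V (complex_space id) F}"


section \<open>Completion of a normed space\<close>

text \<open>The completion consists of the classes of Cauchy sequences modulo null sequences.\<close>

definition cauchy_seqs :: "('v, 'm) cnormed_scheme \<Rightarrow> (nat \<Rightarrow> 'v) set" where
  "cauchy_seqs V = {\<sigma>. Metric_space.MCauchy (carrier V) (vdist V) \<sigma>}"

definition cauchy_rel :: "('v, 'm) cnormed_scheme \<Rightarrow> ((nat \<Rightarrow> 'v) \<times> (nat \<Rightarrow> 'v)) set" where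
  "cauchy_rel V = {(\<sigma>, \<tau>). \<sigma> \<in> cauchy_seqs V \<and> \<tau> \<in> cauchy_seqs V \<and>
     (\<lambda>n. vdist V (\<sigma> n) (\<tau> n)) \<longlonglongrightarrow> 0}"

definition completion :: "('v, 'm) cnormed_scheme \<Rightarrow> (nat \<Rightarrow> 'v) set cnormed" where
  "completion V = \<lparr>
     carrier = cauchy_seqs V // cauchy_rel V,
     monoid.mult = undefined,
     one = undefined,
     ring.zero = cauchy_rel V `` {\<lambda>n. \<zero>\<^bsub>V\<^esub>},
     add = (\<lambda>A B. \<Union>\<sigma>\<in>A. \<Union>\<tau>\<in>B. cauchy_rel V `` {\<lambda>n. \<sigma> n \<oplus>\<^bsub>V\<^esub> \<tau> n}),
     smult = (\<lambda>c A. \<Union>\<sigma>\<in>A. cauchy_rel V `` {\<lambda>n. c \<odot>\<^bsub>V\<^esub> \<sigma> n}),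
     vnorm = (\<lambda>A. THE r. \<forall>\<sigma>\<in>A. (\<lambda>n. vnorm V (\<sigma> n)) \<longlonglongrightarrow> r)\<rparr>"

definition completion_embed :: "('v, 'm) cnormed_scheme \<Rightarrow> 'v \<Rightarrow> (nat \<Rightarrow> 'v) set" where
  "completion_embed V x = cauchy_rel V `` {\<lambda>n. x}"


section \<open>Multipliers\<close>

text \<open>Functions on \<open>G\<close> are elements of \<^term>\<open>extensional (carrier G)\<close>, so that they are
  determined by their values on the carrier. All spaces of a decomposition live in the type
  \<^typ>\<open>complex + 'h\<close>; its left summand provides \<open>H 0 = H d = \<complex>\<close>. The sides of the last
  condition are \<open>\<xi>\<^sub>1(t\<^sub>1) \<cdots> \<xi>\<^sub>d(t\<^sub>d) 1\<close> and \<open>\<phi>(t\<^sub>1 \<cdots> t\<^sub>d)\<close>.\<close>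

definition Md_decomposition ::
  "('g, 'b) monoid_scheme \<Rightarrow> nat \<Rightarrow> ('g \<Rightarrow> complex) \<Rightarrow>
   (nat \<Rightarrow> (complex + 'h) chilbert) \<Rightarrow> (nat \<Rightarrow> 'g \<Rightarrow> complex + 'h \<Rightarrow> complex + 'h) \<Rightarrow> bool" where
  "Md_decomposition G d \<phi> H \<xi> \<longleftrightarrow>
     (\<forall>i\<in>{0..d}. hilbert_space (H i)) \<and>
     H 0 = complex_space Inl \<and> H d = complex_space Inl \<and>
     (\<forall>i\<in>{1..d}. (\<forall>t\<in>carrier G. bounded_op (H i) (H (i - 1)) (\<xi> i t)) \<and>
        bdd_above ((\<lambda>t. opnorm (H i) (H (i - 1)) (\<xi> i t)) ` carrier G)) \<and>
     (\<forall>t. (\<forall>i\<in>{1..d}. t i \<in> carrier G) \<longrightarrow>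
        foldr (\<lambda>i. \<xi> i (t i)) [1..<Suc d] (Inl 1) =
        Inl (\<phi> (foldr (\<lambda>i x. t i \<otimes>\<^bsub>G\<^esub> x) [1..<Suc d] \<one>\<^bsub>G\<^esub>)))"

definition Md_cost ::
  "('g, 'b) monoid_scheme \<Rightarrow> nat \<Rightarrow>
   (nat \<Rightarrow> (complex + 'h) chilbert) \<Rightarrow> (nat \<Rightarrow> 'g \<Rightarrow> complex + 'h \<Rightarrow> complex + 'h) \<Rightarrow> real" where
  "Md_cost G d H \<xi> = (\<Prod>i=1..d. SUP t\<in>carrier G. opnorm (H i) (H (i - 1)) (\<xi> i t))"

text \<open>HOL cannot quantify over all types \<open>'h\<close>, so \<open>'h\<close> is fixed to a type that is large enough
  for the group: see lemma \<open>Md_decomposition_universe\<close> below.\<close>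

type_synonym 'g universe = "'g list \<Rightarrow> complex"

definition Md :: "('g, 'b) monoid_scheme \<Rightarrow> nat \<Rightarrow> ('g \<Rightarrow> complex) set" where
  "Md G d = {\<phi> \<in> extensional (carrier G). bounded (\<phi> ` carrier G) \<and>
     (\<exists>(H :: nat \<Rightarrow> (complex + 'g universe) chilbert) \<xi>. Md_decomposition G d \<phi> H \<xi>)}"

definition Md_norm :: "('g, 'b) monoid_scheme \<Rightarrow> nat \<Rightarrow> ('g \<Rightarrow> complex) \<Rightarrow> real" where
  "Md_norm G d \<phi> = Inf {Md_cost G d H \<xi> | (H :: nat \<Rightarrow> (complex + 'g universe) chilbert) \<xi>.
     Md_decomposition G d \<phi> H \<xi>}"


section \<open>The predual\<close>

definition pairing ::
  "('g, 'b) monoid_scheme \<Rightarrow> ('g \<Rightarrow> complex) \<Rightarrow> ('g \<Rightarrow> complex) \<Rightarrow> complex" where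
  "pairing G \<phi> g = (\<Sum>\<^sub>\<infinity>t\<in>carrier G. \<phi> t * g t)"

definition group_algebra :: "('g, 'b) monoid_scheme \<Rightarrow> ('g \<Rightarrow> complex) set" where
  "group_algebra G = {f \<in> extensional (carrier G). finite {t \<in> carrier G. f t \<noteq> 0}}"

text \<open>\<open>\<ell>\<^sup>1(G)\<close> with the norm of \<open>X\<^sub>d(G)\<close>\<close>

definition ell1_Xd :: "('g, 'b) monoid_scheme \<Rightarrow> nat \<Rightarrow> ('g \<Rightarrow> complex) cnormed" where
  "ell1_Xd G d = \<lparr>
     carrier = {g \<in> extensional (carrier G). (\<lambda>t. cmod (g t)) summable_on carrier G},
     monoid.mult = undefined,
     one = undefined,
     ring.zero = (\<lambda>t\<in>carrier G. 0),
     add = (\<lambda>f g. \<lambda>t\<in>carrier G. f t + g t),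
     smult = (\<lambda>c f. \<lambda>t\<in>carrier G. c * f t),
     vnorm = (\<lambda>g. SUP \<phi>\<in>{\<phi> \<in> Md G d. Md_norm G d \<phi> \<le> 1}. cmod (pairing G \<phi> g))\<rparr>"

abbreviation Xd :: "('g, 'b) monoid_scheme \<Rightarrow> nat \<Rightarrow> (nat \<Rightarrow> 'g \<Rightarrow> complex) set cnormed" where
  "Xd G d \<equiv> completion (ell1_Xd G d)"

abbreviation Xd_embed ::
  "('g, 'b) monoid_scheme \<Rightarrow> nat \<Rightarrow> ('g \<Rightarrow> complex) \<Rightarrow> (nat \<Rightarrow> 'g \<Rightarrow> complex) set" where
  "Xd_embed G d \<equiv> completion_embed (ell1_Xd G d)"

text \<open>The identification \<open>M\<^sub>d(G) = X\<^sub>d(G)\<^sup>*\<close>: the functional of \<open>\<phi>\<close> is the element of the dual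
  that extends \<^term>\<open>pairing G \<phi>\<close> from \<open>\<ell>\<^sup>1(G)\<close>. It is unique because \<open>\<ell>\<^sup>1(G)\<close> is dense.\<close>

definition Md_functional ::
  "('g, 'b) monoid_scheme \<Rightarrow> nat \<Rightarrow> ('g \<Rightarrow> complex) \<Rightarrow> (nat \<Rightarrow> 'g \<Rightarrow> complex) set \<Rightarrow> complex" where
  "Md_functional G d \<phi> = (THE F. F \<in> dual_space (Xd G d) \<and>
     (\<forall>g\<in>carrier (ell1_Xd G d). F (Xd_embed G d g) = pairing G \<phi> g))"

text \<open>The dual map \<open>M\<^sub>d(K) \<rightarrow> M\<^sub>d(G)\<close> of \<open>U : X\<^sub>d(G) \<rightarrow> X\<^sub>d(K)\<close>: the transpose \<open>F \<mapsto> F \<circ> U\<close>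
  conjugated by the identifications.\<close>

definition Md_dual_map ::
  "('g, 'b) monoid_scheme \<Rightarrow> ('k, 'c) monoid_scheme \<Rightarrow> nat \<Rightarrow>
   ((nat \<Rightarrow> 'g \<Rightarrow> complex) set \<Rightarrow> (nat \<Rightarrow> 'k \<Rightarrow> complex) set) \<Rightarrow>
   ('k \<Rightarrow> complex) \<Rightarrow> ('g \<Rightarrow> complex)" where
  "Md_dual_map G K d U \<phi> =
     inv_into (Md G d) (Md_functional G d)
       (compose (carrier (Xd G d)) (Md_functional K d \<phi>) U)"


section \<open>Independence of the universe type\<close>

lemma complex_ring_simps [simp]:
  "carrier complex_ring = UNIV"
  "monoid.mult complex_ring = (*)"
  "monoid.one complex_ring = 1"
  "ring.zero complex_ring = 0"
  "add complex_ring = (+)"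
  by (auto simp: complex_ring_def fun_eq_iff)

lemma cring_complex_ring: "cring complex_ring"
proof (intro cringI abelian_groupI comm_monoidI)
  show "\<exists>y\<in>carrier complex_ring. y \<oplus>\<^bsub>complex_ring\<^esub> x = \<zero>\<^bsub>complex_ring\<^esub>" for x
    by (rule bexI[of _ "-x"]) auto
qed (auto simp: algebra_simps)

lemma complex_ring_a_inv [simp]: "a_inv complex_ring c = - c"
proof -
  interpret cring complex_ring by (rule cring_complex_ring)
  show ?thesis by (rule minus_equality) auto
qed

context complex_inner_space
begin

lemma smult_1 [simp]: "x \<in> carrier H \<Longrightarrow> 1 \<odot> x = x"
  using smult_one by simp

lemma smult_mult: "x \<in> carrier H \<Longrightarrow> a \<odot> (b \<odot> x) = (a * b) \<odot> x"
  using smult_assoc1[of a b x] by simp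

lemma smult_plus: "x \<in> carrier H \<Longrightarrow> (a + b) \<odot> x = a \<odot> x \<oplus> b \<odot> x"
  using smult_l_distr[of a b x] by simp

lemma smult_in [simp]: "x \<in> carrier H \<Longrightarrow> c \<odot> x \<in> carrier H"
  by simp

lemma minus_eq_smult: "x \<in> carrier H \<Longrightarrow> \<ominus> x = (-1) \<odot> x"
  using smult_l_minus[of 1 x] by simp

lemma cinner_zero_left [simp]: "x \<in> carrier H \<Longrightarrow> cinner H \<zero> x = 0"
  using cinner_smult_left[of \<zero> x 0] by simp

lemma cinner_add_right: "\<lbrakk>x \<in> carrier H; y \<in> carrier H; z \<in> carrier H\<rbrakk>
      \<Longrightarrow> cinner H z (x \<oplus> y) = cinner H z x + cinner H z y"
  using cinner_commute[of z "x \<oplus> y"] cinner_commute[of z x] cinner_commute[of z y]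
    cinner_add_left[of x y z] by simp

lemma cinner_smult_right: "\<lbrakk>x \<in> carrier H; z \<in> carrier H\<rbrakk>
      \<Longrightarrow> cinner H z (c \<odot> x) = cnj c * cinner H z x"
  using cinner_commute[of z "c \<odot> x"] cinner_commute[of z x] cinner_smult_left[of x z c]
  by simp

lemma cinner_zero_right [simp]: "x \<in> carrier H \<Longrightarrow> cinner H x \<zero> = 0"
  using cinner_commute[of x \<zero>] by simp

lemma cinner_self_Im: "x \<in> carrier H \<Longrightarrow> Im (cinner H x x) = 0"
  using cinner_commute[of x x] by (simp add: complex_eq_iff)

lemma cinner_self_nonneg: "x \<in> carrier H \<Longrightarrow> 0 \<le> Re (cinner H x x)"
  using cinner_pos[of x] by (cases "x = \<zero>") auto

lemma vnorm_nonneg: "x \<in> carrier H \<Longrightarrow> 0 \<le> vnorm H x"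
  by (simp add: vnorm_eq cinner_self_nonneg)

lemma vnorm_power2: "x \<in> carrier H \<Longrightarrow> complex_of_real ((vnorm H x)\<^sup>2) = cinner H x x"
  by (simp add: vnorm_eq cinner_self_nonneg complex_eq_iff cinner_self_Im)

lemma vnorm_zero_iff: "x \<in> carrier H \<Longrightarrow> vnorm H x = 0 \<longleftrightarrow> x = \<zero>"
  using cinner_pos[of x] by (cases "x = \<zero>") (auto simp: vnorm_eq)

lemma vnorm_smult: "x \<in> carrier H \<Longrightarrow> vnorm H (c \<odot> x) = cmod c * vnorm H x"
proof -
  assume x: "x \<in> carrier H"
  have "cinner H (c \<odot> x) (c \<odot> x) = (c * cnj c) * cinner H x x"
    using x by (simp add: cinner_smult_left cinner_smult_right)
  also have "c * cnj c = complex_of_real ((cmod c)\<^sup>2)"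
    by (rule complex_norm_square[symmetric])
  finally have "Re (cinner H (c \<odot> x) (c \<odot> x)) = (cmod c)\<^sup>2 * Re (cinner H x x)" by simp
  then show ?thesis using x by (simp add: vnorm_eq real_sqrt_mult)
qed

lemma Cauchy_Schwarz:
  assumes x: "x \<in> carrier H" and y: "y \<in> carrier H"
  shows "cmod (cinner H x y) \<le> vnorm H x * vnorm H y"
proof (cases "y = \<zero>")
  case True
  moreover have "vnorm H \<zero> = 0" by (simp add: vnorm_zero_iff)
  ultimately show ?thesis using x by simp
next
  case False
  define b where "b = Re (cinner H y y)"
  have b: "0 < b" "cinner H y y = complex_of_real b"
    using cinner_pos[OF y False] cinner_self_Im[OF y] by (auto simp: b_def complex_eq_iff)
  define p where "p = cinner H x y"
  define c where "c = - (p / complex_of_real b)"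
  have yx: "cinner H y x = cnj p" using cinner_commute[OF y x] by (simp add: p_def)
  define z where "z = x \<oplus> c \<odot> y"
  have z: "z \<in> carrier H" using x y by (simp add: z_def)
  have "cinner H z z = cinner H x x + cnj c * p + (c * cnj p + c * cnj c * complex_of_real b)"
    using x y by (simp add: z_def cinner_add_left cinner_add_right cinner_smult_left
        cinner_smult_right yx b p_def[symmetric] algebra_simps)
  also have "c * cnj p + c * cnj c * complex_of_real b = 0"
    using b by (simp add: c_def)
  finally have "cinner H z z = cinner H x x - complex_of_real ((cmod p)\<^sup>2 / b)"
    using complex_norm_square[of p] by (simp add: c_def mult.commute)
  then have "Re (cinner H z z) = Re (cinner H x x) - (cmod p)\<^sup>2 / b" by simp
  then have "(cmod p)\<^sup>2 / b \<le> Re (cinner H x x)" using cinner_self_nonneg[OF z] by simp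
  then have "(cmod p)\<^sup>2 \<le> Re (cinner H x x) * b" using b by (simp add: pos_divide_le_eq)
  also have "\<dots> = (vnorm H x * vnorm H y)\<^sup>2"
    using x y by (simp add: vnorm_eq power_mult_distrib cinner_self_nonneg b_def)
  finally show ?thesis
    unfolding p_def[symmetric]
    by (rule power2_le_imp_le) (simp add: vnorm_nonneg x y)
qed

lemma vnorm_triangle:
  assumes x: "x \<in> carrier H" and y: "y \<in> carrier H"
  shows "vnorm H (x \<oplus> y) \<le> vnorm H x + vnorm H y"
proof -
  have re: "(vnorm H z)\<^sup>2 = Re (cinner H z z)" if "z \<in> carrier H" for z
    using that by (simp add: vnorm_eq cinner_self_nonneg)
  have "Re (cinner H y x) = Re (cinner H x y)"
    using cinner_commute[OF x y] by simp
  then have "(vnorm H (x \<oplus> y))\<^sup>2 = (vnorm H x)\<^sup>2 + (vnorm H y)\<^sup>2 + 2 * Re (cinner H x y)"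
    using x y by (simp add: re cinner_add_left cinner_add_right)
  also have "\<dots> \<le> (vnorm H x)\<^sup>2 + (vnorm H y)\<^sup>2 + 2 * (vnorm H x * vnorm H y)"
    using Cauchy_Schwarz[OF x y] complex_Re_le_cmod[of "cinner H x y"] by linarith
  also have "\<dots> = (vnorm H x + vnorm H y)\<^sup>2" by (simp add: power2_eq_square algebra_simps)
  finally show ?thesis
    by (rule power2_le_imp_le) (simp add: vnorm_nonneg x y)
qed

lemma minus_eq_zero_iff:
  assumes "x \<in> carrier H" "y \<in> carrier H"
  shows "x \<ominus> y = \<zero> \<longleftrightarrow> x = y"
proof
  assume *: "x \<ominus> y = \<zero>"
  have "x = (x \<ominus> y) \<oplus> y" using assms by (simp add: a_minus_def a_assoc l_neg)
  then show "x = y" using * assms by simp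
qed (use assms in \<open>simp add: a_minus_def r_neg\<close>)

lemma Metric_space_vdist: "Metric_space (carrier H) (vdist H)"
proof
  show "0 \<le> vdist H x y" for x y
    by (simp add: vdist_def vnorm_nonneg)
  show "vdist H x y = vdist H y x" for x y
  proof (cases "x \<in> carrier H \<and> y \<in> carrier H")
    case True
    have "y \<ominus> x = (-1) \<odot> (x \<ominus> y)"
      using True minus_eq_smult[of "x \<ominus> y"] minus_add
      by (metis R.a_inv_closed a_comm a_inv_closed a_minus_def add.inv_closed minus_closed minus_minus)
    then show ?thesis using True vnorm_smult[of "x \<ominus> y" "-1"]
      by (simp add: vdist_def)
  qed (auto simp: vdist_def)
  show "vdist H x y = 0 \<longleftrightarrow> x = y" if "x \<in> carrier H" "y \<in> carrier H" for x y
    using that by (simp add: vdist_def vnorm_zero_iff minus_eq_zero_iff)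
  show "vdist H x z \<le> vdist H x y + vdist H y z"
    if "x \<in> carrier H" "y \<in> carrier H" "z \<in> carrier H" for x y z
  proof -
    have "x \<ominus> z = (x \<ominus> y) \<oplus> (y \<ominus> z)"
      using that by (simp add: a_minus_def a_assoc r_neg1)
    then show ?thesis using that vnorm_triangle[of "x \<ominus> y" "y \<ominus> z"]
      by (simp add: vdist_def)
  qed
qed


definition closed_subspace :: "'v set \<Rightarrow> bool" where
  "closed_subspace S \<longleftrightarrow> S \<subseteq> carrier H \<and> \<zero> \<in> S \<and>
     (\<forall>x\<in>S. \<forall>y\<in>S. x \<oplus> y \<in> S) \<and> (\<forall>c. \<forall>x\<in>S. c \<odot> x \<in> S) \<and>
     (\<forall>\<sigma> x. range \<sigma> \<subseteq> S \<and> x \<in> carrier H \<and> (\<lambda>n. vnorm H (\<sigma> n \<ominus> x)) \<longlonglongrightarrow> 0 \<longrightarrow> x \<in> S)"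

definition closed_span :: "'v set \<Rightarrow> 'v set" where
  "closed_span W = \<Inter>{S. closed_subspace S \<and> W \<subseteq> S}"

lemma closed_subspace_carrier: "closed_subspace (carrier H)"
  by (auto simp: closed_subspace_def)

lemma closed_subspace_span:
  assumes "W \<subseteq> carrier H"
  shows "closed_subspace (closed_span W)"
proof -
  have sub: "closed_span W \<subseteq> carrier H"
    using assms closed_subspace_carrier unfolding closed_span_def by blast
  have "x \<in> closed_span W"
    if "range \<sigma> \<subseteq> closed_span W" "x \<in> carrier H" "(\<lambda>n. vnorm H (\<sigma> n \<ominus> x)) \<longlonglongrightarrow> 0" for \<sigma> x
    unfolding closed_span_def
  proof (rule InterI)
    fix S assume "S \<in> {S. closed_subspace S \<and> W \<subseteq> S}"
    moreover from this have "range \<sigma> \<subseteq> S"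
      using that(1) unfolding closed_span_def by blast
    ultimately show "x \<in> S" using that(2,3) unfolding closed_subspace_def by blast
  qed
  moreover have "\<zero> \<in> closed_span W"
    unfolding closed_span_def closed_subspace_def by blast
  moreover have "x \<oplus> y \<in> closed_span W" if "x \<in> closed_span W" "y \<in> closed_span W" for x y
    using that unfolding closed_span_def closed_subspace_def by blast
  moreover have "c \<odot> x \<in> closed_span W" if "x \<in> closed_span W" for c x
    using that unfolding closed_span_def closed_subspace_def by blast
  ultimately show ?thesis
    unfolding closed_subspace_def[of "closed_span W"] using sub by blast
qed

lemma closed_span_superset: "W \<subseteq> closed_span W"
  by (auto simp: closed_span_def)

lemma closed_span_least: "closed_subspace S \<Longrightarrow> W \<subseteq> S \<Longrightarrow> closed_span W \<subseteq> S"
  by (auto simp: closed_span_def)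

lemma closed_subspace_orthogonal:
  assumes z: "z \<in> carrier H"
  shows "closed_subspace {y \<in> carrier H. cinner H y z = 0}"
  unfolding closed_subspace_def
proof (intro conjI ballI allI impI)
  fix \<sigma> x
  assume "range \<sigma> \<subseteq> {y \<in> carrier H. cinner H y z = 0} \<and> x \<in> carrier H
    \<and> (\<lambda>n. vnorm H (\<sigma> n \<ominus> x)) \<longlonglongrightarrow> 0"
  then have \<sigma>: "\<sigma> n \<in> carrier H" "cinner H (\<sigma> n) z = 0" and x: "x \<in> carrier H"
    and lim: "(\<lambda>n. vnorm H (\<sigma> n \<ominus> x)) \<longlonglongrightarrow> 0" for n
    by auto
  have "cmod (cinner H x z) \<le> vnorm H (\<sigma> n \<ominus> x) * vnorm H z" for n
  proof -
    have "cinner H (\<sigma> n \<ominus> x) z = - cinner H x z"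
      using \<sigma> x z by (simp add: a_minus_def cinner_add_left minus_eq_smult cinner_smult_left)
    then show ?thesis
      using Cauchy_Schwarz[of "\<sigma> n \<ominus> x" z] \<sigma> x z by simp
  qed
  moreover have "(\<lambda>n. vnorm H (\<sigma> n \<ominus> x) * vnorm H z) \<longlonglongrightarrow> 0 * vnorm H z"
    by (intro tendsto_mult lim tendsto_const)
  ultimately have "cmod (cinner H x z) \<le> 0 * vnorm H z"
    by (intro LIMSEQ_le_const) auto
  then show "x \<in> {y \<in> carrier H. cinner H y z = 0}" using x by simp
qed (use z in \<open>auto simp: cinner_add_left cinner_smult_left\<close>)

lemma closed_span_orthogonal:
  assumes "W \<subseteq> carrier H" "x \<in> closed_span W" "\<And>w. w \<in> W \<Longrightarrow> cinner H x w = 0"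
  shows "x = \<zero>"
proof -
  have x: "x \<in> carrier H"
    using closed_subspace_span[OF assms(1)] assms(2) by (auto simp: closed_subspace_def)
  have "W \<subseteq> {y \<in> carrier H. cinner H y x = 0}"
    using assms(1,3) x cinner_commute by fastforce
  from closed_span_least[OF closed_subspace_orthogonal[OF x] this] assms(2)
  have "cinner H x x = 0" by auto
  then show ?thesis using cinner_pos[OF x] by auto
qed

end

lemma closed_subspace_vimage:
  fixes H :: "('v, 'm) chilbert_scheme" and H' :: "('w, 'n) chilbert_scheme"
  assumes "complex_inner_space H" "complex_inner_space H'"
    and T: "bounded_op H H' T" and S: "complex_inner_space.closed_subspace H' S"
  shows "complex_inner_space.closed_subspace H {x \<in> carrier H. T x \<in> S}"
proof -
  interpret H: complex_inner_space H by fact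
  interpret H': complex_inner_space H' by fact
  have Tc: "T x \<in> carrier H'" if "x \<in> carrier H" for x
    using T that by (auto simp: bounded_op_def)
  have Tadd: "T (x \<oplus>\<^bsub>H\<^esub> y) = T x \<oplus>\<^bsub>H'\<^esub> T y" if "x \<in> carrier H" "y \<in> carrier H" for x y
    using T that by (auto simp: bounded_op_def)
  have Tsm: "T (c \<odot>\<^bsub>H\<^esub> x) = c \<odot>\<^bsub>H'\<^esub> T x" if "x \<in> carrier H" for c x
    using T that by (auto simp: bounded_op_def)
  obtain C where "\<forall>x\<in>carrier H. vnorm H' (T x) \<le> C * vnorm H x"
    using T unfolding bounded_op_def by blast
  then have C: "vnorm H' (T x) \<le> C * vnorm H x" if "x \<in> carrier H" for x
    using that by blast
  have T0: "T \<zero>\<^bsub>H\<^esub> = \<zero>\<^bsub>H'\<^esub>"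
    using Tsm[of "\<zero>\<^bsub>H\<^esub>" 0] H.smult_l_null[of "\<zero>\<^bsub>H\<^esub>"] H'.smult_l_null[of "T \<zero>\<^bsub>H\<^esub>"] Tc by simp
  have Tminus: "T (x \<ominus>\<^bsub>H\<^esub> y) = T x \<ominus>\<^bsub>H'\<^esub> T y" if "x \<in> carrier H" "y \<in> carrier H" for x y
    using that by (simp add: a_minus_def Tadd H.minus_eq_smult H'.minus_eq_smult Tsm Tc)
  show ?thesis
    unfolding H.closed_subspace_def
  proof (intro conjI ballI allI impI)
    fix \<sigma> x
    assume "range \<sigma> \<subseteq> {x \<in> carrier H. T x \<in> S} \<and> x \<in> carrier H
      \<and> (\<lambda>n. vnorm H (\<sigma> n \<ominus>\<^bsub>H\<^esub> x)) \<longlonglongrightarrow> 0"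
    then have \<sigma>: "\<sigma> n \<in> carrier H" "T (\<sigma> n) \<in> S" and x: "x \<in> carrier H"
      and lim: "(\<lambda>n. vnorm H (\<sigma> n \<ominus>\<^bsub>H\<^esub> x)) \<longlonglongrightarrow> 0" for n
      by auto
    have "(\<lambda>n. vnorm H' (T (\<sigma> n) \<ominus>\<^bsub>H'\<^esub> T x)) \<longlonglongrightarrow> 0"
    proof (rule tendsto_sandwich[of "\<lambda>_. 0" _ _ "\<lambda>n. C * vnorm H (\<sigma> n \<ominus>\<^bsub>H\<^esub> x)"])
      show "\<forall>\<^sub>F n in sequentially. 0 \<le> vnorm H' (T (\<sigma> n) \<ominus>\<^bsub>H'\<^esub> T x)"
        using \<sigma> x Tc by (intro always_eventually allI H'.vnorm_nonneg) simp
      show "\<forall>\<^sub>F n in sequentially. vnorm H' (T (\<sigma> n) \<ominus>\<^bsub>H'\<^esub> T x) \<le> C * vnorm H (\<sigma> n \<ominus>\<^bsub>H\<^esub> x)"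
        using \<sigma> x C by (intro always_eventually allI) (simp add: Tminus[symmetric])
      show "(\<lambda>n. C * vnorm H (\<sigma> n \<ominus>\<^bsub>H\<^esub> x)) \<longlonglongrightarrow> 0"
        using tendsto_mult[OF tendsto_const lim, of C] by simp
    qed simp
    moreover have "\<And>\<sigma> x. range \<sigma> \<subseteq> S \<Longrightarrow> x \<in> carrier H' \<Longrightarrow>
        (\<lambda>n. vnorm H' (\<sigma> n \<ominus>\<^bsub>H'\<^esub> x)) \<longlonglongrightarrow> 0 \<Longrightarrow> x \<in> S"
      using S by (auto simp: H'.closed_subspace_def)
    ultimately have "T x \<in> S"
      using \<sigma> x Tc by (meson image_subsetI)
    then show "x \<in> {x \<in> carrier H. T x \<in> S}" using x by simp
  qed (use S T0 Tadd Tsm in \<open>auto simp: H'.closed_subspace_def\<close>)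
qed

text \<open>\<open>e\<close> maps the closed subspace \<open>K\<close> of \<open>H\<close> isometrically onto \<open>H'\<close>.\<close>

definition isometric_copy ::
  "('v \<Rightarrow> 'w) \<Rightarrow> 'v set \<Rightarrow> ('v, 'm) cnormed_scheme \<Rightarrow> ('w, 'n) cnormed_scheme \<Rightarrow> bool" where
  "isometric_copy e K H H' \<longleftrightarrow> K \<subseteq> carrier H \<and> inj_on e K \<and> carrier H' = e ` K \<and>
     (\<forall>x\<in>K. \<forall>y\<in>K. x \<oplus>\<^bsub>H\<^esub> y \<in> K \<and> e (x \<oplus>\<^bsub>H\<^esub> y) = e x \<oplus>\<^bsub>H'\<^esub> e y) \<and>
     (\<forall>c. \<forall>x\<in>K. c \<odot>\<^bsub>H\<^esub> x \<in> K \<and> e (c \<odot>\<^bsub>H\<^esub> x) = c \<odot>\<^bsub>H'\<^esub> e x) \<and>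
     (\<forall>x\<in>K. vnorm H' (e x) = vnorm H x)"

definition transport :: "('v \<Rightarrow> 'w) \<Rightarrow> 'v set \<Rightarrow> 'v chilbert \<Rightarrow> 'w chilbert" where
  "transport e K H = \<lparr>
     carrier = e ` K,
     monoid.mult = undefined,
     one = undefined,
     ring.zero = e \<zero>\<^bsub>H\<^esub>,
     add = (\<lambda>x y. e (the_inv_into K e x \<oplus>\<^bsub>H\<^esub> the_inv_into K e y)),
     smult = (\<lambda>c x. e (c \<odot>\<^bsub>H\<^esub> the_inv_into K e x)),
     vnorm = (\<lambda>x. vnorm H (the_inv_into K e x)),
     cinner = (\<lambda>x y. cinner H (the_inv_into K e x) (the_inv_into K e y))\<rparr>"

lemma isometric_copy_transport:
  assumes "complex_inner_space H" "complex_inner_space.closed_subspace H K" "inj_on e K"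
  shows "isometric_copy e K H (transport e K H)"
proof -
  interpret complex_inner_space H by fact
  show ?thesis using assms(2,3)
    by (auto simp: isometric_copy_def transport_def closed_subspace_def the_inv_into_f_f)
qed

lemma hilbert_space_transport:
  assumes "hilbert_space H" and K: "complex_inner_space.closed_subspace H K" and inj: "inj_on e K"
  shows "hilbert_space (transport e K H)"
proof -
  interpret H: hilbert_space H by fact
  interpret MH: Metric_space "carrier H" "vdist H" by (rule H.Metric_space_vdist)
  let ?T = "transport e K H" and ?g = "the_inv_into K e"
  have KH: "x \<in> carrier H" if "x \<in> K" for x using K that by (auto simp: H.closed_subspace_def)
  have K0: "\<zero>\<^bsub>H\<^esub> \<in> K" and Kadd: "x \<oplus>\<^bsub>H\<^esub> y \<in> K" and Ksm: "c \<odot>\<^bsub>H\<^esub> x \<in> K"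
    if "x \<in> K" "y \<in> K" for x y c using K that by (auto simp: H.closed_subspace_def)
  have K0: "\<zero>\<^bsub>H\<^esub> \<in> K" using K by (auto simp: H.closed_subspace_def)
  have g: "?g (e x) = x" if "x \<in> K" for x using inj that by (simp add: the_inv_into_f_f)
  have add: "e x \<oplus>\<^bsub>?T\<^esub> e y = e (x \<oplus>\<^bsub>H\<^esub> y)" if "x \<in> K" "y \<in> K" for x y
    using that by (simp add: transport_def g)
  have sm: "c \<odot>\<^bsub>?T\<^esub> e x = e (c \<odot>\<^bsub>H\<^esub> x)" if "x \<in> K" for x c
    using that by (simp add: transport_def g)
  have car: "carrier ?T = e ` K" and zero: "\<zero>\<^bsub>?T\<^esub> = e \<zero>\<^bsub>H\<^esub>" by (simp_all add: transport_def)
  have nrm: "vnorm ?T (e x) = vnorm H x" if "x \<in> K" for x using that by (simp add: transport_def g)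
  have inn: "cinner ?T (e x) (e y) = cinner H x y" if "x \<in> K" "y \<in> K" for x y
    using that by (simp add: transport_def g)
  have ag: "abelian_group ?T"
  proof (rule abelian_groupI)
    fix x assume "x \<in> carrier ?T"
    then obtain k where k: "x = e k" "k \<in> K" by (auto simp: car)
    have "(-1) \<odot>\<^bsub>H\<^esub> k \<oplus>\<^bsub>H\<^esub> k = \<zero>\<^bsub>H\<^esub>"
      using H.l_neg[OF KH] H.minus_eq_smult[OF KH] k by simp
    then have "e ((-1) \<odot>\<^bsub>H\<^esub> k) \<oplus>\<^bsub>?T\<^esub> x = \<zero>\<^bsub>?T\<^esub>"
      using k Ksm by (simp add: add zero)
    then show "\<exists>y\<in>carrier ?T. y \<oplus>\<^bsub>?T\<^esub> x = \<zero>\<^bsub>?T\<^esub>"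
      using k Ksm by (auto simp: car)
  next
    show "x \<oplus>\<^bsub>?T\<^esub> y = y \<oplus>\<^bsub>?T\<^esub> x" if "x \<in> carrier ?T" "y \<in> carrier ?T" for x y
      using that by (auto simp: car add KH H.a_comm)
  qed (auto simp: car zero add Kadd K0 KH H.a_assoc)
  interpret T: Module.module complex_ring ?T
    by (rule moduleI[OF cring_complex_ring ag])
      (auto simp: car add sm Kadd Ksm KH H.smult_plus H.smult_r_distr H.smult_mult)
  interpret T: complex_inner_space ?T
  proof
    show "0 < Re (cinner ?T x x)" if x: "x \<in> carrier ?T" "x \<noteq> \<zero>\<^bsub>?T\<^esub>" for x
    proof -
      obtain k where k: "x = e k" "k \<in> K" using x by (auto simp: car)
      then have "k \<noteq> \<zero>\<^bsub>H\<^esub>" using x by (auto simp: zero)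
      then show ?thesis using H.cinner_pos[of k] k KH by (simp add: inn)
    qed
    show "cinner ?T x y = cnj (cinner ?T y x)" if "x \<in> carrier ?T" "y \<in> carrier ?T" for x y
    proof -
      obtain k l where kl: "x = e k" "k \<in> K" "y = e l" "l \<in> K"
        using \<open>x \<in> carrier ?T\<close> \<open>y \<in> carrier ?T\<close> by (auto simp: car)
      then show ?thesis using H.cinner_commute[OF KH KH, of k l] by (simp add: inn)
    qed
  qed (auto simp: car add sm inn nrm Kadd Ksm KH H.cinner_add_left H.cinner_smult_left H.vnorm_eq)
  interpret MT: Metric_space "carrier ?T" "vdist ?T" by (rule T.Metric_space_vdist)
  have minus: "e x \<ominus>\<^bsub>?T\<^esub> e y = e (x \<ominus>\<^bsub>H\<^esub> y) \<and> x \<ominus>\<^bsub>H\<^esub> y \<in> K" if "x \<in> K" "y \<in> K" for x y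
    using that by (simp add: a_minus_def T.minus_eq_smult H.minus_eq_smult car sm add Ksm Kadd KH)
  have dist: "vdist ?T (e x) (e y) = vdist H x y" if "x \<in> K" "y \<in> K" for x y
    using that minus KH by (simp add: vdist_def car nrm)
  show ?thesis
  proof
    show "Metric_space.mcomplete (carrier ?T) (vdist ?T)"
      unfolding MT.mcomplete_def
    proof (intro allI impI)
      fix \<sigma> assume \<sigma>: "MT.MCauchy \<sigma>"
      define \<tau> where "\<tau> n = ?g (\<sigma> n)" for n
      have ran: "\<sigma> n \<in> e ` K" for n using \<sigma> unfolding MT.MCauchy_def by (auto simp: car)
      have \<tau>: "\<tau> n \<in> K" "\<sigma> n = e (\<tau> n)" for n
      proof -
        obtain k where "\<sigma> n = e k" "k \<in> K" using ran by blast
        then show "\<tau> n \<in> K" "\<sigma> n = e (\<tau> n)" by (simp_all add: \<tau>_def g)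
      qed
      have "MH.MCauchy \<tau>"
        using \<sigma> \<tau> KH unfolding MH.MCauchy_def MT.MCauchy_def by (auto simp: dist)
      then obtain x where lim: "limitin MH.mtopology \<tau> x sequentially"
        using H.complete unfolding MH.mcomplete_def by blast
      then have x: "x \<in> carrier H" using MH.limitin_mspace by blast
      have lim0: "(\<lambda>n. vdist H (\<tau> n) x) \<longlonglongrightarrow> 0"
        using lim by (simp add: MH.limitin_metric_dist_null)
      moreover have "vdist H (\<tau> n) x = vnorm H (\<tau> n \<ominus>\<^bsub>H\<^esub> x)" for n
        using x \<tau> KH by (simp add: vdist_def)
      ultimately have "(\<lambda>n. vnorm H (\<tau> n \<ominus>\<^bsub>H\<^esub> x)) \<longlonglongrightarrow> 0" by simp
      moreover have "range \<tau> \<subseteq> K" using \<tau>(1) by blast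
      ultimately have "x \<in> K"
        using K x unfolding H.closed_subspace_def by blast
      then have "limitin MT.mtopology \<sigma> (e x) sequentially"
        unfolding MT.limitin_metric_dist_null using lim0 \<tau> by (simp add: car dist)
      then show "\<exists>x. limitin MT.mtopology \<sigma> x sequentially" by blast
    qed
  qed
qed


lemma hilbert_space_complex_space:
  assumes "inj j"
  shows "hilbert_space (complex_space j)"
proof -
  let ?C = "complex_space j"
  have car: "carrier ?C = range j" and zero: "\<zero>\<^bsub>?C\<^esub> = j 0"
    and add: "j x \<oplus>\<^bsub>?C\<^esub> j y = j (x + y)" and sm: "c \<odot>\<^bsub>?C\<^esub> j x = j (c * x)"
    and nrm: "vnorm ?C (j x) = cmod x" and inn: "cinner ?C (j x) (j y) = x * cnj y" for x y c
    using assms by (simp_all add: complex_space_def inv_f_f)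
  have ag: "abelian_group ?C"
  proof (rule abelian_groupI)
    fix x assume "x \<in> carrier ?C"
    then obtain k where k: "x = j k" by (auto simp: car)
    then have "j (- k) \<oplus>\<^bsub>?C\<^esub> x = \<zero>\<^bsub>?C\<^esub>" by (simp add: add zero)
    then show "\<exists>y\<in>carrier ?C. y \<oplus>\<^bsub>?C\<^esub> x = \<zero>\<^bsub>?C\<^esub>"
      by (auto simp: car)
  qed (auto simp: car zero add ac_simps)
  interpret T: Module.module complex_ring ?C
    by (rule moduleI[OF cring_complex_ring ag]) (auto simp: car add sm algebra_simps)
  interpret T: complex_inner_space ?C
  proof
    show "vnorm ?C x = sqrt (Re (cinner ?C x x))" if "x \<in> carrier ?C" for x
      using that by (auto simp: car nrm inn cmod_def power2_eq_square)
    show "0 < Re (cinner ?C x x)" if x: "x \<in> carrier ?C" "x \<noteq> \<zero>\<^bsub>?C\<^esub>" for x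
    proof -
      obtain k where k: "x = j k" using x by (auto simp: car)
      then have "k \<noteq> 0" using x by (auto simp: zero)
      then have "0 < (cmod k)\<^sup>2" by simp
      then have "0 < (Re k)\<^sup>2 + (Im k)\<^sup>2" by (simp only: cmod_power2)
      then show ?thesis
        by (simp add: k inn power2_eq_square)
    qed
  qed (auto simp: car add sm inn algebra_simps)
  interpret MT: Metric_space "carrier ?C" "vdist ?C" by (rule T.Metric_space_vdist)
  have minus: "j x \<ominus>\<^bsub>?C\<^esub> j y = j (x - y)" for x y
    using T.minus_eq_smult[of "j y"] by (simp add: a_minus_def car sm add)
  have dist: "vdist ?C (j x) (j y) = dist x y" for x y
    by (simp add: vdist_def car minus nrm dist_norm)
  show ?thesis
  proof
    show "Metric_space.mcomplete (carrier ?C) (vdist ?C)"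
      unfolding MT.mcomplete_def
    proof (intro allI impI)
      fix \<sigma> assume \<sigma>: "MT.MCauchy \<sigma>"
      then have "range \<sigma> \<subseteq> range j" unfolding MT.MCauchy_def by (simp add: car)
      then have "\<forall>n. \<exists>x. \<sigma> n = j x" by blast
      then obtain \<tau> where \<tau>: "\<And>n. \<sigma> n = j (\<tau> n)" by metis
      have "Cauchy \<tau>"
        using \<sigma> unfolding MT.MCauchy_def Cauchy_def by (simp add: \<tau> dist)
      then obtain x where "\<tau> \<longlonglongrightarrow> x" by (auto simp: Cauchy_convergent_iff convergent_def)
      then have "limitin MT.mtopology \<sigma> (j x) sequentially"
        unfolding MT.limitin_metric_dist_null
        using tendsto_dist_iff[of \<tau> x sequentially] by (simp add: car \<tau> dist)
      then show "\<exists>x. limitin MT.mtopology \<sigma> x sequentially" by blast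
    qed
  qed
qed

lemma bounded_op_nonneg_bound:
  assumes "complex_inner_space H" "bounded_op H H' T"
  obtains C where "0 \<le> C" "\<forall>x\<in>carrier H. vnorm H' (T x) \<le> C * vnorm H x"
proof -
  interpret complex_inner_space H by fact
  obtain C where C: "\<forall>x\<in>carrier H. vnorm H' (T x) \<le> C * vnorm H x"
    using assms(2) unfolding bounded_op_def by blast
  have "vnorm H' (T x) \<le> max 0 C * vnorm H x" if "x \<in> carrier H" for x
  proof -
    have "C * vnorm H x \<le> max 0 C * vnorm H x"
      using vnorm_nonneg[OF that] by (intro mult_right_mono) auto
    then show ?thesis using C that by fastforce
  qed
  then show thesis by (intro that[of "max 0 C"]) auto
qed

lemma opnorm_nonneg:
  assumes "complex_inner_space H" "bounded_op H H' T"
  shows "0 \<le> opnorm H H' T"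
proof -
  obtain C where "0 \<le> C" "\<forall>x\<in>carrier H. vnorm H' (T x) \<le> C * vnorm H x"
    using bounded_op_nonneg_bound[OF assms] .
  then show ?thesis unfolding opnorm_def by (intro cInf_greatest) auto
qed

lemma isometric_copy_op:
  assumes H: "complex_inner_space H" and T: "bounded_op H H' T" and TK: "T \<in> K \<rightarrow> K'"
    and iso: "isometric_copy e K H L" and iso': "isometric_copy e' K' H' L'"
  defines "S \<equiv> e' \<circ> T \<circ> the_inv_into K e"
  shows "bounded_op L L' S" and "opnorm L L' S \<le> opnorm H H' T"
    and "x \<in> K \<Longrightarrow> S (e x) = e' (T x)"
proof -
  have S: "S (e x) = e' (T x)" if "x \<in> K" for x
    using iso that by (simp add: S_def isometric_copy_def the_inv_into_f_f)
  then show "x \<in> K \<Longrightarrow> S (e x) = e' (T x)" .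
  have KH: "K \<subseteq> carrier H" and car: "carrier L = e ` K" "carrier L' = e' ` K'"
    using iso iso' by (auto simp: isometric_copy_def)
  have nrm: "vnorm L (e x) = vnorm H x" "vnorm L' (S (e x)) = vnorm H' (T x)" if "x \<in> K" for x
    using iso iso' TK that S by (auto simp: isometric_copy_def Pi_def)
  obtain C where C: "0 \<le> C" "\<forall>x\<in>carrier H. vnorm H' (T x) \<le> C * vnorm H x"
    using bounded_op_nonneg_bound[OF H T] .
  have "S (e x \<oplus>\<^bsub>L\<^esub> e y) = S (e x) \<oplus>\<^bsub>L'\<^esub> S (e y)" if xy: "x \<in> K" "y \<in> K" for x y
  proof -
    have *: "e x \<oplus>\<^bsub>L\<^esub> e y = e (x \<oplus>\<^bsub>H\<^esub> y)" "x \<oplus>\<^bsub>H\<^esub> y \<in> K"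
      using iso xy unfolding isometric_copy_def by metis+
    have "T (x \<oplus>\<^bsub>H\<^esub> y) = T x \<oplus>\<^bsub>H'\<^esub> T y"
      using T xy KH unfolding bounded_op_def by blast
    moreover have "e' (T x \<oplus>\<^bsub>H'\<^esub> T y) = e' (T x) \<oplus>\<^bsub>L'\<^esub> e' (T y)"
      using iso' TK xy unfolding isometric_copy_def by blast
    ultimately show ?thesis using * xy by (simp add: S)
  qed
  moreover have "S (c \<odot>\<^bsub>L\<^esub> e x) = c \<odot>\<^bsub>L'\<^esub> S (e x)" if x: "x \<in> K" for c x
  proof -
    have *: "c \<odot>\<^bsub>L\<^esub> e x = e (c \<odot>\<^bsub>H\<^esub> x)" "c \<odot>\<^bsub>H\<^esub> x \<in> K"
      using iso x unfolding isometric_copy_def by metis+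
    have "T (c \<odot>\<^bsub>H\<^esub> x) = c \<odot>\<^bsub>H'\<^esub> T x"
      using T x KH unfolding bounded_op_def by blast
    moreover have "e' (c \<odot>\<^bsub>H'\<^esub> T x) = c \<odot>\<^bsub>L'\<^esub> e' (T x)"
      using iso' TK x unfolding isometric_copy_def by blast
    ultimately show ?thesis using * x by (simp add: S)
  qed
  moreover have "S (e x) \<in> e' ` K'" if "x \<in> K" for x
    using TK that by (auto simp: S)
  moreover have "vnorm L' (S (e x)) \<le> C * vnorm L (e x)" if "x \<in> K" for x
    using that C(2) KH by (auto simp: nrm)
  ultimately show "bounded_op L L' S"
    unfolding bounded_op_def car by blast
  show "opnorm L L' S \<le> opnorm H H' T"
    unfolding opnorm_def
  proof (rule cInf_superset_mono)
    show "{C. 0 \<le> C \<and> (\<forall>x\<in>carrier H. vnorm H' (T x) \<le> C * vnorm H x)} \<noteq> {}"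
      using C by blast
    show "bdd_below {C. 0 \<le> C \<and> (\<forall>x\<in>carrier L. vnorm L' (S x) \<le> C * vnorm L x)}"
      by (auto intro: bdd_belowI)
    show "{C. 0 \<le> C \<and> (\<forall>x\<in>carrier H. vnorm H' (T x) \<le> C * vnorm H x)} \<subseteq>
      {C. 0 \<le> C \<and> (\<forall>x\<in>carrier L. vnorm L' (S x) \<le> C * vnorm L x)}"
      using KH by (auto simp: car nrm)
  qed
qed

text \<open>The restriction of \<open>'h\<close> to \<^typ>\<open>'g universe\<close> loses nothing: a decomposition through arbitrary
  Hilbert spaces \<open>H i\<close> can be compressed, without increasing the norms, to the closed spans of the
  vectors \<open>\<xi>\<^sub>i\<^sub>+\<^sub>1(t\<^sub>i\<^sub>+\<^sub>1) \<cdots> \<xi>\<^sub>d(t\<^sub>d) 1\<close>, and a vector in such a span is determined by its inner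
  products with these vectors, which are indexed by lists of group elements.\<close>

lemma Md_decomposition_universe:
  fixes G :: "('g, 'b) monoid_scheme" and H :: "nat \<Rightarrow> (complex + 'h) chilbert"
  assumes G: "group G" and D: "Md_decomposition G d \<phi> H \<xi>"
  shows "\<exists>(H' :: nat \<Rightarrow> (complex + 'g universe) chilbert) \<xi>'.
    Md_decomposition G d \<phi> H' \<xi>' \<and> Md_cost G d H' \<xi>' \<le> Md_cost G d H \<xi>"
proof -
  interpret group G by fact
  let ?C = "complex_space Inl :: (complex + 'h) chilbert"
  let ?C' = "complex_space Inl :: (complex + 'g universe) chilbert"
  have hil: "hilbert_space (H i)" if "i \<le> d" for i
    using D that by (auto simp: Md_decomposition_def)
  have inn: "complex_inner_space (H i)" if "i \<le> d" for i
    using hil[OF that] by (simp add: hilbert_space_def)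
  have H0: "H 0 = ?C" and Hd: "H d = ?C"
    using D by (auto simp: Md_decomposition_def)
  have bop: "bounded_op (H i) (H (i - 1)) (\<xi> i t)" if "i \<in> {1..d}" "t \<in> carrier G" for i t
    using D that by (auto simp: Md_decomposition_def)
  have bdd: "bdd_above ((\<lambda>t. opnorm (H i) (H (i - 1)) (\<xi> i t)) ` carrier G)" if "i \<in> {1..d}" for i
    using D that by (auto simp: Md_decomposition_def)
  define adm where "adm t \<longleftrightarrow> (\<forall>i\<in>{1..d}. t i \<in> carrier G)" for t :: "nat \<Rightarrow> 'g"
  define V where "V i t = foldr (\<lambda>j. \<xi> j (t j)) [Suc i..<Suc d] (Inl 1)" for i t
  have fact: "V 0 t = Inl (\<phi> (foldr (\<lambda>i x. t i \<otimes>\<^bsub>G\<^esub> x) [1..<Suc d] \<one>\<^bsub>G\<^esub>))" if "adm t" for t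
    using D that by (auto simp: Md_decomposition_def V_def adm_def)
  have Vd: "V d t = Inl 1" for t by (simp add: V_def)
  have VSuc: "V i t = \<xi> (Suc i) (t (Suc i)) (V (Suc i) t)" if "i < d" for i t
    using that by (simp add: V_def upt_conv_Cons del: upt_Suc)
  have Vcong: "V i t = V i t'" if "\<And>j. j \<in> {Suc i..d} \<Longrightarrow> t j = t' j" for i t t'
    unfolding V_def by (rule foldr_cong) (use that in auto)
  have Cinl: "Inl c \<in> carrier ?C" "carrier ?C = range Inl" for c by (auto simp: complex_space_def)
  have Vcar: "V i t \<in> carrier (H i)" if "i \<le> d" "adm t" for i t
    using that(1)
  proof (induction rule: inc_induct)
    case base then show ?case by (simp add: Vd Hd Cinl)
  next
    case (step i)
    then show ?case
      using bop[of "Suc i" "t (Suc i)"] that(2) by (auto simp: VSuc bounded_op_def adm_def)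
  qed
  define W where "W i = V i ` Collect adm" for i
  have W: "W i \<subseteq> carrier (H i)" if "i \<le> d" for i
    using Vcar[OF that] by (auto simp: W_def)
  define K where "K i = (if i = 0 \<or> i = d then carrier (H i)
    else complex_inner_space.closed_span (H i) (W i))" for i
  have K: "complex_inner_space.closed_subspace (H i) (K i)" if "i \<le> d" for i
    using complex_inner_space.closed_subspace_carrier[OF inn[OF that]]
      complex_inner_space.closed_subspace_span[OF inn[OF that] W[OF that]] by (simp add: K_def)
  have VK: "V i t \<in> K i" if "i \<le> d" "adm t" for i t
    using that Vcar[OF that] complex_inner_space.closed_span_superset[OF inn[OF that(1)], of "W i"]
    by (auto simp: K_def W_def)
  have \<xi>K: "\<xi> i t \<in> K i \<rightarrow> K (i - 1)" if i: "i \<in> {1..d}" and t: "t \<in> carrier G" for i t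
  proof -
    interpret H: complex_inner_space "H i" using i by (intro inn) auto
    define P where "P = {x \<in> carrier (H i). \<xi> i t x \<in> K (i - 1)}"
    have P: "H.closed_subspace P"
      unfolding P_def using i t
      by (intro closed_subspace_vimage[where H' = "H (i - 1)"] inn bop K) auto
    have WP: "W i \<subseteq> P"
    proof
      fix x assume "x \<in> W i"
      then obtain l where l: "adm l" "x = V i l" by (auto simp: W_def)
      have l': "adm (l(i := t))" using l t by (auto simp: adm_def)
      have "V (i - 1) (l(i := t)) = \<xi> i t (V i (l(i := t)))"
        using VSuc[of "i - 1" "l(i := t)"] i Suc_pred[of i] by (auto simp: less_eq_Suc_le)
      also have "V i (l(i := t)) = V i l" by (rule Vcong) auto
      finally have "\<xi> i t x = V (i - 1) (l(i := t))" by (simp only: l)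
      then show "x \<in> P"
        using VK[of "i - 1" "l(i := t)"] Vcar[of i l] l l' i by (auto simp: P_def)
    qed
    have "K i \<subseteq> P"
    proof (cases "i = d")
      case True
      have "Inl 1 \<in> W i" using True t by (auto simp: W_def Vd adm_def intro!: image_eqI[of _ _ "\<lambda>_. t"])
      then have "Inl 1 \<in> P" using WP by blast
      then have "c \<odot>\<^bsub>H i\<^esub> Inl 1 \<in> P" for c using P by (auto simp: H.closed_subspace_def)
      moreover have "c \<odot>\<^bsub>H i\<^esub> Inl 1 = Inl c" for c
        using True by (simp add: Hd complex_space_def inv_f_f)
      ultimately show ?thesis using True by (auto simp: K_def Hd Cinl)
    next
      case False
      then show ?thesis using i H.closed_span_least[OF P WP] by (auto simp: K_def)
    qed
    then show ?thesis by (auto simp: P_def)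
  qed
  define e :: "nat \<Rightarrow> complex + 'h \<Rightarrow> complex + 'g universe" where
    "e i x = (if i = 0 \<or> i = d then (case x of Inl c \<Rightarrow> Inl c | Inr _ \<Rightarrow> Inl 0)
       else Inr (\<lambda>l. if adm (\<lambda>j. l ! j) then cinner (H i) x (V i (\<lambda>j. l ! j)) else 0))" for i x
  define H' where "H' i = (if i = 0 \<or> i = d then ?C' else transport (e i) (K i) (H i))" for i
  have einj: "inj_on (e i) (K i)" if i: "i \<le> d" "\<not> (i = 0 \<or> i = d)" for i
  proof (rule inj_onI)
    interpret H: complex_inner_space "H i" using i by (intro inn) auto
    fix x y assume xy: "x \<in> K i" "y \<in> K i" and eq: "e i x = e i y"
    have car: "x \<in> carrier (H i)" "y \<in> carrier (H i)"
      using xy K[OF i(1)] by (auto simp: H.closed_subspace_def)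
    have "x \<ominus>\<^bsub>H i\<^esub> y \<in> K i"
      using xy K[OF i(1)] car by (simp add: H.closed_subspace_def a_minus_def H.minus_eq_smult)
    moreover have "cinner (H i) (x \<ominus>\<^bsub>H i\<^esub> y) w = 0" if w: "w \<in> W i" for w
    proof -
      obtain t where t: "adm t" "w = V i t" using w by (auto simp: W_def)
      define l where "l = map t [0..<Suc d]"
      have lt: "l ! j = t j" if "j \<le> d" for j
        using that by (simp add: l_def del: upt_Suc)
      have l: "adm (\<lambda>j. l ! j)" using t lt by (auto simp: adm_def)
      have wl: "w = V i (\<lambda>j. l ! j)" unfolding t by (rule Vcong) (simp add: lt)
      have "cinner (H i) x w = cinner (H i) y w"
        using eq i(2) l by (auto simp: e_def wl dest!: fun_cong[of _ _ l])
      moreover have "w \<in> carrier (H i)" using Vcar[OF i(1) t(1)] by (simp add: t)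
      ultimately show ?thesis using car
        by (simp add: a_minus_def H.cinner_add_left H.minus_eq_smult H.cinner_smult_left)
    qed
    ultimately have "x \<ominus>\<^bsub>H i\<^esub> y = \<zero>\<^bsub>H i\<^esub>"
      using H.closed_span_orthogonal[OF W[OF i(1)]] i by (simp add: K_def)
    then show "x = y" using H.minus_eq_zero_iff car by simp
  qed
  have iso: "isometric_copy (e i) (K i) (H i) (H' i)" if i: "i \<le> d" for i
  proof (cases "i = 0 \<or> i = d")
    case True
    then have "H i = ?C" using H0 Hd by auto
    then show ?thesis using True
      by (auto simp: isometric_copy_def K_def H'_def e_def complex_space_def inv_f_f inj_on_def
          image_image)
  next
    case False
    then show ?thesis
      using isometric_copy_transport[OF inn[OF i] K[OF i] einj[OF i False]] by (simp add: H'_def)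
  qed
  have hil': "hilbert_space (H' i)" if i: "i \<le> d" for i
    using hilbert_space_complex_space[of Inl] hilbert_space_transport[OF hil[OF i] K[OF i] einj[OF i]]
    by (auto simp: H'_def)
  define \<xi>' where "\<xi>' i t = e (i - 1) \<circ> \<xi> i t \<circ> the_inv_into (K i) (e i)" for i t
  have op: "bounded_op (H' i) (H' (i - 1)) (\<xi>' i t)"
      "opnorm (H' i) (H' (i - 1)) (\<xi>' i t) \<le> opnorm (H i) (H (i - 1)) (\<xi> i t)"
      "x \<in> K i \<Longrightarrow> \<xi>' i t (e i x) = e (i - 1) (\<xi> i t x)"
    if "i \<in> {1..d}" "t \<in> carrier G" for i t x
  proof -
    have "i \<le> d" "i - 1 \<le> d" using that by auto
    note * = isometric_copy_op[OF inn[OF this(1)] bop[OF that] \<xi>K[OF that] iso[OF this(1)] iso[OF this(2)]]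
    show "bounded_op (H' i) (H' (i - 1)) (\<xi>' i t)"
        "opnorm (H' i) (H' (i - 1)) (\<xi>' i t) \<le> opnorm (H i) (H (i - 1)) (\<xi> i t)"
        "x \<in> K i \<Longrightarrow> \<xi>' i t (e i x) = e (i - 1) (\<xi> i t x)"
      unfolding \<xi>'_def by (fact *)+
  qed
  have fold: "foldr (\<lambda>j. \<xi>' j (t j)) [Suc i..<Suc d] (Inl 1) = e i (V i t)"
    if "i \<le> d" "adm t" for i t
    using that(1)
  proof (induction rule: inc_induct)
    case base then show ?case by (simp add: Vd e_def)
  next
    case (step i)
    have "[Suc i..<Suc d] = Suc i # [Suc (Suc i)..<Suc d]"
      using step by (simp add: upt_conv_Cons del: upt_Suc)
    then have "foldr (\<lambda>j. \<xi>' j (t j)) [Suc i..<Suc d] (Inl 1) = \<xi>' (Suc i) (t (Suc i)) (e (Suc i) (V (Suc i) t))"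
      using step by (simp del: upt_Suc)
    also have "\<dots> = e i (V i t)"
      using op(3)[of "Suc i" "t (Suc i)" "V (Suc i) t"] VK[of "Suc i" t] step that(2)
      by (simp add: VSuc adm_def)
    finally show ?case .
  qed
  have bdd': "bdd_above ((\<lambda>t. opnorm (H' i) (H' (i - 1)) (\<xi>' i t)) ` carrier G)"
    if i: "i \<in> {1..d}" for i
  proof -
    obtain M where "\<And>t. t \<in> carrier G \<Longrightarrow> opnorm (H i) (H (i - 1)) (\<xi> i t) \<le> M"
      using bdd[OF i] by (auto simp: bdd_above_def)
    then show ?thesis using op(2)[OF i] by (intro bdd_aboveI2[of _ _ M]) (meson order_trans)
  qed
  have "Md_decomposition G d \<phi> H' \<xi>'"
    unfolding Md_decomposition_def
  proof (intro conjI ballI allI impI)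
    fix t assume "\<forall>i\<in>{1..d}. t i \<in> carrier G"
    then have t: "adm t" by (simp add: adm_def)
    show "foldr (\<lambda>i. \<xi>' i (t i)) [1..<Suc d] (Inl 1) =
        Inl (\<phi> (foldr (\<lambda>i x. t i \<otimes>\<^bsub>G\<^esub> x) [1..<Suc d] \<one>\<^bsub>G\<^esub>))"
      using fold[OF _ t, of 0] fact[OF t] by (simp add: e_def del: upt_Suc)
  qed (use hil' op(1) bdd' in \<open>auto simp: H'_def\<close>)
  moreover have "Md_cost G d H' \<xi>' \<le> Md_cost G d H \<xi>"
    unfolding Md_cost_def
  proof (intro prod_mono conjI)
    fix i assume i: "i \<in> {1..d}"
    have "complex_inner_space (H' i)" using hil'[of i] i by (simp add: hilbert_space_def)
    then have "0 \<le> opnorm (H' i) (H' (i - 1)) (\<xi>' i \<one>\<^bsub>G\<^esub>)"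
      using op(1)[OF i] by (intro opnorm_nonneg) auto
    also have "\<dots> \<le> (SUP t\<in>carrier G. opnorm (H' i) (H' (i - 1)) (\<xi>' i t))"
      by (intro cSUP_upper bdd'[OF i]) auto
    finally show "0 \<le> (SUP t\<in>carrier G. opnorm (H' i) (H' (i - 1)) (\<xi>' i t))" .
    show "(SUP t\<in>carrier G. opnorm (H' i) (H' (i - 1)) (\<xi>' i t))
        \<le> (SUP t\<in>carrier G. opnorm (H i) (H (i - 1)) (\<xi> i t))"
      using op(2)[OF i] bdd[OF i] by (intro cSUP_mono) auto
  qed
  ultimately show ?thesis by blast
qed

end

theory Submission
  imports Defs
begin

text \<open>Extension by zero is a contraction \<open>M\<^sub>d(\<Gamma>) \<rightarrow> M\<^sub>d(G)\<close>: inducing a factorisation of \<open>\<phi>\<close> through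
  Hilbert spaces \<open>H\<^sub>i\<close> from \<open>\<Gamma>\<close> to \<open>G\<close> gives a factorisation of its extension through
  \<open>\<ell>\<^sup>2(G/\<Gamma>; H\<^sub>i)\<close> with the same bounds. By duality, restriction is contractive for the norms of
  \<open>X\<^sub>d(G)\<close> and \<open>X\<^sub>d(\<Gamma>)\<close>, and its norm is attained at the unit mass at the identity, which has norm
  one in both spaces. A multiplier is determined by its functional, since the unit masses lie in
  \<open>\<ell>\<^sup>1(G)\<close>; so the dual map can be read off from the pairing on \<open>\<ell>\<^sup>1(G)\<close>.\<close>

section \<open>Complex normed spaces and their completions\<close>

text \<open>The induced spaces cannot serve as they stand. The two outer ones have to be the complex
  numbers, so the last operator is preceded by the inclusion of the trivial coordinate and the first
  is followed by evaluation there; both are contractions, so the bounds survive. The inner ones live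
  in a type larger than \<open>'g universe\<close>, and \<open>Md_decomposition_universe\<close>
  brings the result back. The norm on l^1 is under control only once there are enough multipliers:
  the pointwise bound by \<open>Md_norm\<close> makes its supremum finite, the constant 1 makes the
  unit ball nonempty, and the indicators of points make it definite. These indicators come from the
  extension by zero itself, taken from the trivial subgroup and then translated. Elements of X_d are
  classes of Cauchy sequences and \<open>Md_functional\<close> is chosen by \<open>THE\<close>, so
  existence and uniqueness of extensions by continuity have to be at hand. The
  \<open>inv_into\<close> in the dual map is evaluated by exhibiting a multiplier with the right
  functional and using injectivity.\<close>

locale complex_normed_space = Module.module complex_ring V
  for V :: "('v, 'm) cnormed_scheme" (structure) +
  assumes vnorm_eq_zero: "\<lbrakk>x \<in> carrier V; vnorm V x = 0\<rbrakk> \<Longrightarrow> x = \<zero>"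
    and vnorm_smult: "x \<in> carrier V \<Longrightarrow> vnorm V (c \<odot> x) = cmod c * vnorm V x"
    and vnorm_triangle: "\<lbrakk>x \<in> carrier V; y \<in> carrier V\<rbrakk>
      \<Longrightarrow> vnorm V (x \<oplus> y) \<le> vnorm V x + vnorm V y"
begin

lemma minus_eq_smult: "x \<in> carrier V \<Longrightarrow> \<ominus> x = (-1) \<odot> x"
  using smult_l_minus[of 1 x] smult_one[of x] by simp

lemma smult_closed' [simp]: "x \<in> carrier V \<Longrightarrow> c \<odot> x \<in> carrier V"
  using smult_closed[of c x] by simp

lemma vnorm_zero [simp]: "vnorm V \<zero> = 0"
  using vnorm_smult[of \<zero> 0] smult_l_null[of \<zero>] by simp

lemma vnorm_a_inv: "x \<in> carrier V \<Longrightarrow> vnorm V (\<ominus> x) = vnorm V x"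
  by (simp add: minus_eq_smult vnorm_smult)

text \<open>The triangle inequality for \<open>x\<close> and its negative gives
  \<open>0 \<le> 2 * vnorm V x\<close>, which is why the locale has no positivity axiom.\<close>

lemma vnorm_nonneg: "x \<in> carrier V \<Longrightarrow> 0 \<le> vnorm V x"
  using vnorm_triangle[of x "\<ominus> x"] by (simp add: vnorm_a_inv r_neg)

lemma minus_eq_zero_iff:
  assumes "x \<in> carrier V" "y \<in> carrier V"
  shows "x \<ominus> y = \<zero> \<longleftrightarrow> x = y"
proof
  assume *: "x \<ominus> y = \<zero>"
  have "x = (x \<ominus> y) \<oplus> y" using assms by (simp add: a_minus_def a_assoc l_neg)
  then show "x = y" using * assms by simp
qed (use assms in \<open>simp add: a_minus_def r_neg\<close>)

lemma vdist_eq: "\<lbrakk>x \<in> carrier V; y \<in> carrier V\<rbrakk> \<Longrightarrow> vdist V x y = vnorm V (x \<ominus> y)"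
  by (simp add: vdist_def)

lemma Metric_space_vdist: "Metric_space (carrier V) (vdist V)"
proof
  show "0 \<le> vdist V x y" for x y
    by (simp add: vdist_def vnorm_nonneg)
  show "vdist V x y = vdist V y x" for x y
  proof (cases "x \<in> carrier V \<and> y \<in> carrier V")
    case True
    then have "y \<ominus> x = \<ominus> (x \<ominus> y)"
      by (simp add: a_minus_def minus_add a_comm)
    then show ?thesis using True by (simp add: vdist_def vnorm_a_inv)
  qed (auto simp: vdist_def)
  show "vdist V x y = 0 \<longleftrightarrow> x = y" if "x \<in> carrier V" "y \<in> carrier V" for x y
  proof
    assume "vdist V x y = 0"
    then show "x = y" using that vnorm_eq_zero[of "x \<ominus> y"] by (simp add: vdist_eq minus_eq_zero_iff)
  next
    assume "x = y"
    then have "x \<ominus> y = \<zero>" using that by (simp add: minus_eq_zero_iff)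
    then show "vdist V x y = 0" using that by (simp add: vdist_eq)
  qed
  show "vdist V x z \<le> vdist V x y + vdist V y z"
    if "x \<in> carrier V" "y \<in> carrier V" "z \<in> carrier V" for x y z
  proof -
    have "x \<ominus> z = (x \<ominus> y) \<oplus> (y \<ominus> z)"
      using that by (simp add: a_minus_def a_assoc r_neg1)
    then show ?thesis using that vnorm_triangle[of "x \<ominus> y" "y \<ominus> z"]
      by (simp add: vdist_def)
  qed
qed

sublocale M: Metric_space "carrier V" "vdist V"
  by (rule Metric_space_vdist)

lemma vdist_zero_right: "x \<in> carrier V \<Longrightarrow> vdist V x \<zero> = vnorm V x"
  by (simp add: vdist_eq a_minus_def minus_eq_smult smult_r_null)

lemma vdist_add_le:
  assumes "x \<in> carrier V" "y \<in> carrier V" "x' \<in> carrier V" "y' \<in> carrier V"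
  shows "vdist V (x \<oplus> y) (x' \<oplus> y') \<le> vdist V x x' + vdist V y y'"
proof -
  have "(x \<oplus> y) \<ominus> (x' \<oplus> y') = (x \<ominus> x') \<oplus> (y \<ominus> y')"
    using assms by (simp add: a_minus_def minus_add a_ac)
  then show ?thesis using assms vnorm_triangle[of "x \<ominus> x'" "y \<ominus> y'"] by (simp add: vdist_eq)
qed

lemma vdist_smult:
  assumes "x \<in> carrier V" "y \<in> carrier V"
  shows "vdist V (c \<odot> x) (c \<odot> y) = cmod c * vdist V x y"
proof -
  have "c \<odot> x \<ominus> c \<odot> y = c \<odot> (x \<ominus> y)"
    using assms by (simp add: a_minus_def smult_r_distr smult_r_minus)
  then show ?thesis using assms by (simp add: vdist_eq vnorm_smult)
qed

lemma abs_vnorm_diff_le: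
  assumes "x \<in> carrier V" "y \<in> carrier V"
  shows "\<bar>vnorm V x - vnorm V y\<bar> \<le> vdist V x y"
  using M.mdist_reverse_triangle[of x \<zero> y] M.triangle[of x y \<zero>] M.triangle[of y x \<zero>]
    M.commute[of x y] assms
  by (simp add: vdist_zero_right)

lemma cauchy_seqs_iff: "u \<in> cauchy_seqs V \<longleftrightarrow>
    range u \<subseteq> carrier V \<and> (\<forall>\<epsilon>>0. \<exists>N. \<forall>n\<ge>N. \<forall>m\<ge>N. vdist V (u n) (u m) < \<epsilon>)"
  unfolding cauchy_seqs_def M.MCauchy_def by auto

lemma cauchy_seqsD: "u \<in> cauchy_seqs V \<Longrightarrow> u n \<in> carrier V"
  by (auto simp: cauchy_seqs_iff)

lemma cauchy_seqs_const: "x \<in> carrier V \<Longrightarrow> (\<lambda>n. x) \<in> cauchy_seqs V"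
  by (auto simp: cauchy_seqs_iff)

lemma cauchy_seqs_add:
  assumes "u \<in> cauchy_seqs V" "v \<in> cauchy_seqs V"
  shows "(\<lambda>n. u n \<oplus> v n) \<in> cauchy_seqs V"
  unfolding cauchy_seqs_iff
proof (intro conjI allI impI)
  show "range (\<lambda>n. u n \<oplus> v n) \<subseteq> carrier V"
    using assms by (auto simp: cauchy_seqsD)
  fix \<epsilon> :: real assume "0 < \<epsilon>"
  then have e: "0 < \<epsilon> / 2" by simp
  obtain N1 where N1: "\<forall>n\<ge>N1. \<forall>m\<ge>N1. vdist V (u n) (u m) < \<epsilon> / 2"
    using assms(1) e unfolding cauchy_seqs_iff by blast
  obtain N2 where N2: "\<forall>n\<ge>N2. \<forall>m\<ge>N2. vdist V (v n) (v m) < \<epsilon> / 2"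
    using assms(2) e unfolding cauchy_seqs_iff by blast
  show "\<exists>N. \<forall>n\<ge>N. \<forall>m\<ge>N. vdist V (u n \<oplus> v n) (u m \<oplus> v m) < \<epsilon>"
  proof (intro exI[of _ "max N1 N2"] allI impI)
    fix n m assume "max N1 N2 \<le> n" "max N1 N2 \<le> m"
    then have "vdist V (u n) (u m) < \<epsilon> / 2" "vdist V (v n) (v m) < \<epsilon> / 2"
      using N1 N2 by auto
    then show "vdist V (u n \<oplus> v n) (u m \<oplus> v m) < \<epsilon>"
      using vdist_add_le[of "u n" "v n" "u m" "v m"] assms by (simp add: cauchy_seqsD)
  qed
qed

lemma equiv_cauchy_rel: "equiv (cauchy_seqs V) (cauchy_rel V)"
proof (rule equivI)
  show "cauchy_rel V \<subseteq> cauchy_seqs V \<times> cauchy_seqs V" by (auto simp: cauchy_rel_def)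
  show "refl_on (cauchy_seqs V) (cauchy_rel V)"
    by (auto simp: refl_on_def cauchy_rel_def cauchy_seqsD)
  show "sym (cauchy_rel V)"
    by (auto simp: sym_def cauchy_rel_def M.commute)
  show "trans (cauchy_rel V)"
  proof (rule transI)
    fix u v w assume "(u, v) \<in> cauchy_rel V" "(v, w) \<in> cauchy_rel V"
    then have s: "u \<in> cauchy_seqs V" "v \<in> cauchy_seqs V" "w \<in> cauchy_seqs V"
      and l: "(\<lambda>n. vdist V (u n) (v n)) \<longlonglongrightarrow> 0" "(\<lambda>n. vdist V (v n) (w n)) \<longlonglongrightarrow> 0"
      by (auto simp: cauchy_rel_def)
    have "(\<lambda>n. vdist V (u n) (w n)) \<longlonglongrightarrow> 0"
    proof (rule tendsto_sandwich[of "\<lambda>_. 0" _ _ "\<lambda>n. vdist V (u n) (v n) + vdist V (v n) (w n)"])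
      show "(\<lambda>n. vdist V (u n) (v n) + vdist V (v n) (w n)) \<longlonglongrightarrow> 0"
        using tendsto_add[OF l] by simp
    qed (use s in \<open>auto simp: cauchy_seqsD M.triangle\<close>)
    then show "(u, w) \<in> cauchy_rel V" using s by (simp add: cauchy_rel_def)
  qed
qed

abbreviation cls :: "(nat \<Rightarrow> 'v) \<Rightarrow> (nat \<Rightarrow> 'v) set" where
  "cls u \<equiv> cauchy_rel V `` {u}"

lemma completion_carrierI: "u \<in> cauchy_seqs V \<Longrightarrow> cls u \<in> carrier (completion V)"
  by (auto simp: completion_def intro: quotientI)

lemma completion_carrierE:
  assumes "A \<in> carrier (completion V)"
  obtains u where "u \<in> cauchy_seqs V" "A = cls u"
  using assms by (auto simp: completion_def elim: quotientE)

lemma cls_eqI: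
  assumes "(u, v) \<in> cauchy_rel V"
  shows "cls u = cls v"
  using equiv_class_eq[OF equiv_cauchy_rel assms] .

text \<open>The sum in \<open>completion\<close> is a union over all pairs of representatives.
  Replacing a representative changes the termwise sum by a null sequence, so the union is over a
  constant family and collapses to one class.\<close>

lemma completion_add:
  assumes "u \<in> cauchy_seqs V" "v \<in> cauchy_seqs V"
  shows "cls u \<oplus>\<^bsub>completion V\<^esub> cls v = cls (\<lambda>n. u n \<oplus> v n)"
proof -
  have "congruent2 (cauchy_rel V) (cauchy_rel V) (\<lambda>u v. cls (\<lambda>n. u n \<oplus> v n))"
  proof (rule congruent2I')
    fix u u' v v' assume "(u, u') \<in> cauchy_rel V" "(v, v') \<in> cauchy_rel V"
    then have s: "u \<in> cauchy_seqs V" "v \<in> cauchy_seqs V" "u' \<in> cauchy_seqs V" "v' \<in> cauchy_seqs V"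
      and l: "(\<lambda>n. vdist V (u n) (u' n)) \<longlonglongrightarrow> 0" "(\<lambda>n. vdist V (v n) (v' n)) \<longlonglongrightarrow> 0"
      by (auto simp: cauchy_rel_def)
    have "(\<lambda>n. vdist V (u n \<oplus> v n) (u' n \<oplus> v' n)) \<longlonglongrightarrow> 0"
    proof (rule tendsto_sandwich[of "\<lambda>_. 0" _ _ "\<lambda>n. vdist V (u n) (u' n) + vdist V (v n) (v' n)"])
      show "(\<lambda>n. vdist V (u n) (u' n) + vdist V (v n) (v' n)) \<longlonglongrightarrow> 0"
        using tendsto_add[OF l] by simp
    qed (use s in \<open>auto simp: cauchy_seqsD vdist_add_le\<close>)
    then show "cls (\<lambda>n. u n \<oplus> v n) = cls (\<lambda>n. u' n \<oplus> v' n)"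
      using s by (intro cls_eqI) (simp add: cauchy_rel_def cauchy_seqs_add)
  qed
  then show ?thesis
    using UN_equiv_class2[OF equiv_cauchy_rel equiv_cauchy_rel _ assms]
    by (simp add: completion_def)
qed

text \<open>By the reverse triangle inequality the norms along a Cauchy sequence converge, and
  equivalent sequences share the limit; this determines the value that \<open>THE\<close> selects in
  \<open>completion\<close>. Later estimates in the completion are limits of estimates in
  \<open>V\<close> along this convergence.\<close>

lemma completion_vnorm:
  assumes s: "u \<in> cauchy_seqs V"
  shows "(\<lambda>n. vnorm V (u n)) \<longlonglongrightarrow> vnorm (completion V) (cls u)"
proof -
  have "Cauchy (\<lambda>n. vnorm V (u n))"
    unfolding Cauchy_def
  proof (intro allI impI)
    fix \<epsilon> :: real assume "0 < \<epsilon>"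
    then obtain N where N: "\<forall>n\<ge>N. \<forall>m\<ge>N. vdist V (u n) (u m) < \<epsilon>"
      using s unfolding cauchy_seqs_iff by blast
    have "dist (vnorm V (u m)) (vnorm V (u n)) \<le> vdist V (u m) (u n)" for m n
      using abs_vnorm_diff_le[of "u m" "u n"] s by (simp add: cauchy_seqsD dist_real_def)
    then show "\<exists>M. \<forall>m\<ge>M. \<forall>n\<ge>M. dist (vnorm V (u m)) (vnorm V (u n)) < \<epsilon>"
      using N by (meson le_less_trans)
  qed
  then obtain r where r: "(\<lambda>n. vnorm V (u n)) \<longlonglongrightarrow> r"
    by (auto simp: Cauchy_convergent_iff convergent_def)
  have all: "(\<lambda>n. vnorm V (v n)) \<longlonglongrightarrow> r" if "v \<in> cls u" for v
  proof -
    have t: "v \<in> cauchy_seqs V" and l: "(\<lambda>n. vdist V (u n) (v n)) \<longlonglongrightarrow> 0"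
      using that by (auto simp: cauchy_rel_def)
    have "(\<lambda>n. vnorm V (u n) - vnorm V (v n)) \<longlonglongrightarrow> 0"
      by (rule Lim_null_comparison[OF _ l])
        (use s t abs_vnorm_diff_le in \<open>auto simp: cauchy_seqsD\<close>)
    from tendsto_diff[OF r this] show ?thesis by simp
  qed
  have "u \<in> cls u" using equiv_class_self[OF equiv_cauchy_rel s] .
  then have "(THE r. \<forall>v\<in>cls u. (\<lambda>n. vnorm V (v n)) \<longlonglongrightarrow> r) = r"
    using all r by (intro the_equality) (auto intro: LIMSEQ_unique)
  then show ?thesis using r by (simp add: completion_def)
qed

lemma cauchy_seqs_smult:
  assumes "u \<in> cauchy_seqs V"
  shows "(\<lambda>n. c \<odot> u n) \<in> cauchy_seqs V"
  unfolding cauchy_seqs_iff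
proof (intro conjI allI impI)
  show "range (\<lambda>n. c \<odot> u n) \<subseteq> carrier V"
    using assms by (auto simp: cauchy_seqsD)
  fix \<epsilon> :: real assume "0 < \<epsilon>"
  then have e: "0 < \<epsilon> / (cmod c + 1)" by (simp add: add_nonneg_pos)
  obtain N where N: "\<forall>n\<ge>N. \<forall>m\<ge>N. vdist V (u n) (u m) < \<epsilon> / (cmod c + 1)"
    using assms e unfolding cauchy_seqs_iff by blast
  have "cmod c * vdist V (u n) (u m) < \<epsilon>" if "N \<le> n" "N \<le> m" for n m
  proof -
    have "cmod c * vdist V (u n) (u m) \<le> (cmod c + 1) * vdist V (u n) (u m)"
      by (intro mult_right_mono) auto
    also have "\<dots> < \<epsilon>"
      using N that by (simp add: pos_less_divide_eq add_nonneg_pos mult.commute)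
    finally show ?thesis .
  qed
  then show "\<exists>N. \<forall>n\<ge>N. \<forall>m\<ge>N. vdist V (c \<odot> u n) (c \<odot> u m) < \<epsilon>"
    using assms by (auto simp: vdist_smult cauchy_seqsD)
qed

lemma completion_smult:
  assumes "u \<in> cauchy_seqs V"
  shows "c \<odot>\<^bsub>completion V\<^esub> cls u = cls (\<lambda>n. c \<odot> u n)"
proof -
  have "(\<lambda>u. cls (\<lambda>n. c \<odot> u n)) respects cauchy_rel V"
  proof (rule congruentI)
    fix u v assume "(u, v) \<in> cauchy_rel V"
    then have s: "u \<in> cauchy_seqs V" "v \<in> cauchy_seqs V"
      and l: "(\<lambda>n. vdist V (u n) (v n)) \<longlonglongrightarrow> 0"
      by (auto simp: cauchy_rel_def)
    have "(\<lambda>n. vdist V (c \<odot> u n) (c \<odot> v n)) \<longlonglongrightarrow> 0"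
      using tendsto_mult[OF tendsto_const l, of "cmod c"] s by (simp add: vdist_smult cauchy_seqsD)
    then show "cls (\<lambda>n. c \<odot> u n) = cls (\<lambda>n. c \<odot> v n)"
      using s by (intro cls_eqI) (simp add: cauchy_rel_def cauchy_seqs_smult)
  qed
  then show ?thesis
    using UN_equiv_class[OF equiv_cauchy_rel _ assms] by (simp add: completion_def)
qed

lemma completion_vnorm_nonneg:
  assumes "A \<in> carrier (completion V)"
  shows "0 \<le> vnorm (completion V) A"
proof -
  obtain u where u: "u \<in> cauchy_seqs V" "A = cls u" using assms by (rule completion_carrierE)
  show ?thesis
    unfolding u(2)
    by (rule LIMSEQ_le_const[OF completion_vnorm[OF u(1)]]) (simp add: vnorm_nonneg cauchy_seqsD[OF u(1)])
qed

lemma completion_closed: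
  assumes A: "A \<in> carrier (completion V)"
  shows "B \<in> carrier (completion V) \<Longrightarrow> A \<oplus>\<^bsub>completion V\<^esub> B \<in> carrier (completion V)"
    and "c \<odot>\<^bsub>completion V\<^esub> A \<in> carrier (completion V)"
proof -
  obtain u where u: "u \<in> cauchy_seqs V" "A = cls u" using A by (rule completion_carrierE)
  show "c \<odot>\<^bsub>completion V\<^esub> A \<in> carrier (completion V)"
    unfolding u(2) completion_smult[OF u(1)] by (rule completion_carrierI[OF cauchy_seqs_smult[OF u(1)]])
  assume "B \<in> carrier (completion V)"
  then obtain v where v: "v \<in> cauchy_seqs V" "B = cls v" by (rule completion_carrierE)
  show "A \<oplus>\<^bsub>completion V\<^esub> B \<in> carrier (completion V)"
    unfolding u(2) v(2) completion_add[OF u(1) v(1)]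
    by (rule completion_carrierI[OF cauchy_seqs_add[OF u(1) v(1)]])
qed

lemma completion_embed_carrier: "x \<in> carrier V \<Longrightarrow> completion_embed V x \<in> carrier (completion V)"
  by (simp add: completion_embed_def completion_carrierI cauchy_seqs_const)

lemma completion_embed_vnorm:
  assumes "x \<in> carrier V"
  shows "vnorm (completion V) (completion_embed V x) = vnorm V x"
  using completion_vnorm[OF cauchy_seqs_const[OF assms]]
  by (simp add: completion_embed_def LIMSEQ_const_iff)

end

text \<open>\<open>bounded_op\<close> hides its constant and \<open>opnorm\<close> is an infimum.
  Carrying the constant along lets bounds be multiplied under composition and passed to limits
  without touching infima.\<close>

definition op_bounded_by ::
  "('v, 'm) cnormed_scheme \<Rightarrow> ('w, 'n) cnormed_scheme \<Rightarrow> real \<Rightarrow> ('v \<Rightarrow> 'w) \<Rightarrow> bool" where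
  "op_bounded_by V W C T \<longleftrightarrow>
     T \<in> carrier V \<rightarrow> carrier W \<and>
     (\<forall>x\<in>carrier V. \<forall>y\<in>carrier V. T (x \<oplus>\<^bsub>V\<^esub> y) = T x \<oplus>\<^bsub>W\<^esub> T y) \<and>
     (\<forall>c. \<forall>x\<in>carrier V. T (c \<odot>\<^bsub>V\<^esub> x) = c \<odot>\<^bsub>W\<^esub> T x) \<and>
     (\<forall>x\<in>carrier V. vnorm W (T x) \<le> C * vnorm V x)"

lemma op_bounded_byD:
  assumes "op_bounded_by V W C T" "x \<in> carrier V"
  shows "T x \<in> carrier W"
    and "y \<in> carrier V \<Longrightarrow> T (x \<oplus>\<^bsub>V\<^esub> y) = T x \<oplus>\<^bsub>W\<^esub> T y"
    and "T (c \<odot>\<^bsub>V\<^esub> x) = c \<odot>\<^bsub>W\<^esub> T x"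
    and "vnorm W (T x) \<le> C * vnorm V x"
  using assms by (auto simp: op_bounded_by_def)

lemma op_bounded_by_imp_bounded_op: "op_bounded_by V W C T \<Longrightarrow> bounded_op V W T"
  unfolding op_bounded_by_def bounded_op_def by blast

lemma bounded_op_iff_bounded_by: "bounded_op V W T \<longleftrightarrow> (\<exists>C. op_bounded_by V W C T)"
  unfolding op_bounded_by_def bounded_op_def by blast

lemma opnorm_le:
  assumes "op_bounded_by V W C T" "0 \<le> C"
  shows "opnorm V W T \<le> C"
  unfolding opnorm_def by (rule cInf_lower) (use assms in \<open>auto simp: op_bounded_by_def intro: bdd_belowI\<close>)

text \<open>The infimum is itself an admissible constant: for \<open>vnorm V x\<close> positive, the
  quotient of the two norms is a lower bound of all admissible constants. For
  \<open>vnorm V x = 0\<close> any constant already forces the image to have norm at most 0.\<close>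

lemma opnorm_bound:
  assumes nonneg: "\<And>x. x \<in> carrier V \<Longrightarrow> 0 \<le> vnorm V x" and T: "bounded_op V W T"
  shows "0 \<le> opnorm V W T" "op_bounded_by V W (opnorm V W T) T"
proof -
  let ?S = "{C. 0 \<le> C \<and> (\<forall>x\<in>carrier V. vnorm W (T x) \<le> C * vnorm V x)}"
  obtain C where C: "vnorm W (T x) \<le> C * vnorm V x" if "x \<in> carrier V" for x
    using T unfolding bounded_op_def by blast
  have "vnorm W (T x) \<le> max 0 C * vnorm V x" if "x \<in> carrier V" for x
    using C[OF that] nonneg[OF that] by (meson max.cobounded2 mult_right_mono order_trans)
  then have ne: "?S \<noteq> {}" by (intro ex_in_conv[THEN iffD1] exI[of _ "max 0 C"]) auto
  have S_nonneg: "0 \<le> c" if "c \<in> ?S" for c using that by simp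
  show nn: "0 \<le> opnorm V W T"
    unfolding opnorm_def by (rule cInf_greatest[OF ne S_nonneg])
  have "vnorm W (T x) \<le> opnorm V W T * vnorm V x" if x: "x \<in> carrier V" for x
  proof (cases "vnorm V x = 0")
    case True
    then show ?thesis using C[OF x] by simp
  next
    case False
    then have pos: "0 < vnorm V x" using nonneg[OF x] by simp
    have "vnorm W (T x) / vnorm V x \<le> opnorm V W T"
      unfolding opnorm_def
      by (rule cInf_greatest[OF ne]) (use x pos in \<open>auto simp: pos_divide_le_eq\<close>)
    then show ?thesis using pos by (simp add: pos_divide_le_eq)
  qed
  then show "op_bounded_by V W (opnorm V W T) T"
    using T unfolding op_bounded_by_def bounded_op_def by blast
qed

lemma op_bounded_by_comp:
  assumes S: "op_bounded_by U V B S" and T: "op_bounded_by V W A T" and A: "0 \<le> A"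
  shows "op_bounded_by U W (A * B) (\<lambda>x. T (S x))"
  unfolding op_bounded_by_def
proof (intro conjI ballI allI)
  fix x assume x: "x \<in> carrier U"
  have "vnorm W (T (S x)) \<le> A * vnorm V (S x)"
    using op_bounded_byD[OF T] op_bounded_byD[OF S] x by blast
  also have "\<dots> \<le> A * (B * vnorm U x)"
    using op_bounded_byD(4)[OF S x] A by (rule mult_left_mono)
  finally show "vnorm W (T (S x)) \<le> A * B * vnorm U x" by (simp add: mult.assoc)
qed (auto simp: op_bounded_byD[OF S] op_bounded_byD[OF T])

lemma op_bounded_by_mono:
  assumes "op_bounded_by V W A T" "A \<le> B" "\<And>x. x \<in> carrier V \<Longrightarrow> 0 \<le> vnorm V x"
  shows "op_bounded_by V W B T"
  using assms unfolding op_bounded_by_def by (meson mult_right_mono order_trans)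

lemma complex_space_id [simp]:
  "carrier (complex_space id) = UNIV"
  "x \<oplus>\<^bsub>complex_space id\<^esub> y = x + y"
  "c \<odot>\<^bsub>complex_space id\<^esub> x = c * x"
  "vnorm (complex_space id) x = cmod x"
  using inv_f_f[of id x] inv_f_f[of id y] by (simp_all add: complex_space_def)

lemma op_bounded_by_vdist:
  assumes "complex_normed_space V" "complex_normed_space W" and T: "op_bounded_by V W C T"
    and x: "x \<in> carrier V" and y: "y \<in> carrier V"
  shows "vdist W (T x) (T y) \<le> C * vdist V x y"
proof -
  interpret V: complex_normed_space V by fact
  interpret W: complex_normed_space W by fact
  note D = op_bounded_byD[OF T]
  have "T (x \<ominus>\<^bsub>V\<^esub> y) = T x \<ominus>\<^bsub>W\<^esub> T y"
    using x y by (simp add: a_minus_def V.minus_eq_smult W.minus_eq_smult D)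
  then show ?thesis using D(4)[of "x \<ominus>\<^bsub>V\<^esub> y"] x y by (simp add: V.vdist_eq W.vdist_eq D)
qed

section \<open>Extension of operators and functionals to the completion\<close>

definition completion_map ::
  "('v, 'm) cnormed_scheme \<Rightarrow> ('w, 'n) cnormed_scheme \<Rightarrow> ('v \<Rightarrow> 'w) \<Rightarrow>
   (nat \<Rightarrow> 'v) set \<Rightarrow> (nat \<Rightarrow> 'w) set" where
  "completion_map V W T A = (\<Union>u\<in>A. cauchy_rel W `` {\<lambda>n. T (u n)})"

context
  fixes V :: "('v, 'm) cnormed_scheme" and W :: "('w, 'n) cnormed_scheme" and C T
  assumes V: "complex_normed_space V" and W: "complex_normed_space W"
    and T: "op_bounded_by V W C T"
begin

interpretation V: complex_normed_space V by (rule V)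
interpretation W: complex_normed_space W by (rule W)

lemma op_bounded_by_cauchy:
  assumes s: "u \<in> cauchy_seqs V"
  shows "(\<lambda>n. T (u n)) \<in> cauchy_seqs W"
  unfolding W.cauchy_seqs_iff
proof (intro conjI allI impI)
  show "range (\<lambda>n. T (u n)) \<subseteq> carrier W"
    using op_bounded_byD(1)[OF T] V.cauchy_seqsD[OF s] by blast
  fix \<epsilon> :: real assume "0 < \<epsilon>"
  \<comment> \<open>\<open>C\<close> may be negative or zero; \<open>\<bar>C\<bar> + 1\<close> is a
    positive number above it by which one can divide.\<close>
  then have e: "0 < \<epsilon> / (\<bar>C\<bar> + 1)" by (simp add: add_nonneg_pos)
  obtain N where N: "\<forall>n\<ge>N. \<forall>m\<ge>N. vdist V (u n) (u m) < \<epsilon> / (\<bar>C\<bar> + 1)"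
    using s e unfolding V.cauchy_seqs_iff by blast
  have "vdist W (T (u n)) (T (u m)) < \<epsilon>" if "N \<le> n" "N \<le> m" for n m
  proof -
    have "vdist W (T (u n)) (T (u m)) \<le> C * vdist V (u n) (u m)"
      using op_bounded_by_vdist[OF V W T] s by (simp add: V.cauchy_seqsD)
    also have "\<dots> \<le> (\<bar>C\<bar> + 1) * vdist V (u n) (u m)"
      by (intro mult_right_mono) auto
    also have "\<dots> < \<epsilon>"
      using N that by (simp add: pos_less_divide_eq add_nonneg_pos mult.commute)
    finally show ?thesis .
  qed
  then show "\<exists>N. \<forall>n\<ge>N. \<forall>m\<ge>N. vdist W (T (u n)) (T (u m)) < \<epsilon>" by blast
qed

text \<open>Boundedness sends null sequences to null sequences, so the union over representatives in
  \<open>completion_map\<close> is again over a constant family.\<close>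

lemma completion_map_cls:
  assumes s: "u \<in> cauchy_seqs V"
  shows "completion_map V W T (V.cls u) = W.cls (\<lambda>n. T (u n))"
proof -
  have "(\<lambda>u. W.cls (\<lambda>n. T (u n))) respects cauchy_rel V"
  proof (rule congruentI)
    fix u v assume "(u, v) \<in> cauchy_rel V"
    then have s: "u \<in> cauchy_seqs V" "v \<in> cauchy_seqs V"
      and l: "(\<lambda>n. vdist V (u n) (v n)) \<longlonglongrightarrow> 0"
      by (auto simp: cauchy_rel_def)
    have "(\<lambda>n. vdist W (T (u n)) (T (v n))) \<longlonglongrightarrow> 0"
    proof (rule tendsto_sandwich[of "\<lambda>_. 0" _ _ "\<lambda>n. C * vdist V (u n) (v n)"])
      show "(\<lambda>n. C * vdist V (u n) (v n)) \<longlonglongrightarrow> 0"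
        using tendsto_mult[OF tendsto_const l, of C] by simp
      show "\<forall>\<^sub>F n in sequentially. vdist W (T (u n)) (T (v n)) \<le> C * vdist V (u n) (v n)"
        using op_bounded_by_vdist[OF V W T] s by (simp add: V.cauchy_seqsD)
    qed auto
    then show "W.cls (\<lambda>n. T (u n)) = W.cls (\<lambda>n. T (v n))"
      using s by (intro W.cls_eqI) (simp add: cauchy_rel_def op_bounded_by_cauchy)
  qed
  then show ?thesis
    using UN_equiv_class[OF V.equiv_cauchy_rel _ s] by (simp add: completion_map_def)
qed

lemma completion_map_embed:
  "x \<in> carrier V \<Longrightarrow> completion_map V W T (completion_embed V x) = completion_embed W (T x)"
  using completion_map_cls[OF V.cauchy_seqs_const] by (simp add: completion_embed_def)

lemma completion_map_bounded_by:
  "op_bounded_by (completion V) (completion W) C (completion_map V W T)"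
  unfolding op_bounded_by_def
proof (intro conjI ballI allI)
  show "completion_map V W T \<in> carrier (completion V) \<rightarrow> carrier (completion W)"
  proof
    fix A assume "A \<in> carrier (completion V)"
    then obtain u where u: "u \<in> cauchy_seqs V" "A = V.cls u" by (rule V.completion_carrierE)
    show "completion_map V W T A \<in> carrier (completion W)"
      unfolding u(2) completion_map_cls[OF u(1)]
      by (rule W.completion_carrierI[OF op_bounded_by_cauchy[OF u(1)]])
  qed
next
  fix A B assume "A \<in> carrier (completion V)" "B \<in> carrier (completion V)"
  then obtain u v where s: "u \<in> cauchy_seqs V" "v \<in> cauchy_seqs V" "A = V.cls u" "B = V.cls v"
    by (metis V.completion_carrierE)
  then show "completion_map V W T (A \<oplus>\<^bsub>completion V\<^esub> B) =
      completion_map V W T A \<oplus>\<^bsub>completion W\<^esub> completion_map V W T B"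
    by (simp add: V.completion_add W.completion_add completion_map_cls V.cauchy_seqs_add
        op_bounded_by_cauchy op_bounded_byD[OF T] V.cauchy_seqsD)
next
  fix c A assume "A \<in> carrier (completion V)"
  then obtain u where s: "u \<in> cauchy_seqs V" "A = V.cls u"
    by (metis V.completion_carrierE)
  then show "completion_map V W T (c \<odot>\<^bsub>completion V\<^esub> A) =
      c \<odot>\<^bsub>completion W\<^esub> completion_map V W T A"
    by (simp add: V.completion_smult W.completion_smult completion_map_cls V.cauchy_seqs_smult
        op_bounded_by_cauchy op_bounded_byD[OF T] V.cauchy_seqsD)
next
  fix A assume "A \<in> carrier (completion V)"
  then obtain u where s: "u \<in> cauchy_seqs V" "A = V.cls u"
    by (metis V.completion_carrierE)
  have "(\<lambda>n. vnorm W (T (u n))) \<longlonglongrightarrow> vnorm (completion W) (completion_map V W T A)"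
    using W.completion_vnorm[OF op_bounded_by_cauchy[OF s(1)]] s by (simp add: completion_map_cls)
  moreover have "(\<lambda>n. C * vnorm V (u n)) \<longlonglongrightarrow> C * vnorm (completion V) A"
    unfolding s(2) by (intro tendsto_mult tendsto_const V.completion_vnorm s)
  ultimately show "vnorm (completion W) (completion_map V W T A) \<le> C * vnorm (completion V) A"
    by (rule LIMSEQ_le) (use op_bounded_byD(4)[OF T] V.cauchy_seqsD[OF s(1)] in blast)
qed

end

context complex_normed_space
begin

text \<open>Density of \<open>V\<close>: the class of \<open>u\<close> is the limit of the embedded
  terms \<open>u n\<close>, and a bounded functional respects this limit.\<close>

lemma completion_functional_unique:
  assumes F: "F \<in> dual_space (completion V)" and F': "F' \<in> dual_space (completion V)"
    and eq: "\<And>x. x \<in> carrier V \<Longrightarrow> F (completion_embed V x) = F' (completion_embed V x)"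
  shows "F = F'"
proof (rule extensionalityI)
  show "F \<in> extensional (carrier (completion V))" "F' \<in> extensional (carrier (completion V))"
    using F F' by (auto simp: dual_space_def)
  fix A assume "A \<in> carrier (completion V)"
  then obtain u where s: "u \<in> cauchy_seqs V" "A = cls u" by (rule completion_carrierE)
  have lim: "(\<lambda>n. E (completion_embed V (u n))) \<longlonglongrightarrow> E A" if E: "E \<in> dual_space (completion V)" for E
  proof -
    obtain C where C: "op_bounded_by (completion V) (complex_space id) C E"
      using E by (auto simp: dual_space_def bounded_op_iff_bounded_by)
    \<comment> \<open>\<open>B n\<close> is the class of \<open>u\<close> minus the embedded
      \<open>u n\<close>. The difference is formed termwise in \<open>V\<close>, so that only
      addition and scalar multiplication of the completion enter.\<close>
    define B where "B n = cls (\<lambda>m. u m \<oplus> (-1) \<odot> u n)" for n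
    have Bs: "(\<lambda>m. u m \<oplus> (-1) \<odot> u n) \<in> cauchy_seqs V" for n
      using s by (intro cauchy_seqs_add cauchy_seqs_const) (auto simp: cauchy_seqsD)
    have B: "B n \<in> carrier (completion V)" for n
      using Bs by (simp add: B_def completion_carrierI)
    have em: "completion_embed V (u n) \<in> carrier (completion V)" for n
      using s by (simp add: completion_embed_carrier cauchy_seqsD)
    have "A = B n \<oplus>\<^bsub>completion V\<^esub> completion_embed V (u n)" for n
    proof -
      have "B n \<oplus>\<^bsub>completion V\<^esub> completion_embed V (u n) = cls (\<lambda>m. u m \<oplus> (-1) \<odot> u n \<oplus> u n)"
        using s Bs by (simp add: completion_embed_def B_def completion_add cauchy_seqs_const cauchy_seqsD)
      also have "(\<lambda>m. u m \<oplus> (-1) \<odot> u n \<oplus> u n) = u"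
        using cauchy_seqsD[OF s(1)] by (simp add: minus_eq_smult[symmetric] a_assoc l_neg)
      finally show ?thesis using s by simp
    qed
    then have E_eq: "E (completion_embed V (u n)) = E A - E (B n)" for n
      using op_bounded_byD(2)[OF C B em, of n n] by simp
    \<comment> \<open>The norm of \<open>B n\<close> is the limit over \<open>m\<close> of the
      distances between \<open>u m\<close> and \<open>u n\<close>, so the Cauchy property makes it
      small for large \<open>n\<close>.\<close>
    have nB: "vnorm (completion V) (B n) \<le> \<epsilon>" if "\<forall>m\<ge>N. vdist V (u m) (u n) < \<epsilon>" for n N \<epsilon>
    proof (rule LIMSEQ_le_const2)
      show "(\<lambda>m. vnorm V (u m \<oplus> (-1) \<odot> u n)) \<longlonglongrightarrow> vnorm (completion V) (B n)"
        unfolding B_def by (rule completion_vnorm[OF Bs])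
      show "\<exists>N. \<forall>m\<ge>N. vnorm V (u m \<oplus> (-1) \<odot> u n) \<le> \<epsilon>"
        using that cauchy_seqsD[OF s(1)]
        by (intro exI[of _ N]) (auto simp: vdist_eq a_minus_def minus_eq_smult less_imp_le)
    qed
    have nB0: "0 \<le> vnorm (completion V) (B n)" for n
      using completion_vnorm[OF Bs, of n] cauchy_seqsD[OF Bs] vnorm_nonneg
      by (intro LIMSEQ_le_const[where X = "\<lambda>m. vnorm V (u m \<oplus> (-1) \<odot> u n)"]) (auto simp: B_def)
    have "(\<lambda>n. vnorm (completion V) (B n)) \<longlonglongrightarrow> 0"
    proof (rule LIMSEQ_I)
      fix \<epsilon> :: real assume "0 < \<epsilon>"
      then have "0 < \<epsilon> / 2" by simp
      then obtain N where N: "\<forall>n\<ge>N. \<forall>m\<ge>N. vdist V (u n) (u m) < \<epsilon> / 2"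
        using s(1) unfolding cauchy_seqs_iff by blast
      have "norm (vnorm (completion V) (B n) - 0) < \<epsilon>" if "N \<le> n" for n
      proof -
        have "vnorm (completion V) (B n) \<le> \<epsilon> / 2" using N that by (intro nB[of N]) blast
        then show ?thesis using nB0[of n] \<open>0 < \<epsilon>\<close> by simp
      qed
      then show "\<exists>N. \<forall>n\<ge>N. norm (vnorm (completion V) (B n) - 0) < \<epsilon>" by blast
    qed
    then have "(\<lambda>n. C * vnorm (completion V) (B n)) \<longlonglongrightarrow> 0"
      using tendsto_mult[OF tendsto_const, of _ 0 sequentially C] by simp
    then have "(\<lambda>n. E (B n)) \<longlonglongrightarrow> 0"
      by (rule Lim_null_comparison[rotated])
        (use op_bounded_byD(4)[OF C B] in \<open>simp add: always_eventually\<close>)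
    from tendsto_diff[OF tendsto_const this, of "E A"] show ?thesis by (simp add: E_eq)
  qed
  have "(\<lambda>n. F (completion_embed V (u n))) = (\<lambda>n. F' (completion_embed V (u n)))"
    using eq s by (simp add: cauchy_seqsD)
  then show "F A = F' A" using lim[OF F] lim[OF F'] by (metis LIMSEQ_unique)
qed

text \<open>Completeness of the complex numbers supplies the limit of \<open>f\<close> along a
  Cauchy sequence. \<open>completion_map\<close> would land in the completion of
  \<open>complex_space id\<close> instead of the scalars themselves.\<close>

lemma completion_functional_exists:
  assumes f: "op_bounded_by V (complex_space id) C f"
  shows "\<exists>F\<in>dual_space (completion V). \<forall>x\<in>carrier V. F (completion_embed V x) = f x"
proof -
  note D = op_bounded_byD[OF f, simplified]
  have f_diff: "cmod (f x - f y) \<le> C * vdist V x y" if "x \<in> carrier V" "y \<in> carrier V" for x y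
    using that D(4)[of "x \<ominus> y"] D(2)[of x "(-1) \<odot> y"] D(3)[of y "-1"]
    by (simp add: vdist_eq a_minus_def minus_eq_smult)
  have conv: "\<exists>r. \<forall>v\<in>cls u. (\<lambda>n. f (v n)) \<longlonglongrightarrow> r" if s: "u \<in> cauchy_seqs V" for u
  proof -
    have "Cauchy (\<lambda>n. f (u n))"
      unfolding Cauchy_def
    proof (intro allI impI)
      fix \<epsilon> :: real assume "0 < \<epsilon>"
      then have "0 < \<epsilon> / (\<bar>C\<bar> + 1)" by (simp add: add_nonneg_pos)
      then obtain N where N: "\<forall>n\<ge>N. \<forall>m\<ge>N. vdist V (u n) (u m) < \<epsilon> / (\<bar>C\<bar> + 1)"
        using s unfolding cauchy_seqs_iff by blast
      have "dist (f (u m)) (f (u n)) < \<epsilon>" if "N \<le> m" "N \<le> n" for m n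
      proof -
        have "dist (f (u m)) (f (u n)) \<le> C * vdist V (u m) (u n)"
          using f_diff s by (simp add: dist_norm cauchy_seqsD)
        also have "\<dots> \<le> (\<bar>C\<bar> + 1) * vdist V (u m) (u n)"
          by (intro mult_right_mono) auto
        also have "\<dots> < \<epsilon>"
          using N that by (simp add: pos_less_divide_eq add_nonneg_pos mult.commute)
        finally show ?thesis .
      qed
      then show "\<exists>M. \<forall>m\<ge>M. \<forall>n\<ge>M. dist (f (u m)) (f (u n)) < \<epsilon>" by blast
    qed
    then obtain r where r: "(\<lambda>n. f (u n)) \<longlonglongrightarrow> r"
      by (auto simp: Cauchy_convergent_iff convergent_def)
    have "(\<lambda>n. f (v n)) \<longlonglongrightarrow> r" if "v \<in> cls u" for v
    proof -
      have t: "v \<in> cauchy_seqs V" and l: "(\<lambda>n. vdist V (u n) (v n)) \<longlonglongrightarrow> 0"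
        using that by (auto simp: cauchy_rel_def)
      have "(\<lambda>n. C * vdist V (u n) (v n)) \<longlonglongrightarrow> 0"
        using tendsto_mult[OF tendsto_const l, of C] by simp
      then have "(\<lambda>n. f (u n) - f (v n)) \<longlonglongrightarrow> 0"
        by (rule Lim_null_comparison[rotated]) (use s t f_diff in \<open>simp add: cauchy_seqsD\<close>)
      from tendsto_diff[OF r this] show ?thesis by simp
    qed
    then show ?thesis by blast
  qed
  \<comment> \<open>All representatives of a class give the same limit, so \<open>SOME\<close> has
    only one candidate; restricting to the carrier provides the extensionality that
    \<open>dual_space\<close> demands.\<close>
  define F where "F = (\<lambda>A\<in>carrier (completion V). SOME r. \<forall>v\<in>A. (\<lambda>n. f (v n)) \<longlonglongrightarrow> r)"
  have F: "(\<lambda>n. f (u n)) \<longlonglongrightarrow> F (cls u)" if s: "u \<in> cauchy_seqs V" for u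
  proof -
    have "\<forall>v\<in>cls u. (\<lambda>n. f (v n)) \<longlonglongrightarrow> F (cls u)"
      using someI_ex[OF conv[OF s]] completion_carrierI[OF s] by (simp add: F_def)
    then show ?thesis using equiv_class_self[OF equiv_cauchy_rel s] by blast
  qed
  have "op_bounded_by (completion V) (complex_space id) C F"
    unfolding op_bounded_by_def complex_space_id
  proof (intro conjI ballI allI)
    fix A B assume "A \<in> carrier (completion V)" "B \<in> carrier (completion V)"
    then obtain u v where s: "u \<in> cauchy_seqs V" "v \<in> cauchy_seqs V" "A = cls u" "B = cls v"
      by (metis completion_carrierE)
    have "(\<lambda>n. f (u n) + f (v n)) \<longlonglongrightarrow> F (A \<oplus>\<^bsub>completion V\<^esub> B)"
      using F[OF cauchy_seqs_add[OF s(1,2)]] s by (simp add: completion_add D cauchy_seqsD)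
    moreover have "(\<lambda>n. f (u n) + f (v n)) \<longlonglongrightarrow> F A + F B"
      unfolding s by (intro tendsto_add F s)
    ultimately show "F (A \<oplus>\<^bsub>completion V\<^esub> B) = F A + F B" by (rule LIMSEQ_unique)
  next
    fix c A assume "A \<in> carrier (completion V)"
    then obtain u where s: "u \<in> cauchy_seqs V" "A = cls u" by (metis completion_carrierE)
    have "(\<lambda>n. c * f (u n)) \<longlonglongrightarrow> F (c \<odot>\<^bsub>completion V\<^esub> A)"
      using F[OF cauchy_seqs_smult[OF s(1)]] s by (simp add: completion_smult D cauchy_seqsD)
    moreover have "(\<lambda>n. c * f (u n)) \<longlonglongrightarrow> c * F A"
      unfolding s by (intro tendsto_mult tendsto_const F s)
    ultimately show "F (c \<odot>\<^bsub>completion V\<^esub> A) = c * F A" by (rule LIMSEQ_unique)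
  next
    fix A assume "A \<in> carrier (completion V)"
    then obtain u where s: "u \<in> cauchy_seqs V" "A = cls u" by (metis completion_carrierE)
    have "(\<lambda>n. cmod (f (u n))) \<longlonglongrightarrow> cmod (F A)"
      unfolding s by (intro tendsto_norm F s)
    moreover have "(\<lambda>n. C * vnorm V (u n)) \<longlonglongrightarrow> C * vnorm (completion V) A"
      unfolding s(2) by (intro tendsto_mult tendsto_const completion_vnorm s)
    ultimately show "cmod (F A) \<le> C * vnorm (completion V) A"
      by (rule LIMSEQ_le) (use D(4) cauchy_seqsD[OF s(1)] in blast)
  qed auto
  then have "F \<in> dual_space (completion V)"
    by (auto simp: dual_space_def F_def dest: op_bounded_by_imp_bounded_op)
  moreover have "F (completion_embed V x) = f x" if "x \<in> carrier V" for x
    using F[OF cauchy_seqs_const[OF that]] by (simp add: completion_embed_def LIMSEQ_const_iff)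
  ultimately show ?thesis by blast
qed

end

section \<open>Hilbert sums\<close>

text \<open>All summands are the same space, since an induced space holds one copy of
  \<open>H i\<close> for each coset. Extensionality off \<open>R\<close> makes an element determined
  by its coordinates.\<close>

definition hilbert_sum :: "'i set \<Rightarrow> ('v, 'm) chilbert_scheme \<Rightarrow> ('i \<Rightarrow> 'v) chilbert" where
  "hilbert_sum R H = \<lparr>
     carrier = {f \<in> R \<rightarrow>\<^sub>E carrier H. (\<lambda>i. (vnorm H (f i))\<^sup>2) summable_on R},
     monoid.mult = undefined,
     one = undefined,
     ring.zero = (\<lambda>i\<in>R. \<zero>\<^bsub>H\<^esub>),
     add = (\<lambda>f g. \<lambda>i\<in>R. f i \<oplus>\<^bsub>H\<^esub> g i),
     smult = (\<lambda>c f. \<lambda>i\<in>R. c \<odot>\<^bsub>H\<^esub> f i),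
     vnorm = (\<lambda>f. sqrt (\<Sum>\<^sub>\<infinity>i\<in>R. (vnorm H (f i))\<^sup>2)),
     cinner = (\<lambda>f g. \<Sum>\<^sub>\<infinity>i\<in>R. cinner H (f i) (g i))\<rparr>"

lemma hilbert_sum_simps [simp]:
  "\<zero>\<^bsub>hilbert_sum R H\<^esub> = (\<lambda>i\<in>R. \<zero>\<^bsub>H\<^esub>)"
  "f \<oplus>\<^bsub>hilbert_sum R H\<^esub> g = (\<lambda>i\<in>R. f i \<oplus>\<^bsub>H\<^esub> g i)"
  "c \<odot>\<^bsub>hilbert_sum R H\<^esub> f = (\<lambda>i\<in>R. c \<odot>\<^bsub>H\<^esub> f i)"
  "vnorm (hilbert_sum R H) f = sqrt (\<Sum>\<^sub>\<infinity>i\<in>R. (vnorm H (f i))\<^sup>2)"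
  "cinner (hilbert_sum R H) f g = (\<Sum>\<^sub>\<infinity>i\<in>R. cinner H (f i) (g i))"
  by (simp_all add: hilbert_sum_def)

lemma hilbert_sum_carrier:
  "f \<in> carrier (hilbert_sum R H) \<longleftrightarrow> f \<in> extensional R \<and> (\<forall>i\<in>R. f i \<in> carrier H) \<and>
     (\<lambda>i. (vnorm H (f i))\<^sup>2) summable_on R"
  by (auto simp: hilbert_sum_def PiE_def Pi_def)

lemma hilbert_sumD:
  assumes "f \<in> carrier (hilbert_sum R H)"
  shows "i \<in> R \<Longrightarrow> f i \<in> carrier H" "f \<in> extensional R" "(\<lambda>i. (vnorm H (f i))\<^sup>2) summable_on R"
  using assms by (auto simp: hilbert_sum_carrier)

lemma nonneg_summable_onI:
  fixes f :: "'i \<Rightarrow> real"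
  assumes "\<And>i. i \<in> R \<Longrightarrow> 0 \<le> f i" "\<And>F. finite F \<Longrightarrow> F \<subseteq> R \<Longrightarrow> sum f F \<le> b"
  shows "f summable_on R" "infsum f R \<le> b"
proof -
  show s: "f summable_on R"
    using assms by (intro nonneg_bdd_above_summable_on bdd_aboveI[of _ b]) auto
  show "infsum f R \<le> b" using infsum_le_finite_sums[OF s] assms(2) by blast
qed

context complex_inner_space
begin

text \<open>From \<open>2 * a * b \<le> a\<^sup>2 + b\<^sup>2\<close>; this is the domination that
  keeps square-summable families closed under addition.\<close>

lemma vnorm_add_power2_le:
  assumes "x \<in> carrier H" "y \<in> carrier H"
  shows "(vnorm H (x \<oplus> y))\<^sup>2 \<le> 2 * (vnorm H x)\<^sup>2 + 2 * (vnorm H y)\<^sup>2"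
proof -
  have "(vnorm H (x \<oplus> y))\<^sup>2 \<le> (vnorm H x + vnorm H y)\<^sup>2"
    using assms by (intro power_mono vnorm_triangle vnorm_nonneg) auto
  also have "\<dots> \<le> 2 * (vnorm H x)\<^sup>2 + 2 * (vnorm H y)\<^sup>2"
    using sum_squares_bound[of "vnorm H x" "vnorm H y"] by (simp add: power2_sum)
  finally show ?thesis .
qed

lemma hilbert_sum_add_closed:
  assumes f: "f \<in> carrier (hilbert_sum R H)" and g: "g \<in> carrier (hilbert_sum R H)"
  shows "(\<lambda>i\<in>R. f i \<oplus> g i) \<in> carrier (hilbert_sum R H)"
proof -
  have "(\<lambda>i. 2 * (vnorm H (f i))\<^sup>2 + 2 * (vnorm H (g i))\<^sup>2) summable_on R"
    by (intro summable_on_add summable_on_cmult_right hilbert_sumD(3)[OF f] hilbert_sumD(3)[OF g])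
  then have "(\<lambda>i. (vnorm H (f i \<oplus> g i))\<^sup>2) summable_on R"
    by (rule summable_on_comparison_test)
      (use hilbert_sumD(1)[OF f] hilbert_sumD(1)[OF g] vnorm_add_power2_le in auto)
  then have "(\<lambda>i. (vnorm H ((\<lambda>i\<in>R. f i \<oplus> g i) i))\<^sup>2) summable_on R"
    by (rule summable_on_cong[THEN iffD1, rotated]) simp
  then show ?thesis
    using hilbert_sumD(1)[OF f] hilbert_sumD(1)[OF g] by (simp add: hilbert_sum_carrier)
qed

lemma hilbert_sum_smult_closed:
  assumes f: "f \<in> carrier (hilbert_sum R H)"
  shows "(\<lambda>i\<in>R. c \<odot> f i) \<in> carrier (hilbert_sum R H)"
proof -
  have "(\<lambda>i. (cmod c)\<^sup>2 * (vnorm H (f i))\<^sup>2) summable_on R"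
    by (intro summable_on_cmult_right hilbert_sumD(3)[OF f])
  then have "(\<lambda>i. (vnorm H ((\<lambda>i\<in>R. c \<odot> f i) i))\<^sup>2) summable_on R"
    by (rule summable_on_cong[THEN iffD1, rotated])
      (use hilbert_sumD(1)[OF f] in \<open>simp add: vnorm_smult power_mult_distrib\<close>)
  then show ?thesis
    using hilbert_sumD(1)[OF f] by (simp add: hilbert_sum_carrier)
qed

lemma hilbert_sum_zero_closed: "(\<lambda>i\<in>R. \<zero>) \<in> carrier (hilbert_sum R H)"
proof -
  have "(\<lambda>i. (vnorm H ((\<lambda>i\<in>R. \<zero>) i))\<^sup>2) summable_on R"
    by (rule summable_on_cong[THEN iffD1, rotated, OF summable_on_0_simp])
      (simp add: vnorm_zero_iff)
  then show ?thesis by (simp add: hilbert_sum_carrier)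
qed

text \<open>The Cauchy-Schwarz inequality in each coordinate dominates the terms by the sum of two
  summable families of squares.\<close>

lemma cinner_summable:
  assumes f: "f \<in> carrier (hilbert_sum R H)" and g: "g \<in> carrier (hilbert_sum R H)"
  shows "(\<lambda>i. cinner H (f i) (g i)) summable_on R"
proof -
  have le: "norm (cinner H (f i) (g i)) \<le> (vnorm H (f i))\<^sup>2 + (vnorm H (g i))\<^sup>2"
    if i: "i \<in> R" for i
  proof -
    note car = hilbert_sumD(1)[OF f i] hilbert_sumD(1)[OF g i]
    have "0 \<le> vnorm H (f i) * vnorm H (g i)" using car by (simp add: vnorm_nonneg)
    then show ?thesis
      using Cauchy_Schwarz[OF car] sum_squares_bound[of "vnorm H (f i)" "vnorm H (g i)"]
      by linarith
  qed
  have "(\<lambda>i. (vnorm H (f i))\<^sup>2 + (vnorm H (g i))\<^sup>2) summable_on R"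
    by (intro summable_on_add hilbert_sumD(3)[OF f] hilbert_sumD(3)[OF g])
  from Infinite_Sum.abs_summable_on_comparison_test'[OF this le] show ?thesis
    by (rule Infinite_Sum.abs_summable_summable)
qed

lemma vnorm_hilbert_sum_component:
  assumes f: "f \<in> carrier (hilbert_sum R H)" and i: "i \<in> R"
  shows "vnorm H (f i) \<le> vnorm (hilbert_sum R H) f"
proof -
  have "(vnorm H (f i))\<^sup>2 \<le> (\<Sum>\<^sub>\<infinity>i\<in>R. (vnorm H (f i))\<^sup>2)"
    using finite_sum_le_infsum[OF hilbert_sumD(3)[OF f], of "{i}"] i by simp
  then show ?thesis by (simp add: real_le_rsqrt)
qed

lemma complex_inner_space_hilbert_sum: "complex_inner_space (hilbert_sum R H)"
proof -
  let ?L = "hilbert_sum R H"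
  note car = hilbert_sumD(1)
  have ag: "abelian_group ?L"
  proof (rule abelian_groupI)
    fix f assume f: "f \<in> carrier ?L"
    have "(\<lambda>i\<in>R. (-1) \<odot> f i) \<oplus>\<^bsub>?L\<^esub> f = \<zero>\<^bsub>?L\<^esub>"
      using car[OF f] by (auto intro!: restrict_ext simp: minus_eq_smult[symmetric] l_neg)
    then show "\<exists>g\<in>carrier ?L. g \<oplus>\<^bsub>?L\<^esub> f = \<zero>\<^bsub>?L\<^esub>"
      using hilbert_sum_smult_closed[OF f] by blast
  next
    fix f assume f: "f \<in> carrier ?L"
    show "\<zero>\<^bsub>?L\<^esub> \<oplus>\<^bsub>?L\<^esub> f = f"
      by (rule extensionalityI[of _ R]) (use f car[OF f] hilbert_sumD(2)[OF f] in auto)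
  qed (auto simp: hilbert_sum_add_closed hilbert_sum_zero_closed car a_ac
      intro!: restrict_ext)
  interpret L: Module.module complex_ring ?L
  proof (rule moduleI[OF cring_complex_ring ag])
    fix f assume f: "f \<in> carrier ?L"
    show "\<one>\<^bsub>complex_ring\<^esub> \<odot>\<^bsub>?L\<^esub> f = f"
      by (rule extensionalityI[of _ R]) (use f car[OF f] hilbert_sumD(2)[OF f] in auto)
  qed (auto simp: hilbert_sum_smult_closed car smult_plus smult_r_distr smult_mult
      intro!: restrict_ext)
  have self: "cinner ?L f f = complex_of_real (\<Sum>\<^sub>\<infinity>i\<in>R. (vnorm H (f i))\<^sup>2)" if f: "f \<in> carrier ?L" for f
  proof -
    have "cinner ?L f f = (\<Sum>\<^sub>\<infinity>i\<in>R. complex_of_real ((vnorm H (f i))\<^sup>2))"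
      unfolding hilbert_sum_simps by (rule infsum_cong) (use car[OF f] vnorm_power2 in auto)
    also have "\<dots> = complex_of_real (\<Sum>\<^sub>\<infinity>i\<in>R. (vnorm H (f i))\<^sup>2)"
      by (intro infsumI has_sum_of_real has_sum_infsum hilbert_sumD(3)[OF f])
    finally show ?thesis .
  qed
  show ?thesis
  proof
    fix f g h assume f: "f \<in> carrier ?L" and g: "g \<in> carrier ?L" and h: "h \<in> carrier ?L"
    have "cinner ?L (f \<oplus>\<^bsub>?L\<^esub> g) h = (\<Sum>\<^sub>\<infinity>i\<in>R. cinner H (f i) (h i) + cinner H (g i) (h i))"
      unfolding hilbert_sum_simps
      by (rule infsum_cong) (simp add: car[OF f] car[OF g] car[OF h] cinner_add_left)
    also have "\<dots> = cinner ?L f h + cinner ?L g h"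
      unfolding hilbert_sum_simps by (intro infsum_add cinner_summable f g h)
    finally show "cinner ?L (f \<oplus>\<^bsub>?L\<^esub> g) h = cinner ?L f h + cinner ?L g h" .
  next
    fix f g c assume f: "f \<in> carrier ?L" and g: "g \<in> carrier ?L"
    have "cinner ?L (c \<odot>\<^bsub>?L\<^esub> f) g = (\<Sum>\<^sub>\<infinity>i\<in>R. c * cinner H (f i) (g i))"
      unfolding hilbert_sum_simps
      by (rule infsum_cong) (simp add: car[OF f] car[OF g] cinner_smult_left)
    then show "cinner ?L (c \<odot>\<^bsub>?L\<^esub> f) g = c * cinner ?L f g"
      by (simp add: infsum_cmult_right')
    have "cinner ?L f g = (\<Sum>\<^sub>\<infinity>i\<in>R. cnj (cinner H (g i) (f i)))"
      unfolding hilbert_sum_simps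
      by (rule infsum_cong) (rule cinner_commute[OF car[OF f] car[OF g]])
    then show "cinner ?L f g = cnj (cinner ?L g f)" by simp
  next
    fix f assume f: "f \<in> carrier ?L"
    then show "vnorm ?L f = sqrt (Re (cinner ?L f f))" using self[OF f] by simp
    assume nz: "f \<noteq> \<zero>\<^bsub>?L\<^esub>"
    have "\<exists>i\<in>R. f i \<noteq> \<zero>"
    proof (rule ccontr)
      assume "\<not> ?thesis"
      then have "f = \<zero>\<^bsub>?L\<^esub>"
        by (intro extensionalityI[of _ R]) (use hilbert_sumD(2)[OF f] in auto)
      then show False using nz by blast
    qed
    then obtain i where i: "i \<in> R" "f i \<noteq> \<zero>" by blast
    have "0 < vnorm H (f i)"
      using vnorm_zero_iff[OF car[OF f i(1)]] vnorm_nonneg[OF car[OF f i(1)]] i(2) by linarith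
    also have "\<dots> \<le> vnorm ?L f" by (rule vnorm_hilbert_sum_component[OF f i(1)])
    finally show "0 < Re (cinner ?L f f)" using self[OF f] by simp
  qed
qed

end

text \<open>A Cauchy sequence converges in each coordinate because \<open>H\<close> is complete. The
  coordinatewise limit is the limit in norm, because the Cauchy estimate is uniform over finite sets
  of coordinates and so survives in the infinite sum.\<close>

lemma hilbert_space_hilbert_sum:
  assumes "hilbert_space H"
  shows "hilbert_space (hilbert_sum R H)"
proof -
  interpret H: hilbert_space H by fact
  let ?L = "hilbert_sum R H"
  interpret L: complex_inner_space ?L by (rule H.complex_inner_space_hilbert_sum)
  interpret ms_H: Metric_space "carrier H" "vdist H" by (rule H.Metric_space_vdist)
  interpret ms_L: Metric_space "carrier ?L" "vdist ?L" by (rule L.Metric_space_vdist)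
  note car = hilbert_sumD(1)
  have minus: "(f \<ominus>\<^bsub>?L\<^esub> g) i = f i \<ominus>\<^bsub>H\<^esub> g i"
    if "f \<in> carrier ?L" "g \<in> carrier ?L" "i \<in> R" for f g i
    using that by (simp add: a_minus_def L.minus_eq_smult H.minus_eq_smult car)
  have dist2: "(\<Sum>i\<in>F. (vdist H (f i) (g i))\<^sup>2) \<le> (vdist ?L f g)\<^sup>2"
    if fg: "f \<in> carrier ?L" "g \<in> carrier ?L" and F: "finite F" "F \<subseteq> R" for f g F
  proof -
    have fgc: "f \<ominus>\<^bsub>?L\<^esub> g \<in> carrier ?L" using fg by simp
    have "(\<Sum>i\<in>F. (vdist H (f i) (g i))\<^sup>2) = (\<Sum>i\<in>F. (vnorm H ((f \<ominus>\<^bsub>?L\<^esub> g) i))\<^sup>2)"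
      by (rule sum.cong) (use F fg in \<open>auto simp: vdist_def car minus\<close>)
    also have "\<dots> \<le> (\<Sum>\<^sub>\<infinity>i\<in>R. (vnorm H ((f \<ominus>\<^bsub>?L\<^esub> g) i))\<^sup>2)"
      using F hilbert_sumD(3)[OF fgc] by (intro finite_sum_le_infsum) auto
    also have "\<dots> = (vdist ?L f g)\<^sup>2"
      using fg by (simp add: vdist_def infsum_nonneg)
    finally show ?thesis .
  qed
  show ?thesis
  proof
    show "Metric_space.mcomplete (carrier ?L) (vdist ?L)"
      unfolding ms_L.mcomplete_def
    proof (intro allI impI)
      fix u assume u: "ms_L.MCauchy u"
      then have uc: "u n \<in> carrier ?L" for n unfolding ms_L.MCauchy_def by auto
      have comp: "vdist H (f i) (g i) \<le> vdist ?L f g" if "f \<in> carrier ?L" "g \<in> carrier ?L" "i \<in> R" for f g i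
        using dist2[OF that(1,2), of "{i}"] that(3) by (simp add: power2_le_iff_abs_le)
      have "\<exists>x. limitin ms_H.mtopology (\<lambda>n. u n i) x sequentially" if i: "i \<in> R" for i
      proof -
        have "ms_H.MCauchy (\<lambda>n. u n i)"
          unfolding ms_H.MCauchy_def
        proof (intro conjI allI impI)
          show "range (\<lambda>n. u n i) \<subseteq> carrier H" using car[OF uc i] by auto
          fix \<epsilon> :: real assume "0 < \<epsilon>"
          then show "\<exists>N. \<forall>n n'. N \<le> n \<longrightarrow> N \<le> n' \<longrightarrow> vdist H (u n i) (u n' i) < \<epsilon>"
            using u comp[OF uc uc i] unfolding ms_L.MCauchy_def by (meson le_less_trans)
        qed
        then show ?thesis using H.complete unfolding ms_H.mcomplete_def by blast
      qed
      then obtain x where x: "\<And>i. i \<in> R \<Longrightarrow> limitin ms_H.mtopology (\<lambda>n. u n i) (x i) sequentially"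
        by metis
      have xc: "x i \<in> carrier H" if "i \<in> R" for i using x[OF that] ms_H.limitin_mspace by blast
      have xlim: "(\<lambda>n. vdist H (u n i) (x i)) \<longlonglongrightarrow> 0" if "i \<in> R" for i
        using x[OF that] by (simp add: ms_H.limitin_metric_dist_null)
      \<comment> \<open>Over a finite \<open>F\<close> the limit in \<open>m\<close> can be taken
        term by term; the bound obtained does not depend on \<open>F\<close>.\<close>
      have bound: "(\<Sum>i\<in>F. (vdist H (u n i) (x i))\<^sup>2) \<le> \<epsilon>\<^sup>2"
        if F: "finite F" "F \<subseteq> R" and n: "\<And>m. N \<le> m \<Longrightarrow> vdist ?L (u n) (u m) < \<epsilon>" for F n N \<epsilon>
      proof (rule LIMSEQ_le_const2)
        have "(\<lambda>m. vdist H (u n i) (u m i)) \<longlonglongrightarrow> vdist H (u n i) (x i)" if i: "i \<in> R" for i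
        proof -
          have "\<bar>vdist H (u n i) (u m i) - vdist H (u n i) (x i)\<bar> \<le> vdist H (u m i) (x i)" for m
            using ms_H.triangle[of "u n i" "u m i" "x i"] ms_H.triangle[of "u n i" "x i" "u m i"]
              car[OF uc i] xc[OF i] ms_H.commute[of "u m i" "x i"] by (simp add: abs_le_iff)
          then have "(\<lambda>m. vdist H (u n i) (u m i) - vdist H (u n i) (x i)) \<longlonglongrightarrow> 0"
            by (intro Lim_null_comparison[OF _ xlim[OF i]]) simp
          then show ?thesis by (simp add: LIM_zero_iff)
        qed
        then show "(\<lambda>m. \<Sum>i\<in>F. (vdist H (u n i) (u m i))\<^sup>2) \<longlonglongrightarrow> (\<Sum>i\<in>F. (vdist H (u n i) (x i))\<^sup>2)"
          using F by (intro tendsto_sum tendsto_power) auto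
        show "\<exists>N. \<forall>m\<ge>N. (\<Sum>i\<in>F. (vdist H (u n i) (u m i))\<^sup>2) \<le> \<epsilon>\<^sup>2"
        proof (intro exI allI impI)
          fix m assume m: "N \<le> m"
          have "(vdist ?L (u n) (u m))\<^sup>2 \<le> \<epsilon>\<^sup>2" using n[OF m] by (intro power_mono) auto
          then show "(\<Sum>i\<in>F. (vdist H (u n i) (u m i))\<^sup>2) \<le> \<epsilon>\<^sup>2"
            using dist2[OF uc uc F] order_trans by blast
        qed
      qed
      define y where "y = (\<lambda>i\<in>R. x i)"
      have close: "y \<in> carrier ?L \<and> vdist ?L (u n) y \<le> \<epsilon>"
        if "0 \<le> \<epsilon>" and n: "\<And>m. N \<le> m \<Longrightarrow> vdist ?L (u n) (u m) < \<epsilon>" for n N \<epsilon>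
      proof -
        \<comment> \<open>\<open>z\<close> is the error between \<open>u n\<close> and the limit. It
          is square-summable by the uniform bound, and membership of \<open>y\<close> follows by
          writing \<open>y\<close> as \<open>u n\<close> minus \<open>z\<close>.\<close>
        define z where "z = (\<lambda>i\<in>R. u n i \<ominus>\<^bsub>H\<^esub> x i)"
        have zn: "(vnorm H (z i))\<^sup>2 = (vdist H (u n i) (x i))\<^sup>2" if "i \<in> R" for i
          using that by (simp add: z_def vdist_def car[OF uc] xc)
        have "(\<Sum>i\<in>F. (vnorm H (z i))\<^sup>2) \<le> \<epsilon>\<^sup>2" if F: "finite F" "F \<subseteq> R" for F
        proof -
          have "(\<Sum>i\<in>F. (vnorm H (z i))\<^sup>2) = (\<Sum>i\<in>F. (vdist H (u n i) (x i))\<^sup>2)"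
            by (rule sum.cong) (use F zn in auto)
          then show ?thesis using bound[OF F n] by simp
        qed
        from nonneg_summable_onI[OF zero_le_power2 this] have zs: "(\<lambda>i. (vnorm H (z i))\<^sup>2) summable_on R" "(\<Sum>\<^sub>\<infinity>i\<in>R. (vnorm H (z i))\<^sup>2) \<le> \<epsilon>\<^sup>2"
          by blast+
        have z: "z \<in> carrier ?L"
          using zs(1) car[OF uc] xc by (simp add: hilbert_sum_carrier z_def)
        have "y = u n \<ominus>\<^bsub>?L\<^esub> z"
        proof (rule extensionalityI[of _ R])
          show "u n \<ominus>\<^bsub>?L\<^esub> z \<in> extensional R"
            using uc z by (intro hilbert_sumD(2)[of _ _ H]) simp
          fix i assume i: "i \<in> R"
          have "u n i \<ominus>\<^bsub>H\<^esub> (u n i \<ominus>\<^bsub>H\<^esub> x i) = x i"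
            using car[OF uc i] xc[OF i]
            by (simp add: a_minus_def H.minus_add H.r_neg2)
          then show "y i = (u n \<ominus>\<^bsub>?L\<^esub> z) i"
            using i by (simp add: minus[OF uc z] y_def) (simp add: z_def)
        qed (simp add: y_def)
        then have y: "y \<in> carrier ?L" using uc z by simp
        have "u n \<ominus>\<^bsub>?L\<^esub> y = z"
        proof (rule extensionalityI[of _ R])
          show "u n \<ominus>\<^bsub>?L\<^esub> y \<in> extensional R"
            using uc y by (intro hilbert_sumD(2)[of _ _ H]) simp
          show "(u n \<ominus>\<^bsub>?L\<^esub> y) i = z i" if "i \<in> R" for i
            using that by (simp add: minus[OF uc y]) (simp add: y_def z_def)
        qed (simp add: z_def)
        then have "vdist ?L (u n) y = sqrt (\<Sum>\<^sub>\<infinity>i\<in>R. (vnorm H (z i))\<^sup>2)"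
          using uc y by (simp add: vdist_def)
        also have "\<dots> \<le> \<epsilon>" using zs(2) \<open>0 \<le> \<epsilon>\<close> by (simp add: real_le_lsqrt)
        finally show ?thesis using y by blast
      qed
      have cau: "\<exists>N. \<forall>n\<ge>N. \<forall>m\<ge>N. vdist ?L (u n) (u m) < \<epsilon>" if "0 < \<epsilon>" for \<epsilon>
      proof -
        have "\<exists>N. \<forall>n n'. N \<le> n \<longrightarrow> N \<le> n' \<longrightarrow> vdist ?L (u n) (u n') < \<epsilon>"
          using u that unfolding ms_L.MCauchy_def by (elim conjE allE) (erule mp)
        then show ?thesis by simp
      qed
      have y: "y \<in> carrier ?L"
      proof -
        obtain N where "\<forall>n\<ge>N. \<forall>m\<ge>N. vdist ?L (u n) (u m) < 1"
          using cau[of 1] by auto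
        then show ?thesis using close[of 1 N N] by simp
      qed
      have "(\<lambda>n. vdist ?L (u n) y) \<longlonglongrightarrow> 0"
      proof (rule LIMSEQ_I)
        fix \<epsilon> :: real assume e: "0 < \<epsilon>"
        then obtain N where N: "\<forall>n\<ge>N. \<forall>m\<ge>N. vdist ?L (u n) (u m) < \<epsilon> / 2"
          using cau[of "\<epsilon> / 2"] by auto
        have "norm (vdist ?L (u n) y - 0) < \<epsilon>" if "N \<le> n" for n
        proof -
          have "vdist ?L (u n) y \<le> \<epsilon> / 2" using close[of "\<epsilon> / 2" N n] N that e by simp
          then show ?thesis using e ms_L.nonneg[of "u n" y] by simp
        qed
        then show "\<exists>N. \<forall>n\<ge>N. norm (vdist ?L (u n) y - 0) < \<epsilon>" by blast
      qed
      then have "limitin ms_L.mtopology u y sequentially"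
        unfolding ms_L.limitin_metric_dist_null using uc y by simp
      then show "\<exists>x. limitin ms_L.mtopology u x sequentially" by blast
    qed
  qed
qed

text \<open>Reindexing along an injection can only leave out coordinates, so it does not enlarge the
  sum of squares; the operators on the coordinates then cost the common factor \<open>C\<close>.
  This is the shape of an induced operator: a permutation of the cosets followed by a different
  operator at each coset.\<close>

lemma hilbert_sum_op_bounded_by:
  assumes H: "complex_inner_space H" and H': "complex_inner_space H'"
    and \<pi>: "\<pi> ` R \<subseteq> R" "inj_on \<pi> R" and C: "0 \<le> C"
    and T: "\<And>i. i \<in> R \<Longrightarrow> op_bounded_by H H' C (T i)"
  shows "op_bounded_by (hilbert_sum R H) (hilbert_sum R H') C (\<lambda>f. \<lambda>i\<in>R. T i (f (\<pi> i)))"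
proof -
  interpret H: complex_inner_space H by fact
  interpret H': complex_inner_space H' by fact
  note D = op_bounded_byD[OF T] and car = hilbert_sumD(1)
  have \<pi>R: "\<pi> i \<in> R" if "i \<in> R" for i using \<pi> that by blast
  have *: "(\<lambda>i. (vnorm H' (T i (f (\<pi> i))))\<^sup>2) summable_on R \<and>
      (\<Sum>\<^sub>\<infinity>i\<in>R. (vnorm H' (T i (f (\<pi> i))))\<^sup>2) \<le> (C * vnorm (hilbert_sum R H) f)\<^sup>2"
    if f: "f \<in> carrier (hilbert_sum R H)" for f
  proof -
    let ?g = "\<lambda>i. (vnorm H (f i))\<^sup>2"
    have s: "?g summable_on \<pi> ` R"
      using hilbert_sumD(3)[OF f] \<pi>(1) by (rule summable_on_subset_banach)
    have s1: "(\<lambda>i. C\<^sup>2 * ?g (\<pi> i)) summable_on R"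
      using s summable_on_reindex[OF \<pi>(2), of ?g] by (intro summable_on_cmult_right) (simp add: o_def)
    have le: "(vnorm H' (T i (f (\<pi> i))))\<^sup>2 \<le> C\<^sup>2 * ?g (\<pi> i)" if i: "i \<in> R" for i
    proof -
      have "(vnorm H' (T i (f (\<pi> i))))\<^sup>2 \<le> (C * vnorm H (f (\<pi> i)))\<^sup>2"
        using D(1,4)[OF i] car[OF f] \<pi>R[OF i] by (intro power_mono H'.vnorm_nonneg) auto
      then show ?thesis by (simp add: power_mult_distrib)
    qed
    have s2: "(\<lambda>i. (vnorm H' (T i (f (\<pi> i))))\<^sup>2) summable_on R"
      by (rule summable_on_comparison_test[OF s1 le]) auto
    have "(\<Sum>\<^sub>\<infinity>i\<in>R. (vnorm H' (T i (f (\<pi> i))))\<^sup>2) \<le> (\<Sum>\<^sub>\<infinity>i\<in>R. C\<^sup>2 * ?g (\<pi> i))"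
      by (rule infsum_mono[OF s2 s1 le])
    also have "\<dots> = C\<^sup>2 * infsum ?g (\<pi> ` R)"
      by (simp add: infsum_cmult_right' infsum_reindex[OF \<pi>(2)] o_def)
    also have "\<dots> \<le> C\<^sup>2 * infsum ?g R"
      using s hilbert_sumD(3)[OF f] \<pi>(1) by (intro mult_left_mono infsum_mono2) auto
    also have "\<dots> = (C * vnorm (hilbert_sum R H) f)\<^sup>2"
      by (simp add: power_mult_distrib infsum_nonneg)
    finally show ?thesis using s2 by blast
  qed
  show ?thesis
    unfolding op_bounded_by_def
  proof (intro conjI ballI allI)
    show "(\<lambda>f. \<lambda>i\<in>R. T i (f (\<pi> i))) \<in> carrier (hilbert_sum R H) \<rightarrow> carrier (hilbert_sum R H')"
    proof
      fix f assume f: "f \<in> carrier (hilbert_sum R H)"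
      have "(\<lambda>i. (vnorm H' ((\<lambda>i\<in>R. T i (f (\<pi> i))) i))\<^sup>2) summable_on R"
        by (rule summable_on_cong[THEN iffD1, rotated, OF *[OF f, THEN conjunct1]]) simp
      then show "(\<lambda>i\<in>R. T i (f (\<pi> i))) \<in> carrier (hilbert_sum R H')"
        using car[OF f] \<pi>R D(1) by (simp add: hilbert_sum_carrier)
    qed
    fix f assume f: "f \<in> carrier (hilbert_sum R H)"
    have "vnorm (hilbert_sum R H') (\<lambda>i\<in>R. T i (f (\<pi> i))) = sqrt (\<Sum>\<^sub>\<infinity>i\<in>R. (vnorm H' (T i (f (\<pi> i))))\<^sup>2)"
      by (auto intro!: infsum_cong)
    also have "\<dots> \<le> C * vnorm (hilbert_sum R H) f"
      using *[OF f] C by (intro real_le_lsqrt) (auto intro!: infsum_nonneg mult_nonneg_nonneg)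
    finally show "vnorm (hilbert_sum R H') (\<lambda>i\<in>R. T i (f (\<pi> i))) \<le> C * vnorm (hilbert_sum R H) f" .
    show "(\<lambda>i\<in>R. T i ((c \<odot>\<^bsub>hilbert_sum R H\<^esub> f) (\<pi> i))) =
        c \<odot>\<^bsub>hilbert_sum R H'\<^esub> (\<lambda>i\<in>R. T i (f (\<pi> i)))" for c
      using car[OF f] \<pi>R by (auto intro!: restrict_ext simp: D)
    fix g assume g: "g \<in> carrier (hilbert_sum R H)"
    show "(\<lambda>i\<in>R. T i ((f \<oplus>\<^bsub>hilbert_sum R H\<^esub> g) (\<pi> i))) =
        (\<lambda>i\<in>R. T i (f (\<pi> i))) \<oplus>\<^bsub>hilbert_sum R H'\<^esub> (\<lambda>i\<in>R. T i (g (\<pi> i)))"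
      using car[OF f] car[OF g] \<pi>R by (auto intro!: restrict_ext simp: D)
  qed
qed

definition coordinate_embed ::
  "'i set \<Rightarrow> ('v, 'm) chilbert_scheme \<Rightarrow> 'i \<Rightarrow> 'v \<Rightarrow> 'i \<Rightarrow> 'v" where
  "coordinate_embed R H a x = (\<lambda>i\<in>R. if i = a then x else \<zero>\<^bsub>H\<^esub>)"

context complex_inner_space
begin

lemma coordinate_embed_bounded_by:
  assumes a: "a \<in> R"
  shows "op_bounded_by H (hilbert_sum R H) 1 (coordinate_embed R H a)"
proof -
  have v0: "vnorm H \<zero> = 0" by (simp add: vnorm_zero_iff)
  have *: "((\<lambda>i. (vnorm H (coordinate_embed R H a x i))\<^sup>2) has_sum (vnorm H x)\<^sup>2) R" for x
  proof -
    have "((\<lambda>i. (vnorm H x)\<^sup>2) has_sum (vnorm H x)\<^sup>2) {a}"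
      using has_sum_finite[of "{a}" "\<lambda>i. (vnorm H x)\<^sup>2"] by simp
    then show ?thesis
      by (rule has_sum_cong_neutral[THEN iffD1, rotated -1])
        (use a in \<open>auto simp: coordinate_embed_def v0\<close>)
  qed
  show ?thesis
    unfolding op_bounded_by_def
  proof (intro conjI ballI allI)
    show "coordinate_embed R H a \<in> carrier H \<rightarrow> carrier (hilbert_sum R H)"
    proof
      fix x assume "x \<in> carrier H"
      then show "coordinate_embed R H a x \<in> carrier (hilbert_sum R H)"
        using has_sum_imp_summable[OF *[of x]]
        unfolding hilbert_sum_carrier by (auto simp: coordinate_embed_def)
    qed
    fix x assume x: "x \<in> carrier H"
    show "vnorm (hilbert_sum R H) (coordinate_embed R H a x) \<le> 1 * vnorm H x"
      using vnorm_nonneg[OF x] by (simp add: infsumI[OF *])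
  qed (auto simp: coordinate_embed_def smult_r_null intro!: restrict_ext)
qed

lemma coordinate_eval_bounded_by:
  assumes a: "a \<in> R"
  shows "op_bounded_by (hilbert_sum R H) H 1 (\<lambda>f. f a)"
  unfolding op_bounded_by_def
proof (intro conjI ballI allI)
  show "vnorm H (f a) \<le> 1 * vnorm (hilbert_sum R H) f" if "f \<in> carrier (hilbert_sum R H)" for f
    using vnorm_hilbert_sum_component[OF that a] by simp
qed (use a in \<open>auto intro: hilbert_sumD(1)\<close>)

end

section \<open>Multipliers\<close>

lemma isometric_copy_bounded_by:
  assumes "isometric_copy e (carrier H) H H'"
  shows "op_bounded_by H H' 1 e" "op_bounded_by H' H 1 (the_inv_into (carrier H) e)"
proof -
  note * = assms[unfolded isometric_copy_def]
  show "op_bounded_by H H' 1 e" using * by (auto simp: op_bounded_by_def)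
  have inv: "the_inv_into (carrier H) e (e x) = x" if "x \<in> carrier H" for x
    using * that by (simp add: the_inv_into_f_f)
  have add: "e x \<oplus>\<^bsub>H'\<^esub> e y = e (x \<oplus>\<^bsub>H\<^esub> y)" "x \<oplus>\<^bsub>H\<^esub> y \<in> carrier H"
    if "x \<in> carrier H" "y \<in> carrier H" for x y using * that by auto
  have sm: "c \<odot>\<^bsub>H'\<^esub> e x = e (c \<odot>\<^bsub>H\<^esub> x)" "c \<odot>\<^bsub>H\<^esub> x \<in> carrier H"
    if "x \<in> carrier H" for x c using * that by auto
  have "carrier H' = e ` carrier H" "\<And>x. x \<in> carrier H \<Longrightarrow> vnorm H' (e x) = vnorm H x"
    using * by auto
  then show "op_bounded_by H' H 1 (the_inv_into (carrier H) e)"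
    by (auto simp: op_bounded_by_def inv add sm)
qed

text \<open>\<open>r\<close> is a section of the map to left cosets, written as a function on the
  whole group. It is normalised to \<open>\<one>\<close> on \<Gamma> so that the trivial coset sits
  at the coordinate \<open>\<one>\<close>, where the induced factorisation begins and ends.\<close>

lemma (in group) coset_representatives:
  assumes \<Gamma>: "subgroup \<Gamma> G"
  obtains r where "\<And>g. g \<in> carrier G \<Longrightarrow> r g \<in> carrier G"
    and "\<And>g. g \<in> carrier G \<Longrightarrow> inv (r g) \<otimes> g \<in> \<Gamma>"
    and "\<And>g h. \<lbrakk>g \<in> carrier G; h \<in> \<Gamma>\<rbrakk> \<Longrightarrow> r (g \<otimes> h) = r g"
    and "\<And>h. h \<in> \<Gamma> \<Longrightarrow> r h = \<one>"
proof -
  interpret \<Gamma>: subgroup \<Gamma> G by fact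
  define r where "r g = (if g \<in> \<Gamma> then \<one> else SOME x. x \<in> carrier G \<and> inv x \<otimes> g \<in> \<Gamma>)" for g
  have r: "r g \<in> carrier G \<and> inv (r g) \<otimes> g \<in> \<Gamma>" if g: "g \<in> carrier G" for g
  proof (cases "g \<in> \<Gamma>")
    case False
    have "g \<in> carrier G \<and> inv g \<otimes> g \<in> \<Gamma>" using g by simp
    then show ?thesis using False someI[of "\<lambda>x. x \<in> carrier G \<and> inv x \<otimes> g \<in> \<Gamma>" g]
      by (simp add: r_def)
  qed (simp add: r_def g)
  have mult: "x \<otimes> h \<in> \<Gamma> \<longleftrightarrow> x \<in> \<Gamma>" if "x \<in> carrier G" "h \<in> \<Gamma>" for x h
  proof
    assume "x \<otimes> h \<in> \<Gamma>"
    then have "x \<otimes> h \<otimes> inv h \<in> \<Gamma>" using that by simp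
    then show "x \<in> \<Gamma>" using that by (simp add: m_assoc)
  qed (use that in simp)
  have r_mult: "r (g \<otimes> h) = r g" if "g \<in> carrier G" "h \<in> \<Gamma>" for g h
  proof -
    \<comment> \<open>\<open>g\<close> and \<open>g \<otimes> h\<close> impose the same condition on
      a representative, and \<open>SOME\<close> returns equal values for equal predicates.\<close>
    have "(x \<in> carrier G \<and> inv x \<otimes> (g \<otimes> h) \<in> \<Gamma>) = (x \<in> carrier G \<and> inv x \<otimes> g \<in> \<Gamma>)" for x
      using that mult[of "inv x \<otimes> g" h] by (auto simp: m_assoc)
    then show ?thesis using that by (simp add: r_def mult)
  qed
  have r_one: "r h = \<one>" if "h \<in> \<Gamma>" for h using that by (simp add: r_def)
  show thesis
    by (rule that[OF r[THEN conjunct1] r[THEN conjunct2] r_mult r_one])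
qed

lemma Md_decompositionD:
  assumes "Md_decomposition G d \<phi> H \<xi>"
  shows "i \<le> d \<Longrightarrow> hilbert_space (H i)" "i \<le> d \<Longrightarrow> complex_inner_space (H i)"
    and "H 0 = complex_space Inl" "H d = complex_space Inl"
    and "i \<in> {1..d} \<Longrightarrow> t \<in> carrier G \<Longrightarrow> bounded_op (H i) (H (i - 1)) (\<xi> i t)"
    and "i \<in> {1..d} \<Longrightarrow> bdd_above ((\<lambda>t. opnorm (H i) (H (i - 1)) (\<xi> i t)) ` carrier G)"
proof -
  note * = assms[unfolded Md_decomposition_def]
  have h: "hilbert_space (H i)" if "i \<le> d" using conjunct1[OF *] that by simp
  then show "i \<le> d \<Longrightarrow> hilbert_space (H i)" "i \<le> d \<Longrightarrow> complex_inner_space (H i)"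
    by (simp_all add: hilbert_space_def)
  show "H 0 = complex_space Inl" "H d = complex_space Inl" using * by blast+
  have "\<forall>i\<in>{1..d}. (\<forall>t\<in>carrier G. bounded_op (H i) (H (i - 1)) (\<xi> i t)) \<and>
      bdd_above ((\<lambda>t. opnorm (H i) (H (i - 1)) (\<xi> i t)) ` carrier G)"
    using * by (elim conjE)
  note ** = bspec[OF this]
  show "i \<in> {1..d} \<Longrightarrow> t \<in> carrier G \<Longrightarrow> bounded_op (H i) (H (i - 1)) (\<xi> i t)"
    using **[of i] by blast
  show "i \<in> {1..d} \<Longrightarrow> bdd_above ((\<lambda>t. opnorm (H i) (H (i - 1)) (\<xi> i t)) ` carrier G)"
    by (rule **[THEN conjunct2])
qed

text \<open>The factors of \<open>Md_cost\<close> serve as uniform bounds for the operator families,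
  which turns a cost into data for \<open>op_bounded_by\<close>.\<close>

lemma Md_decomposition_bound:
  assumes D: "Md_decomposition G d \<phi> H \<xi>" and i: "i \<in> {1..d}" and t: "t \<in> carrier G"
  defines "C \<equiv> SUP t\<in>carrier G. opnorm (H i) (H (i - 1)) (\<xi> i t)"
  shows "0 \<le> C" "op_bounded_by (H i) (H (i - 1)) C (\<xi> i t)"
proof -
  interpret complex_inner_space "H i" by (rule Md_decompositionD(2)[OF D]) (use i in simp)
  note b = opnorm_bound[OF vnorm_nonneg Md_decompositionD(5)[OF D i t]]
  have le: "opnorm (H i) (H (i - 1)) (\<xi> i t) \<le> C"
    unfolding C_def by (intro cSUP_upper t Md_decompositionD(6)[OF D i])
  then show "0 \<le> C" using b(1) by simp
  show "op_bounded_by (H i) (H (i - 1)) C (\<xi> i t)"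
    by (rule op_bounded_by_mono[OF b(2) le vnorm_nonneg])
qed

lemma Md_cost_nonneg:
  assumes "group G" "Md_decomposition G d \<phi> H \<xi>"
  shows "0 \<le> Md_cost G d H \<xi>"
  unfolding Md_cost_def
  by (intro prod_nonneg Md_decomposition_bound(1)[OF assms(2) _ monoid.one_closed[OF group.is_monoid[OF assms(1)]]])

text \<open>With an empty carrier the supremum would have no known value; an element of the carrier
  also gives its lower bound 0, needed to multiply such suprema monotonically.\<close>

lemma opnorm_family_bounds:
  assumes "carrier G \<noteq> {}" "0 \<le> C" "\<And>t. t \<in> carrier G \<Longrightarrow> op_bounded_by V W C (T t)"
    and "\<And>x. x \<in> carrier V \<Longrightarrow> 0 \<le> vnorm V x"
  shows "bdd_above ((\<lambda>t. opnorm V W (T t)) ` carrier G)"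
    and "0 \<le> (SUP t\<in>carrier G. opnorm V W (T t))" "(SUP t\<in>carrier G. opnorm V W (T t)) \<le> C"
proof -
  have le: "opnorm V W (T t) \<le> C" if "t \<in> carrier G" for t
    using opnorm_le[OF assms(3)[OF that] assms(2)] .
  show bdd: "bdd_above ((\<lambda>t. opnorm V W (T t)) ` carrier G)"
    using le by (intro bdd_aboveI2) auto
  show "(SUP t\<in>carrier G. opnorm V W (T t)) \<le> C"
    using assms(1) le by (intro cSUP_least) auto
  obtain t where t: "t \<in> carrier G" using assms(1) by blast
  have "0 \<le> opnorm V W (T t)"
    using assms(3,4) t by (intro opnorm_bound(1) op_bounded_by_imp_bounded_op) auto
  also have "\<dots> \<le> (SUP t\<in>carrier G. opnorm V W (T t))"
    using t bdd by (intro cSUP_upper) auto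
  finally show "0 \<le> (SUP t\<in>carrier G. opnorm V W (T t))" .
qed

text \<open>The way back from uniform bounds to a cost: each supremum lies between 0 and
  \<open>C i\<close>, so the product of the suprema is at most the product of the
  \<open>C i\<close>.\<close>

lemma Md_decompositionI:
  assumes G: "group G"
    and H: "\<And>i. i \<le> d \<Longrightarrow> hilbert_space (H i)" "H 0 = complex_space Inl" "H d = complex_space Inl"
    and C: "\<And>i. i \<in> {1..d} \<Longrightarrow> 0 \<le> C i"
      "\<And>i t. i \<in> {1..d} \<Longrightarrow> t \<in> carrier G \<Longrightarrow> op_bounded_by (H i) (H (i - 1)) (C i) (\<xi> i t)"
    and eq: "\<And>t. (\<And>i. i \<in> {1..d} \<Longrightarrow> t i \<in> carrier G) \<Longrightarrow> foldr (\<lambda>i. \<xi> i (t i)) [1..<Suc d] (Inl 1) =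
        Inl (\<phi> (foldr (\<lambda>i x. t i \<otimes>\<^bsub>G\<^esub> x) [1..<Suc d] \<one>\<^bsub>G\<^esub>))"
  shows "Md_decomposition G d \<phi> H \<xi>" "Md_cost G d H \<xi> \<le> (\<Prod>i=1..d. C i)"
proof -
  interpret group G by fact
  have inn: "complex_inner_space (H i)" if "i \<le> d" for i
    using H(1)[OF that] by (simp add: hilbert_space_def)
  have ne: "carrier G \<noteq> {}" using one_closed by blast
  have B: "bdd_above ((\<lambda>t. opnorm (H i) (H (i - 1)) (\<xi> i t)) ` carrier G)"
      "0 \<le> (SUP t\<in>carrier G. opnorm (H i) (H (i - 1)) (\<xi> i t))"
      "(SUP t\<in>carrier G. opnorm (H i) (H (i - 1)) (\<xi> i t)) \<le> C i" if i: "i \<in> {1..d}" for i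
  proof -
    have "i \<le> d" using i by simp
    note * = opnorm_family_bounds[OF ne C(1)[OF i] C(2)[OF i] complex_inner_space.vnorm_nonneg[OF inn[OF this]]]
    show "bdd_above ((\<lambda>t. opnorm (H i) (H (i - 1)) (\<xi> i t)) ` carrier G)"
      "0 \<le> (SUP t\<in>carrier G. opnorm (H i) (H (i - 1)) (\<xi> i t))"
      "(SUP t\<in>carrier G. opnorm (H i) (H (i - 1)) (\<xi> i t)) \<le> C i"
      by (rule *; assumption)+
  qed
  show "Md_decomposition G d \<phi> H \<xi>"
    unfolding Md_decomposition_def
  proof (intro conjI ballI allI impI)
    show "foldr (\<lambda>i. \<xi> i (t i)) [1..<Suc d] (Inl 1) =
        Inl (\<phi> (foldr (\<lambda>i x. t i \<otimes>\<^bsub>G\<^esub> x) [1..<Suc d] \<one>\<^bsub>G\<^esub>))"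
      if "\<forall>i\<in>{1..d}. t i \<in> carrier G" for t
      using that by (intro eq) blast
  qed (use H B(1) op_bounded_by_imp_bounded_op[OF C(2)] in auto)
  show "Md_cost G d H \<xi> \<le> (\<Prod>i=1..d. C i)"
    unfolding Md_cost_def using B(2,3) by (intro prod_mono conjI) auto
qed

text \<open>The representation through which \<open>\<phi>\<close> factors is induced from \<open>\<Gamma>\<close> to \<open>G\<close>: with coset
  representatives \<open>r\<close>, the operators \<open>(\<Xi>\<^sub>i(t) f)(y) = \<xi>\<^sub>i(y\<inverse> t x) f(x)\<close>, \<open>x = r(t\<inverse> y)\<close>, act on
  \<open>\<ell>\<^sup>2(G/\<Gamma>; H\<^sub>i)\<close>. They move the support of a vector from the coset of \<open>x\<close> to that of \<open>t x\<close>, so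
  starting and ending in the trivial coset singles out the products that lie in \<open>\<Gamma>\<close>.\<close>

lemma (in group) Md_decomposition_extend_zero:
  fixes H :: "nat \<Rightarrow> (complex + 'h) chilbert"
  assumes \<Gamma>: "subgroup \<Gamma> G" and d: "2 \<le> d"
    and D: "Md_decomposition (G\<lparr>carrier := \<Gamma>\<rparr>) d \<phi> H \<xi>"
  shows "\<exists>(H' :: nat \<Rightarrow> (complex + ('a \<Rightarrow> complex + 'h)) chilbert) \<xi>'.
    Md_decomposition G d (\<lambda>s. if s \<in> \<Gamma> then \<phi> s else 0) H' \<xi>' \<and>
    Md_cost G d H' \<xi>' \<le> Md_cost (G\<lparr>carrier := \<Gamma>\<rparr>) d H \<xi>"
proof -
  interpret \<Gamma>: subgroup \<Gamma> G by fact
  let ?K = "G\<lparr>carrier := \<Gamma>\<rparr>"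
  obtain r where r: "\<And>g. g \<in> carrier G \<Longrightarrow> r g \<in> carrier G"
    and r\<Gamma>: "\<And>g. g \<in> carrier G \<Longrightarrow> inv (r g) \<otimes> g \<in> \<Gamma>"
    and rmult: "\<And>g h. g \<in> carrier G \<Longrightarrow> h \<in> \<Gamma> \<Longrightarrow> r (g \<otimes> h) = r g"
    and r1: "\<And>h. h \<in> \<Gamma> \<Longrightarrow> r h = \<one>"
    by (rule coset_representatives[OF \<Gamma>]) blast
  have r\<Gamma>': "inv g \<otimes> r g \<in> \<Gamma>" if "g \<in> carrier G" for g
    using \<Gamma>.m_inv_closed[OF r\<Gamma>[OF that]] that r by (simp add: inv_mult_group)
  have cancel: "g \<otimes> (inv g \<otimes> h) = h" "inv g \<otimes> (g \<otimes> h) = h"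
    if "g \<in> carrier G" "h \<in> carrier G" for g h
    using that by (simp_all add: m_assoc[symmetric])
  \<comment> \<open>Since \<open>r g\<close> differs from \<open>g\<close> by an element of \<Gamma>
    on the right, \<open>y \<mapsto> r (t \<otimes> y)\<close> is a well-behaved action of
    \<open>t\<close> on representatives.\<close>
  have rr: "r (t \<otimes> r g) = r (t \<otimes> g)" if "t \<in> carrier G" "g \<in> carrier G" for t g
  proof -
    have "r (t \<otimes> g \<otimes> (inv g \<otimes> r g)) = r (t \<otimes> g)" using that r\<Gamma>' by (intro rmult) auto
    moreover have "t \<otimes> g \<otimes> (inv g \<otimes> r g) = t \<otimes> r g"
      using that r by (simp add: m_assoc cancel)
    ultimately show ?thesis by simp
  qed
  \<comment> \<open>\<open>R\<close> contains one element of each left coset and stands for the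
    quotient; \<open>r\<close> is the projection onto it.\<close>
  define R where "R = r ` carrier G"
  have RG: "y \<in> carrier G" if "y \<in> R" for y using that r unfolding R_def by blast
  have rid: "r y = y" if "y \<in> R" for y
  proof -
    obtain g where g: "g \<in> carrier G" "y = r g" using \<open>y \<in> R\<close> unfolding R_def by blast
    then show ?thesis using rr[of \<one> g] r[of g] by simp
  qed
  have R1: "\<one> \<in> R" using r1[of \<one>] by (force simp: R_def)
  have rR: "r g \<in> R" if "g \<in> carrier G" for g using that by (simp add: R_def)
  \<comment> \<open>The argument of \<open>\<xi> i\<close> in the induced operator lies in \<Gamma>,
    where alone \<open>\<xi> i\<close> is controlled: \<open>y\<close> and
    \<open>t \<otimes> r (inv t \<otimes> y)\<close> represent the same coset.\<close>
  have cocycle: "inv y \<otimes> t \<otimes> r (inv t \<otimes> y) \<in> \<Gamma>" if "t \<in> carrier G" "y \<in> carrier G" for t y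
    using r\<Gamma>'[of "inv t \<otimes> y"] that by (simp add: inv_mult_group)
  define C where "C i = (SUP t\<in>\<Gamma>. opnorm (H i) (H (i - 1)) (\<xi> i t))" for i
  have \<xi>: "0 \<le> C i" "op_bounded_by (H i) (H (i - 1)) (C i) (\<xi> i h)" if "i \<in> {1..d}" "h \<in> \<Gamma>" for i h
    using Md_decomposition_bound[OF D that(1), of h] that(2) by (simp_all add: C_def)
  have C: "0 \<le> C i" if "i \<in> {1..d}" for i using \<xi>(1)[OF that \<Gamma>.one_closed] .
  note inn = Md_decompositionD(2)[OF D] and H0 = Md_decompositionD(3)[OF D]
    and Hd = Md_decompositionD(4)[OF D]
  define L where "L i = hilbert_sum R (H i)" for i
  have Lh: "hilbert_space (L i)" if "i \<le> d" for i
    unfolding L_def by (rule hilbert_space_hilbert_sum[OF Md_decompositionD(1)[OF D that]])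
  then have Li: "complex_inner_space (L i)" if "i \<le> d" for i
    using that by (simp add: hilbert_space_def)
  define \<Xi> where "\<Xi> i t f = (\<lambda>y\<in>R. \<xi> i (inv y \<otimes> t \<otimes> r (inv t \<otimes> y)) (f (r (inv t \<otimes> y))))" for i t f
  have \<Xi>: "op_bounded_by (L i) (L (i - 1)) (C i) (\<Xi> i t)" if i: "i \<in> {1..d}" and t: "t \<in> carrier G" for i t
    unfolding L_def \<Xi>_def
  proof (rule hilbert_sum_op_bounded_by)
    show "complex_inner_space (H i)" "complex_inner_space (H (i - 1))" "0 \<le> C i"
      using i by (auto intro: inn C)
    show "(\<lambda>y. r (inv t \<otimes> y)) ` R \<subseteq> R" using t RG by (auto intro!: rR)
    \<comment> \<open>The action of \<open>t\<close> inverts that of \<open>inv t\<close>.\<close>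
    show "inj_on (\<lambda>y. r (inv t \<otimes> y)) R"
    proof (rule inj_on_inverseI)
      fix y assume y: "y \<in> R"
      have "r (t \<otimes> r (inv t \<otimes> y)) = r (t \<otimes> (inv t \<otimes> y))" using t RG[OF y] by (intro rr) auto
      also have "t \<otimes> (inv t \<otimes> y) = y" using t RG[OF y] by (simp add: cancel)
      finally show "r (t \<otimes> r (inv t \<otimes> y)) = y" by (simp add: rid[OF y])
    qed
    show "op_bounded_by (H i) (H (i - 1)) (C i) (\<xi> i (inv y \<otimes> t \<otimes> r (inv t \<otimes> y)))" if "y \<in> R" for y
      by (rule \<xi>(2)[OF i cocycle[OF t RG[OF that]]])
  qed
  let ?\<delta> = "\<lambda>i. coordinate_embed R (H i)"
  \<comment> \<open>A vector concentrated at \<open>y\<close> goes to one concentrated at the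
    representative of \<open>t \<otimes> y\<close>, acted on by the \<Gamma>-part of
    \<open>t \<otimes> y\<close>. All that happens later is bookkeeping along such vectors.\<close>
  have \<Xi>\<delta>: "\<Xi> i t (?\<delta> i y x) = ?\<delta> (i - 1) (r (t \<otimes> y)) (\<xi> i (inv (r (t \<otimes> y)) \<otimes> t \<otimes> y) x)"
    if i: "i \<in> {1..d}" and t: "t \<in> carrier G" and y: "y \<in> R" and x: "x \<in> carrier (H i)" for i t y x
  proof -
    interpret Hi: complex_inner_space "H i" using i by (intro inn) auto
    interpret Hj: complex_inner_space "H (i - 1)" using i by (intro inn) auto
    have iff: "r (inv t \<otimes> z) = y \<longleftrightarrow> z = r (t \<otimes> y)" if z: "z \<in> R" for z
    proof
      assume "r (inv t \<otimes> z) = y"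
      then have "r (t \<otimes> y) = r (t \<otimes> (inv t \<otimes> z))" using rr[of t "inv t \<otimes> z"] t RG[OF z] by auto
      also have "t \<otimes> (inv t \<otimes> z) = z" using t RG[OF z] by (simp add: cancel)
      finally show "z = r (t \<otimes> y)" by (simp add: rid[OF z])
    next
      assume "z = r (t \<otimes> y)"
      then have "r (inv t \<otimes> z) = r (inv t \<otimes> (t \<otimes> y))" using rr[of "inv t" "t \<otimes> y"] t RG[OF y] by auto
      also have "inv t \<otimes> (t \<otimes> y) = y" using t RG[OF y] by (simp add: cancel)
      finally show "r (inv t \<otimes> z) = y" by (simp add: rid[OF y])
    qed
    \<comment> \<open>Linearity only enters through the scalar 0: it shows that the vanishing
      coordinates stay zero.\<close>
    have \<xi>0: "\<xi> i h \<zero>\<^bsub>H i\<^esub> = \<zero>\<^bsub>H (i - 1)\<^esub>" if h: "h \<in> \<Gamma>" for h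
    proof -
      have "\<xi> i h (0 \<odot>\<^bsub>H i\<^esub> \<zero>\<^bsub>H i\<^esub>) = 0 \<odot>\<^bsub>H (i - 1)\<^esub> \<xi> i h \<zero>\<^bsub>H i\<^esub>"
        by (rule op_bounded_byD(3)[OF \<xi>(2)[OF i h]]) simp
      then show ?thesis
        using op_bounded_byD(1)[OF \<xi>(2)[OF i h], of "\<zero>\<^bsub>H i\<^esub>"] Hi.smult_l_null[of "\<zero>\<^bsub>H i\<^esub>"]
          Hj.smult_l_null[of "\<xi> i h \<zero>\<^bsub>H i\<^esub>"] by simp
    qed
    show ?thesis
      unfolding \<Xi>_def coordinate_embed_def[of R "H (i - 1)"]
    proof (rule restrict_ext)
      fix z assume z: "z \<in> R"
      have zi: "r (inv t \<otimes> z) \<in> R" using t RG[OF z] by (simp add: rR)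
      show "\<xi> i (inv z \<otimes> t \<otimes> r (inv t \<otimes> z)) (?\<delta> i y x (r (inv t \<otimes> z))) =
          (if z = r (t \<otimes> y) then \<xi> i (inv (r (t \<otimes> y)) \<otimes> t \<otimes> y) x else \<zero>\<^bsub>H (i - 1)\<^esub>)"
        using iff[OF z] zi \<xi>0[OF cocycle[OF t RG[OF z]]] by (auto simp: coordinate_embed_def)
    qed
  qed
  let ?CC = "complex_space Inl :: (complex + ('a \<Rightarrow> complex + 'h)) chilbert"
  \<comment> \<open>The ends must equal \<open>complex_space Inl\<close> literally, and the left
    summand of the type is reserved for them; the inner spaces are copied into the right
    summand.\<close>
  define H' where "H' i = (if i = 0 \<or> i = d then ?CC else transport Inr (carrier (L i)) (L i))" for i
  \<comment> \<open>\<open>e\<close> passes between the copies of the complex numbers in two sum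
    types; its value \<open>Inl 0\<close> on the right summand is a default outside the
    carrier.\<close>
  define e :: "complex + 'h \<Rightarrow> complex + ('a \<Rightarrow> complex + 'h)"
    where "e x = (case x of Inl c \<Rightarrow> Inl c | Inr _ \<Rightarrow> Inl 0)" for x
  have e: "isometric_copy e (carrier (H i)) (H i) (H' i)" if "i = 0 \<or> i = d" for i
  proof -
    have "H i = complex_space Inl" "H' i = ?CC" using that H0 Hd by (auto simp: H'_def)
    then show ?thesis
      by (auto simp: isometric_copy_def e_def complex_space_def inv_f_f inj_on_def image_image)
  qed
  have iso: "isometric_copy Inr (carrier (L i)) (L i) (H' i)" if "i \<le> d" "\<not> (i = 0 \<or> i = d)" for i
    using isometric_copy_transport[OF Li[OF that(1)]
        complex_inner_space.closed_subspace_carrier[OF Li[OF that(1)]], of Inr] that(2)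
    by (simp add: H'_def)
  have hil': "hilbert_space (H' i)" if "i \<le> d" for i
    using hilbert_space_complex_space[of Inl]
      hilbert_space_transport[OF Lh[OF that] complex_inner_space.closed_subspace_carrier[OF Li[OF that]], of Inr]
    by (auto simp: H'_def)
  \<comment> \<open>\<open>inc\<close> enters the induced space and \<open>out\<close> leaves it. In
    the middle they only remove and add the tag \<open>Inr\<close>; at \<open>d\<close> a scalar is
    placed at the trivial coset, at 0 the value at the trivial coset is read off.\<close>
  define inc where "inc i x = (if i = d then ?\<delta> d \<one> (the_inv_into (carrier (H d)) e x)
      else the_inv_into (carrier (L i)) Inr x)" for i x
  define out where "out i f = (if i = 0 then e (f \<one>) else Inr f)" for i :: nat and f :: "'a \<Rightarrow> complex + 'h"
  have inc: "op_bounded_by (H' i) (L i) 1 (inc i)" if i: "i \<in> {1..d}" for i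
  proof (cases "i = d")
    case True
    have "op_bounded_by (H' d) (L d) (1 * 1) (\<lambda>x. ?\<delta> d \<one> (the_inv_into (carrier (H d)) e x))"
      by (rule op_bounded_by_comp[OF isometric_copy_bounded_by(2)[OF e]])
        (auto simp: L_def intro!: complex_inner_space.coordinate_embed_bounded_by inn R1)
    then show ?thesis using True by (simp add: inc_def[abs_def])
  next
    case False
    then show ?thesis using isometric_copy_bounded_by(2)[OF iso, of i] i by (simp add: inc_def[abs_def])
  qed
  have out: "op_bounded_by (L i) (H' i) 1 (out i)" if i: "i < d" for i
  proof (cases "i = 0")
    case True
    have "op_bounded_by (L 0) (H' 0) (1 * 1) (\<lambda>f. e (f \<one>))"
      by (rule op_bounded_by_comp[OF _ isometric_copy_bounded_by(1)[OF e]])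
        (auto simp: L_def intro!: complex_inner_space.coordinate_eval_bounded_by inn R1)
    then show ?thesis using True by (simp add: out_def[abs_def])
  next
    case False
    then show ?thesis using isometric_copy_bounded_by(1)[OF iso, of i] i by (simp add: out_def[abs_def])
  qed
  have inc_out: "inc i (out i f) = f" if "f \<in> carrier (L i)" "i \<noteq> 0" "i \<noteq> d" for i f
    using that by (simp add: inc_def out_def the_inv_into_f_f)
  define \<xi>' where "\<xi>' i t x = out (i - 1) (\<Xi> i t (inc i x))" for i t x
  have \<xi>': "op_bounded_by (H' i) (H' (i - 1)) (C i) (\<xi>' i t)" if i: "i \<in> {1..d}" and t: "t \<in> carrier G" for i t
  proof -
    have "op_bounded_by (H' i) (L (i - 1)) (C i * 1) (\<lambda>x. \<Xi> i t (inc i x))"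
      by (rule op_bounded_by_comp[OF inc[OF i] \<Xi>[OF i t] C[OF i]])
    then have "op_bounded_by (H' i) (H' (i - 1)) (1 * (C i * 1)) (\<lambda>x. out (i - 1) (\<Xi> i t (inc i x)))"
      by (rule op_bounded_by_comp[OF _ out]) (use i in auto)
    then show ?thesis by (simp add: \<xi>'_def[abs_def])
  qed
  have eq: "foldr (\<lambda>i. \<xi>' i (t i)) [1..<Suc d] (Inl 1) =
      Inl (if p \<in> \<Gamma> then \<phi> p else 0)"
    if t: "\<And>i. i \<in> {1..d} \<Longrightarrow> t i \<in> carrier G" and p: "p = foldr (\<lambda>i x. t i \<otimes> x) [1..<Suc d] \<one>" for t p
  proof -
    \<comment> \<open>\<open>P i\<close> is the product of the last \<open>d - i\<close> factors.
      After the operators with these indices the vector sits at its representative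
      \<open>y i\<close>.\<close>
    define P where "P i = foldr (\<lambda>i x. t i \<otimes> x) [Suc i..<Suc d] \<one>" for i
    have ups: "[Suc i..<Suc d] = Suc i # [Suc (Suc i)..<Suc d]" if "i < d" for i
      using that by (simp add: upt_conv_Cons del: upt_Suc)
    have Pd: "P d = \<one>" by (simp add: P_def)
    have PSuc: "P i = t (Suc i) \<otimes> P (Suc i)" if "i < d" for i
      using that by (simp add: P_def ups del: upt_Suc)
    have PG: "P i \<in> carrier G" if "i \<le> d" for i
      using that by (induction rule: inc_induct) (auto simp: Pd PSuc t)
    define y where "y i = r (P i)" for i
    have yR: "y i \<in> R" if "i \<le> d" for i using PG[OF that] by (simp add: y_def rR)
    note yG = RG[OF yR]
    have yd: "y d = \<one>" by (simp add: y_def Pd r1)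
    have yt: "r (t (Suc i) \<otimes> y (Suc i)) = y i" if "i < d" for i
      using rr[of "t (Suc i)" "P (Suc i)"] that t[of "Suc i"] PG[of "Suc i"] by (simp add: y_def PSuc)
    \<comment> \<open>The element of \<Gamma> picked up when \<open>t i\<close> moves the vector
      from \<open>y i\<close> to \<open>y (i - 1)\<close>.\<close>
    define \<gamma> where "\<gamma> i = inv (y (i - 1)) \<otimes> t i \<otimes> y i" for i
    have \<gamma>: "\<gamma> i \<in> \<Gamma>" if i: "i \<in> {1..d}" for i
    proof -
      have i': "i - 1 < d" "Suc (i - 1) = i" using i by auto
      have "t i \<otimes> y i \<in> carrier G" using t[OF i] yG[of i] i by simp
      from r\<Gamma>[OF this] show ?thesis
        using yt[OF i'(1)] t[OF i] yG[of i] yG[of "i - 1"] i i' by (simp add: \<gamma>_def m_assoc)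
    qed
    \<comment> \<open>Neighbouring representatives cancel and \<open>y d = \<one>\<close>, so the
      product telescopes.\<close>
    have \<gamma>prod: "foldr (\<lambda>i x. \<gamma> i \<otimes> x) [Suc i..<Suc d] \<one> = inv (y i) \<otimes> P i" if "i \<le> d" for i
      using that
    proof (induction rule: inc_induct)
      case base
      then show ?case by (simp add: yd Pd)
    next
      case (step i)
      then have "foldr (\<lambda>i x. \<gamma> i \<otimes> x) [Suc i..<Suc d] \<one> =
          \<gamma> (Suc i) \<otimes> (inv (y (Suc i)) \<otimes> P (Suc i))"
        by (simp add: ups del: upt_Suc)
      also have "\<dots> = inv (y i) \<otimes> (t (Suc i) \<otimes> (y (Suc i) \<otimes> (inv (y (Suc i)) \<otimes> P (Suc i))))"
        using step yG[of "Suc i"] yG[of i] t[of "Suc i"] PG[of "Suc i"] by (simp add: \<gamma>_def m_assoc)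
      also have "y (Suc i) \<otimes> (inv (y (Suc i)) \<otimes> P (Suc i)) = P (Suc i)"
        using step yG[of "Suc i"] PG[of "Suc i"] by (simp add: cancel)
      finally show ?case using step by (simp add: PSuc)
    qed
    \<comment> \<open>The single nonzero coordinate of the moving vector: the given factorisation of
      \<open>\<phi>\<close>, run along the elements \<open>\<gamma> i\<close> of \<Gamma>. Hence
      \<open>w 0\<close> is a value of \<open>\<phi>\<close> by hypothesis.\<close>
    define w where "w i = foldr (\<lambda>i. \<xi> i (\<gamma> i)) [Suc i..<Suc d] (Inl 1)" for i
    have wd: "w d = Inl 1" by (simp add: w_def)
    have wSuc: "w i = \<xi> (Suc i) (\<gamma> (Suc i)) (w (Suc i))" if "i < d" for i
      using that by (simp add: w_def ups del: upt_Suc)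
    have wH: "w i \<in> carrier (H i)" if "i \<le> d" for i
      using that
    proof (induction rule: inc_induct)
      case base
      then show ?case by (simp add: wd Hd complex_space_def)
    next
      case (step i)
      then show ?case using op_bounded_byD(1)[OF \<xi>(2)[of "Suc i" "\<gamma> (Suc i)"]] \<gamma>[of "Suc i"]
        by (simp add: wSuc)
    qed
    have w0: "w 0 = Inl (\<phi> (inv (y 0) \<otimes> P 0))"
    proof -
      have "w 0 = Inl (\<phi> (foldr (\<lambda>i x. \<gamma> i \<otimes> x) [1..<Suc d] \<one>))"
        using D \<gamma> by (simp add: Md_decomposition_def w_def del: upt_Suc)
      then show ?thesis using \<gamma>prod[of 0] by simp
    qed
    have \<delta>L: "?\<delta> i (y i) (w i) \<in> carrier (L i)" if "i \<le> d" for i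
      unfolding L_def
      by (rule op_bounded_byD(1)[OF complex_inner_space.coordinate_embed_bounded_by[OF inn[OF that] yR[OF that]] wH[OF that]])
    have step: "\<Xi> (Suc i) (t (Suc i)) (?\<delta> (Suc i) (y (Suc i)) (w (Suc i))) = ?\<delta> i (y i) (w i)" if "i < d" for i
      using \<Xi>\<delta>[of "Suc i" "t (Suc i)" "y (Suc i)" "w (Suc i)"] that t[of "Suc i"] yR[of "Suc i"] wH[of "Suc i"]
      by (simp add: yt wSuc \<gamma>_def)
    define v where "v i = foldr (\<lambda>i. \<xi>' i (t i)) [Suc i..<Suc d] (Inl 1)" for i
    have vSuc: "v i = out i (\<Xi> (Suc i) (t (Suc i)) (inc (Suc i) (v (Suc i))))" if "i < d" for i
      using that by (simp add: v_def ups \<xi>'_def del: upt_Suc)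
    \<comment> \<open>The invariant is kept only down to \<open>i = 1\<close>; \<open>out 0\<close>
      is an evaluation and forgets the other coordinates.\<close>
    have v: "inc i (v i) = ?\<delta> i (y i) (w i)" if "i \<le> d" "1 \<le> i" for i
      using that
    proof (induction rule: inc_induct)
      case base
      have "the_inv_into (carrier (H d)) e (e (Inl 1)) = Inl 1"
        using e[of d] by (intro the_inv_into_f_f) (auto simp: isometric_copy_def Hd complex_space_def)
      then show ?case by (simp add: v_def inc_def e_def yd wd)
    next
      case (step i)
      then show ?case using inc_out[OF \<delta>L[of i]] \<open>\<And>i. i < d \<Longrightarrow> \<Xi> (Suc i) (t (Suc i)) _ = _\<close>[of i]
        by (simp add: vSuc)
    qed
    have "v 0 = out 0 (?\<delta> 0 (y 0) (w 0))"
      using d by (simp add: vSuc[of 0] v[of 1, simplified] step[of 0, simplified])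
    also have "\<dots> = Inl (if p \<in> \<Gamma> then \<phi> p else 0)"
    proof -
      have p0: "p = P 0" by (simp add: p P_def)
      \<comment> \<open>For \<open>p\<close> in \<Gamma> the final position is \<open>\<one>\<close>
        and the coordinate read off is \<open>w 0\<close>. Otherwise the final position differs from
        \<open>\<one>\<close>, since it represents the coset of \<open>p\<close>, and a zero
        coordinate is read off.\<close>
      show ?thesis
      proof (cases "p \<in> \<Gamma>")
        case True
        then have "y 0 = \<one>" by (simp add: y_def p0 r1)
        then show ?thesis using True PG[of 0] R1 by (simp add: out_def coordinate_embed_def w0 p0 e_def)
      next
        case False
        have "y 0 \<noteq> \<one>"
        proof
          assume "y 0 = \<one>"
          then show False using r\<Gamma>[OF PG[of 0]] PG[of 0] False by (simp add: y_def p0)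
        qed
        then show ?thesis using False R1 by (simp add: out_def coordinate_embed_def e_def H0 complex_space_def)
      qed
    qed
    finally show ?thesis by (simp add: v_def)
  qed
  have H'0d: "H' 0 = complex_space Inl" "H' d = complex_space Inl" by (simp_all add: H'_def)
  note D' = Md_decompositionI[where \<phi> = "\<lambda>s. if s \<in> \<Gamma> then \<phi> s else 0",
      OF group_axioms hil' H'0d C \<xi>' eq[OF _ refl], unfolded C_def]
  show ?thesis
  proof (intro exI conjI)
    show "Md_decomposition G d (\<lambda>s. if s \<in> \<Gamma> then \<phi> s else 0) H' \<xi>'"
      by (rule D'(1))
    show "Md_cost G d H' \<xi>' \<le> Md_cost ?K d H \<xi>"
      using D'(2) by (simp add: Md_cost_def)
  qed
qed

section \<open>Operations on decompositions and the pointwise bound\<close>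

lemma Md_decomposition_cong:
  assumes G: "group G" and D: "Md_decomposition G d \<phi> H \<xi>"
    and eq: "\<And>t. t \<in> carrier G \<Longrightarrow> \<phi> t = \<psi> t"
  shows "Md_decomposition G d \<psi> H \<xi>"
proof -
  interpret group G by fact
  \<comment> \<open>A decomposition evaluates its function only at products of group elements, so
    values off the carrier do not matter. This allows passing from plain functions to extensional
    ones.\<close>
  have closed: "foldr (\<lambda>i x. t i \<otimes>\<^bsub>G\<^esub> x) is \<one>\<^bsub>G\<^esub> \<in> carrier G"
    if "\<forall>i\<in>set is. t i \<in> carrier G" for t and "is" :: "nat list"
    using that by (induction "is") auto
  note * = D[unfolded Md_decomposition_def]
  have **: "foldr (\<lambda>i. \<xi> i (t i)) [1..<Suc d] (Inl 1) =
      Inl (\<psi> (foldr (\<lambda>i x. t i \<otimes>\<^bsub>G\<^esub> x) [1..<Suc d] \<one>\<^bsub>G\<^esub>))" if t: "\<forall>i\<in>{1..d}. t i \<in> carrier G" for t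
  proof -
    have "foldr (\<lambda>i x. t i \<otimes>\<^bsub>G\<^esub> x) [1..<Suc d] \<one>\<^bsub>G\<^esub> \<in> carrier G"
      by (rule closed) (use t in auto)
    from eq[OF this] show ?thesis using * t by metis
  qed
  show ?thesis
    unfolding Md_decomposition_def using * ** by (elim conjE, intro conjI) blast+
qed

text \<open>Both the translation and the scalar are absorbed by the first operator, replaced by
  \<open>c\<close> times \<open>\<xi> 1 (s \<otimes> t)\<close>. Translation runs through the same
  family of operators, so only the scalar affects the cost.\<close>

lemma (in group) Md_decomposition_translate:
  assumes d: "1 \<le> d" and D: "Md_decomposition G d \<phi> H \<xi>" and s: "s \<in> carrier G"
  shows "\<exists>\<xi>'. Md_decomposition G d (\<lambda>t. c * \<phi> (s \<otimes> t)) H \<xi>' \<and>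
    Md_cost G d H \<xi>' \<le> cmod c * Md_cost G d H \<xi>"
proof -
  define C where "C i = (SUP t\<in>carrier G. opnorm (H i) (H (i - 1)) (\<xi> i t))" for i
  define C' where "C' i = (if i = 1 then cmod c else 1) * C i" for i :: nat
  define \<xi>' where "\<xi>' i t = (if i = 1 then \<lambda>x. c \<odot>\<^bsub>H 0\<^esub> \<xi> 1 (s \<otimes> t) x else \<xi> i t)" for i t
  note C = Md_decomposition_bound[OF D, folded C_def]
  note H = Md_decompositionD(1-4)[OF D]
  interpret H0: complex_inner_space "H 0" by (rule H(2)) simp
  have scale: "op_bounded_by (H 0) (H 0) (cmod c) (\<lambda>x. c \<odot>\<^bsub>H 0\<^esub> x)"
    by (auto simp: op_bounded_by_def H0.smult_r_distr H0.vnorm_smult H0.smult_mult mult.commute)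
  have C'0: "0 \<le> C' i" if "i \<in> {1..d}" for i
    using C(1)[OF that s] by (simp add: C'_def)
  have \<xi>': "op_bounded_by (H i) (H (i - 1)) (C' i) (\<xi>' i t)" if i: "i \<in> {1..d}" and t: "t \<in> carrier G" for i t
  proof (cases "i = 1")
    case True
    have "op_bounded_by (H 1) (H 0) (C 1) (\<xi> 1 (s \<otimes> t))"
      using C(2)[of 1 "s \<otimes> t"] d s t by simp
    from op_bounded_by_comp[OF this scale] show ?thesis using True by (simp add: \<xi>'_def C'_def)
  next
    case False
    then show ?thesis using C(2)[OF i t] by (simp add: \<xi>'_def C'_def)
  qed
  have eq: "foldr (\<lambda>i. \<xi>' i (t i)) [1..<Suc d] (Inl 1) =
      Inl (c * \<phi> (s \<otimes> foldr (\<lambda>i x. t i \<otimes> x) [1..<Suc d] \<one>))"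
    if t: "\<And>i. i \<in> {1..d} \<Longrightarrow> t i \<in> carrier G" for t
  proof -
    \<comment> \<open>By associativity, multiplying the whole product by \<open>s\<close> amounts to
      changing its first letter.\<close>
    define t' where "t' = t(1 := s \<otimes> t 1)"
    have t': "\<forall>i\<in>{1..d}. t' i \<in> carrier G" using t s by (auto simp: t'_def)
    have up: "[1..<Suc d] = 1 # [2..<Suc d]"
      using d upt_conv_Cons[of 1 "Suc d"] by (simp add: numeral_2_eq_2 del: upt_Suc)
    have closed: "foldr (\<lambda>i x. t i \<otimes> x) is \<one> \<in> carrier G" if "set is \<subseteq> {1..d}" for "is"
      using that by (induction "is") (auto simp: t)
    have c1: "foldr (\<lambda>i. \<xi>' i (t i)) [2..<Suc d] (Inl 1) = foldr (\<lambda>i. \<xi> i (t' i)) [2..<Suc d] (Inl 1)"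
      by (rule foldr_cong) (auto simp: \<xi>'_def t'_def simp del: upt_Suc)
    have c2: "foldr (\<lambda>i x. t' i \<otimes> x) [2..<Suc d] \<one> = foldr (\<lambda>i x. t i \<otimes> x) [2..<Suc d] \<one>"
      by (rule foldr_cong) (auto simp: t'_def simp del: upt_Suc)
    have sub: "set [2..<Suc d] \<subseteq> {1..d}" by auto
    have "foldr (\<lambda>i. \<xi>' i (t i)) [1..<Suc d] (Inl 1) =
        c \<odot>\<^bsub>H 0\<^esub> foldr (\<lambda>i. \<xi> i (t' i)) [1..<Suc d] (Inl 1)"
      unfolding up foldr_Cons o_apply c1 by (simp add: \<xi>'_def t'_def del: upt_Suc)
    also have "foldr (\<lambda>i. \<xi> i (t' i)) [1..<Suc d] (Inl 1) =
        Inl (\<phi> (foldr (\<lambda>i x. t' i \<otimes> x) [1..<Suc d] \<one>))"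
      using D t' unfolding Md_decomposition_def by metis
    also have "foldr (\<lambda>i x. t' i \<otimes> x) [1..<Suc d] \<one> = s \<otimes> foldr (\<lambda>i x. t i \<otimes> x) [1..<Suc d] \<one>"
      using closed[OF sub] s t[of 1] d
      unfolding up foldr_Cons o_apply c2 by (simp add: t'_def m_assoc del: upt_Suc)
    finally show ?thesis by (simp add: H(3) complex_space_def inv_f_f)
  qed
  have "(\<Prod>i=1..d. C' i) = cmod c * Md_cost G d H \<xi>"
    using d by (simp add: C'_def Md_cost_def C_def prod.distrib prod.delta)
  then show ?thesis
    using Md_decompositionI[where \<phi> = "\<lambda>t. c * \<phi> (s \<otimes> t)", OF group_axioms H(1,3,4) C'0 \<xi>' eq]
    by auto
qed

text \<open>The trivial representation: all spaces are the complex numbers and all operators the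
  identity.\<close>

lemma Md_decomposition_const_1:
  assumes G: "group G"
  shows "Md_decomposition G d (\<lambda>t. 1) (\<lambda>i. complex_space Inl :: (complex + 'h) chilbert) (\<lambda>i t x. x)"
    and "Md_cost G d (\<lambda>i. complex_space Inl :: (complex + 'h) chilbert) (\<lambda>i t x. x) \<le> 1"
proof -
  have id: "foldr (\<lambda>i x. x) is y = y" for "is" :: "nat list" and y :: "complex + 'h"
    by (induction "is") auto
  have "op_bounded_by (complex_space Inl :: (complex + 'h) chilbert) (complex_space Inl) 1 (\<lambda>x. x)"
    by (simp add: op_bounded_by_def)
  note op = this
  show "Md_decomposition G d (\<lambda>t. 1) (\<lambda>i. complex_space Inl :: (complex + 'h) chilbert) (\<lambda>i t x. x)"
    by (rule Md_decompositionI(1)[OF G, where C = "\<lambda>_. 1"])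
      (simp_all add: hilbert_space_complex_space op id del: upt_Suc)
  have "Md_cost G d (\<lambda>i. complex_space Inl :: (complex + 'h) chilbert) (\<lambda>i t x. x) \<le> (\<Prod>i=1..d. 1)"
    by (rule Md_decompositionI(2)[OF G, where \<phi> = "\<lambda>t. 1"])
      (simp_all add: hilbert_space_complex_space op id del: upt_Suc)
  then show "Md_cost G d (\<lambda>i. complex_space Inl :: (complex + 'h) chilbert) (\<lambda>i t x. x) \<le> 1" by simp
qed

text \<open>Writing \<open>s\<close> as the product of \<open>s\<close> and \<open>d - 1\<close>
  units exhibits \<open>\<phi> s\<close> as the image of 1 under \<open>d\<close> operators, each
  bounded by its factor of the cost.\<close>

lemma (in group) Md_decomposition_norm_le:
  assumes d: "1 \<le> d" and D: "Md_decomposition G d \<phi> H \<xi>" and s: "s \<in> carrier G"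
  shows "cmod (\<phi> s) \<le> Md_cost G d H \<xi>"
proof -
  define t where "t i = (if i = 1 then s else \<one>)" for i :: nat
  have t: "t i \<in> carrier G" for i using s by (simp add: t_def)
  define C where "C i = (SUP t\<in>carrier G. opnorm (H i) (H (i - 1)) (\<xi> i t))" for i
  note C = Md_decomposition_bound[OF D, folded C_def]
  have ups: "[Suc i..<Suc d] = Suc i # [Suc (Suc i)..<Suc d]" if "i < d" for i
    using that by (simp add: upt_conv_Cons del: upt_Suc)
  define v where "v i = foldr (\<lambda>i. \<xi> i (t i)) [Suc i..<Suc d] (Inl 1)" for i
  have vSuc: "v i = \<xi> (Suc i) (t (Suc i)) (v (Suc i))" if "i < d" for i
    using that by (simp add: v_def ups del: upt_Suc)
  \<comment> \<open>At \<open>i = d\<close> the vector is \<open>Inl 1\<close>, of norm 1, and the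
    product is empty.\<close>
  have "v i \<in> carrier (H i) \<and> vnorm (H i) (v i) \<le> (\<Prod>j=Suc i..d. C j)" if "i \<le> d" for i
    using that
  proof (induction rule: inc_induct)
    case base
    then show ?case by (simp add: v_def Md_decompositionD(4)[OF D] complex_space_def inv_f_f)
  next
    case (step i)
    have i: "Suc i \<in> {1..d}" using step by simp
    note op = op_bounded_byD[OF C(2)[OF i t, of "Suc i"], simplified]
    have "vnorm (H i) (v i) \<le> C (Suc i) * vnorm (H (Suc i)) (v (Suc i))"
      using op step by (simp add: vSuc)
    also have "\<dots> \<le> C (Suc i) * (\<Prod>j=Suc (Suc i)..d. C j)"
      using step C(1)[OF i s] by (intro mult_left_mono) auto
    also have "\<dots> = (\<Prod>j=Suc i..d. C j)"
      using step by (simp add: prod.atLeast_Suc_atMost)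
    finally show ?case using op step by (simp add: vSuc)
  qed
  from this[of 0] have v0: "vnorm (H 0) (v 0) \<le> Md_cost G d H \<xi>"
    by (simp add: Md_cost_def C_def)
  have one: "foldr (\<lambda>i x. t i \<otimes> x) is \<one> = \<one>" if "1 \<notin> set is" for "is"
    using that by (induction "is") (auto simp: t_def)
  have "v 0 = Inl (\<phi> (foldr (\<lambda>i x. t i \<otimes> x) [1..<Suc d] \<one>))"
    using D t unfolding Md_decomposition_def v_def by (metis One_nat_def)
  also have "foldr (\<lambda>i x. t i \<otimes> x) [1..<Suc d] \<one> = s"
    using d s one[of "[2..<Suc d]"] upt_conv_Cons[of 1 "Suc d"]
    by (simp add: numeral_2_eq_2 t_def del: upt_Suc)
  finally show ?thesis
    using v0 by (simp add: Md_decompositionD(3)[OF D] complex_space_def inv_f_f)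
qed

section \<open>Membership in \<open>Md\<close> and estimates of \<open>Md_norm\<close>\<close>

lemma Md_norm_le_cost:
  fixes H :: "nat \<Rightarrow> (complex + 'g universe) chilbert" and G :: "('g, 'b) monoid_scheme"
  assumes "group G" "Md_decomposition G d \<phi> H \<xi>"
  shows "Md_norm G d \<phi> \<le> Md_cost G d H \<xi>"
  unfolding Md_norm_def
proof (rule cInf_lower)
  show "bdd_below {Md_cost G d H \<xi> |(H :: nat \<Rightarrow> (complex + 'g universe) chilbert) \<xi>.
      Md_decomposition G d \<phi> H \<xi>}"
    using Md_cost_nonneg[OF assms(1)] by (intro bdd_belowI[of _ 0]) auto
qed (use assms(2) in blast)

context group
begin

text \<open>The spaces may live in any type \<open>'h\<close>:
  \<open>Md_decomposition_universe\<close> compresses them into the type over which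
  \<open>Md\<close> and \<open>Md_norm\<close> quantify, at no extra cost. Constructions can
  therefore enlarge the type freely.\<close>

lemma MdI:
  fixes H :: "nat \<Rightarrow> (complex + 'h) chilbert"
  assumes d: "1 \<le> d" and \<phi>: "\<phi> \<in> extensional (carrier G)" and D: "Md_decomposition G d \<phi> H \<xi>"
  shows "\<phi> \<in> Md G d" "Md_norm G d \<phi> \<le> Md_cost G d H \<xi>"
proof -
  obtain H' :: "nat \<Rightarrow> (complex + 'a universe) chilbert" and \<xi>'
    where D': "Md_decomposition G d \<phi> H' \<xi>'" and le: "Md_cost G d H' \<xi>' \<le> Md_cost G d H \<xi>"
    using Md_decomposition_universe[OF group_axioms D] by blast
  have "bounded (\<phi> ` carrier G)"
    using Md_decomposition_norm_le[OF d D] by (auto simp: bounded_iff)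
  then show "\<phi> \<in> Md G d" using \<phi> D' unfolding Md_def by blast
  show "Md_norm G d \<phi> \<le> Md_cost G d H \<xi>"
    using Md_norm_le_cost[OF group_axioms D'] le by linarith
qed

lemma MdE:
  assumes "\<phi> \<in> Md G d"
  obtains H :: "nat \<Rightarrow> (complex + 'a universe) chilbert" and \<xi>
  where "Md_decomposition G d \<phi> H \<xi>"
  using assms unfolding Md_def by blast

lemma Md_norm_greatest:
  assumes "\<phi> \<in> Md G d"
    and "\<And>(H :: nat \<Rightarrow> (complex + 'a universe) chilbert) \<xi>. Md_decomposition G d \<phi> H \<xi> \<Longrightarrow> b \<le> Md_cost G d H \<xi>"
  shows "b \<le> Md_norm G d \<phi>"
  unfolding Md_norm_def by (rule cInf_greatest) (use assms MdE in blast)+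

lemma norm_le_Md_norm:
  assumes "1 \<le> d" "\<phi> \<in> Md G d" "s \<in> carrier G"
  shows "cmod (\<phi> s) \<le> Md_norm G d \<phi>"
  by (rule Md_norm_greatest) (use assms Md_decomposition_norm_le in blast)+

text \<open>Every decomposition of \<open>\<phi>\<close> induces one of \<open>\<psi>\<close> that
  costs no more, so \<open>Md_norm G d \<psi>\<close> is a lower bound of all the costs for
  \<open>\<phi>\<close>.\<close>

lemma Md_extend_zero:
  assumes \<Gamma>: "subgroup \<Gamma> G" and d: "2 \<le> d" and \<phi>: "\<phi> \<in> Md (G\<lparr>carrier := \<Gamma>\<rparr>) d"
  defines "\<psi> \<equiv> \<lambda>s\<in>carrier G. if s \<in> \<Gamma> then \<phi> s else 0"
  shows "\<psi> \<in> Md G d" "Md_norm G d \<psi> \<le> Md_norm (G\<lparr>carrier := \<Gamma>\<rparr>) d \<phi>"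
proof -
  let ?K = "G\<lparr>carrier := \<Gamma>\<rparr>"
  interpret K: group ?K using \<Gamma> by (rule subgroup.subgroup_is_group[OF _ group_axioms])
  have *: "\<psi> \<in> Md G d \<and> Md_norm G d \<psi> \<le> Md_cost ?K d H \<xi>"
    if D: "Md_decomposition ?K d \<phi> H \<xi>" for H :: "nat \<Rightarrow> (complex + 'a universe) chilbert" and \<xi>
  proof -
    obtain H' :: "nat \<Rightarrow> (complex + ('a \<Rightarrow> complex + 'a universe)) chilbert" and \<xi>'
      where D': "Md_decomposition G d (\<lambda>s. if s \<in> \<Gamma> then \<phi> s else 0) H' \<xi>'"
        and le: "Md_cost G d H' \<xi>' \<le> Md_cost ?K d H \<xi>"
      using Md_decomposition_extend_zero[OF \<Gamma> d D] by blast
    have "Md_decomposition G d \<psi> H' \<xi>'"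
      by (rule Md_decomposition_cong[OF group_axioms D']) (simp add: \<psi>_def)
    from MdI[OF _ _ this] d le show ?thesis by (simp add: \<psi>_def)
  qed
  then show "\<psi> \<in> Md G d" using K.MdE[OF \<phi>] by blast
  show "Md_norm G d \<psi> \<le> Md_norm ?K d \<phi>"
    by (rule K.Md_norm_greatest[OF \<phi>]) (use * in blast)
qed

lemma const_1_Md: "1 \<le> d \<Longrightarrow> (\<lambda>t\<in>carrier G. 1) \<in> Md G d"
  and Md_norm_const_1: "1 \<le> d \<Longrightarrow> Md_norm G d (\<lambda>t\<in>carrier G. 1) \<le> 1"
proof -
  assume d: "1 \<le> d"
  note one = Md_decomposition_const_1[OF group_axioms, of d]
  have "Md_decomposition G d (\<lambda>t\<in>carrier G. 1)
      (\<lambda>i. complex_space Inl :: (complex + 'a) chilbert) (\<lambda>i t x. x)"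
    by (rule Md_decomposition_cong[OF group_axioms one(1)]) simp
  from MdI[OF d _ this] show "(\<lambda>t\<in>carrier G. 1) \<in> Md G d" "Md_norm G d (\<lambda>t\<in>carrier G. 1) \<le> 1"
    using one(2)[where 'h = 'a] by auto
qed

lemma Md_translate:
  fixes H :: "nat \<Rightarrow> (complex + 'h) chilbert"
  assumes d: "1 \<le> d" and D: "Md_decomposition G d \<phi> H \<xi>" and s: "s \<in> carrier G"
  shows "(\<lambda>t\<in>carrier G. c * \<phi> (s \<otimes> t)) \<in> Md G d"
    and "Md_norm G d (\<lambda>t\<in>carrier G. c * \<phi> (s \<otimes> t)) \<le> cmod c * Md_cost G d H \<xi>"
proof -
  let ?\<psi> = "\<lambda>t\<in>carrier G. c * \<phi> (s \<otimes> t)"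
  obtain \<xi>' where D': "Md_decomposition G d (\<lambda>t. c * \<phi> (s \<otimes> t)) H \<xi>'"
    and le: "Md_cost G d H \<xi>' \<le> cmod c * Md_cost G d H \<xi>"
    using Md_decomposition_translate[OF d D s] by blast
  have "Md_decomposition G d ?\<psi> H \<xi>'"
    by (rule Md_decomposition_cong[OF group_axioms D']) simp
  from MdI[OF d _ this] le
  show "?\<psi> \<in> Md G d" "Md_norm G d ?\<psi> \<le> cmod c * Md_cost G d H \<xi>" by simp_all
qed

text \<open>The unit ball absorbs every multiplier, which turns estimates on the ball into estimates
  for all of \<open>Md\<close>. One decomposition yields a suitable factor.\<close>

lemma Md_scale_unit_ball:
  assumes d: "1 \<le> d" and \<phi>: "\<phi> \<in> Md G d"
  obtains K where "0 < K" "(\<lambda>t\<in>carrier G. of_real (inverse K) * \<phi> t) \<in> {\<phi> \<in> Md G d. Md_norm G d \<phi> \<le> 1}"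
proof -
  obtain H :: "nat \<Rightarrow> (complex + 'a universe) chilbert" and \<xi> where D: "Md_decomposition G d \<phi> H \<xi>"
    using MdE[OF \<phi>] by blast
  \<comment> \<open>The added 1 keeps \<open>K\<close> invertible when the cost is 0.\<close>
  define K where "K = Md_cost G d H \<xi> + 1"
  have K: "0 < K" using Md_cost_nonneg[OF group_axioms D] by (simp add: K_def)
  let ?\<psi> = "\<lambda>t\<in>carrier G. of_real (inverse K) * \<phi> t"
  have eq: "(\<lambda>t\<in>carrier G. of_real (inverse K) * \<phi> (\<one> \<otimes> t)) = ?\<psi>"
    by (rule restrict_ext) simp
  have "?\<psi> \<in> Md G d" using Md_translate(1)[OF d D one_closed, of "of_real (inverse K)"] by (simp only: eq)
  moreover have "Md_norm G d ?\<psi> \<le> cmod (of_real (inverse K)) * Md_cost G d H \<xi>"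
    using Md_translate(2)[OF d D one_closed, of "of_real (inverse K)"] by (simp only: eq)
  moreover have "cmod (of_real (inverse K)) * Md_cost G d H \<xi> \<le> 1"
  proof -
    have "cmod (of_real (inverse K)) = inverse K" unfolding norm_of_real using K by simp
    moreover have "Md_cost G d H \<xi> = K - 1" by (simp add: K_def)
    ultimately have "cmod (of_real (inverse K)) * Md_cost G d H \<xi> = inverse K * (K - 1)"
      by (simp only:)
    moreover have "inverse K * (K - 1) \<le> 1" using K by (simp add: field_simps)
    ultimately show ?thesis by (simp only:)
  qed
  ultimately show thesis using that[OF K] by auto
qed

text \<open>On the trivial subgroup the constant 1 is a multiplier; its extension by zero is the
  indicator of \<open>\<one>\<close>, and translation by \<open>inv s\<close> moves it to
  \<open>s\<close>. These multipliers separate the elements of l^1.\<close>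

lemma indicator_Md:
  assumes d: "2 \<le> d" and s: "s \<in> carrier G"
  shows "(\<lambda>t\<in>carrier G. if t = s then 1 else 0) \<in> Md G d"
proof -
  have triv: "subgroup {\<one>} G" by (rule triv_subgroup)
  interpret T: group "G\<lparr>carrier := {\<one>}\<rparr>" by (rule subgroup.subgroup_is_group[OF triv group_axioms])
  have "(\<lambda>t\<in>{\<one>}. 1) \<in> Md (G\<lparr>carrier := {\<one>}\<rparr>) d" using T.const_1_Md[of d] d by simp
  then have "(\<lambda>t\<in>carrier G. if t \<in> {\<one>} then (\<lambda>t\<in>{\<one>}. 1) t else 0) \<in> Md G d"
    by (rule Md_extend_zero(1)[OF triv d])
  then obtain H :: "nat \<Rightarrow> (complex + 'a universe) chilbert" and \<xi>
    where D: "Md_decomposition G d (\<lambda>t\<in>carrier G. if t \<in> {\<one>} then (\<lambda>t\<in>{\<one>}. 1) t else 0) H \<xi>"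
    by (rule MdE)
  from Md_translate(1)[OF _ D inv_closed[OF s], of 1]
  have "(\<lambda>t\<in>carrier G. 1 * (\<lambda>t\<in>carrier G. if t \<in> {\<one>} then (\<lambda>t\<in>{\<one>}. 1) t else 0) (inv s \<otimes> t)) \<in> Md G d"
    using d by linarith
  moreover have "inv s \<otimes> t = \<one> \<longleftrightarrow> t = s" if "t \<in> carrier G" for t
    using that s inv_solve_left[of \<one> s t] by auto
  then have "(\<lambda>t\<in>carrier G. 1 * (\<lambda>t\<in>carrier G. if t \<in> {\<one>} then (\<lambda>t\<in>{\<one>}. 1) t else 0) (inv s \<otimes> t)) =
      (\<lambda>t\<in>carrier G. if t = s then (1::complex) else 0)"
    using s by (intro restrict_ext) auto
  ultimately show ?thesis by (simp only:)
qed

end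

section \<open>The predual\<close>

lemma ell1_Xd_simps [simp]:
  "\<zero>\<^bsub>ell1_Xd G d\<^esub> = (\<lambda>t\<in>carrier G. 0)"
  "f \<oplus>\<^bsub>ell1_Xd G d\<^esub> g = (\<lambda>t\<in>carrier G. f t + g t)"
  "c \<odot>\<^bsub>ell1_Xd G d\<^esub> f = (\<lambda>t\<in>carrier G. c * f t)"
  by (simp_all add: ell1_Xd_def)

lemma ell1_Xd_carrier:
  "g \<in> carrier (ell1_Xd G d) \<longleftrightarrow> g \<in> extensional (carrier G) \<and> (\<lambda>t. cmod (g t)) summable_on carrier G"
  by (simp add: ell1_Xd_def)

lemma ell1_Xd_vnorm:
  "vnorm (ell1_Xd G d) g = (SUP \<phi>\<in>{\<phi> \<in> Md G d. Md_norm G d \<phi> \<le> 1}. cmod (pairing G \<phi> g))"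
  by (simp add: ell1_Xd_def)

lemma ell1_Xd_restrictI:
  assumes "f summable_on carrier G" "\<And>t. t \<in> carrier G \<Longrightarrow> cmod (g t) \<le> f t"
  shows "(\<lambda>t\<in>carrier G. g t) \<in> carrier (ell1_Xd G d)"
proof -
  have "(\<lambda>t. cmod (g t)) summable_on carrier G"
    using assms by (rule summable_on_comparison_test) auto
  then have "(\<lambda>t. cmod ((\<lambda>t\<in>carrier G. g t) t)) summable_on carrier G"
    by (rule summable_on_cong[THEN iffD1, rotated]) simp
  then show ?thesis by (simp add: ell1_Xd_carrier)
qed

text \<open>Hoelder's inequality for a bounded and an absolutely summable function.\<close>

lemma pairing_summable:
  assumes \<phi>: "\<And>t. t \<in> carrier G \<Longrightarrow> cmod (\<phi> t) \<le> M" and g: "g \<in> carrier (ell1_Xd G d)"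
  shows "(\<lambda>t. \<phi> t * g t) summable_on carrier G"
    and "cmod (pairing G \<phi> g) \<le> M * (\<Sum>\<^sub>\<infinity>t\<in>carrier G. cmod (g t))"
proof -
  have s: "(\<lambda>t. M * cmod (g t)) summable_on carrier G"
    using g by (intro summable_on_cmult_right) (simp add: ell1_Xd_carrier)
  have le: "norm (\<phi> t * g t) \<le> M * cmod (g t)" if "t \<in> carrier G" for t
    using \<phi>[OF that] by (simp add: norm_mult mult_right_mono)
  have abs: "(\<lambda>t. norm (\<phi> t * g t)) summable_on carrier G"
    using s le by (rule Infinite_Sum.abs_summable_on_comparison_test')
  show "(\<lambda>t. \<phi> t * g t) summable_on carrier G"
    using abs by (rule Infinite_Sum.abs_summable_summable)
  have "cmod (pairing G \<phi> g) \<le> (\<Sum>\<^sub>\<infinity>t\<in>carrier G. norm (\<phi> t * g t))"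
    unfolding pairing_def by (rule norm_infsum_bound[OF abs])
  also have "\<dots> \<le> (\<Sum>\<^sub>\<infinity>t\<in>carrier G. M * cmod (g t))"
    by (rule infsum_mono[OF abs s le])
  also have "\<dots> = M * (\<Sum>\<^sub>\<infinity>t\<in>carrier G. cmod (g t))"
    by (rule infsum_cmult_right')
  finally show "cmod (pairing G \<phi> g) \<le> M * (\<Sum>\<^sub>\<infinity>t\<in>carrier G. cmod (g t))" .
qed

lemma pairing_add:
  assumes "\<And>t. t \<in> carrier G \<Longrightarrow> cmod (\<phi> t) \<le> M"
    and "f \<in> carrier (ell1_Xd G d)" "g \<in> carrier (ell1_Xd G d)"
  shows "pairing G \<phi> (\<lambda>t\<in>carrier G. f t + g t) = pairing G \<phi> f + pairing G \<phi> g"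
proof -
  have "pairing G \<phi> (\<lambda>t\<in>carrier G. f t + g t) = (\<Sum>\<^sub>\<infinity>t\<in>carrier G. \<phi> t * f t + \<phi> t * g t)"
    unfolding pairing_def by (rule infsum_cong) (simp add: algebra_simps)
  also have "\<dots> = pairing G \<phi> f + pairing G \<phi> g"
    unfolding pairing_def using assms by (intro infsum_add pairing_summable(1))
  finally show ?thesis .
qed

lemma pairing_smult:
  "pairing G \<phi> (\<lambda>t\<in>carrier G. c * g t) = c * pairing G \<phi> g"
  "pairing G (\<lambda>t\<in>carrier G. c * \<phi> t) g = c * pairing G \<phi> g"
proof -
  have "pairing G \<phi> (\<lambda>t\<in>carrier G. c * g t) = (\<Sum>\<^sub>\<infinity>t\<in>carrier G. c * (\<phi> t * g t))"
    unfolding pairing_def by (rule infsum_cong) simp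
  then show "pairing G \<phi> (\<lambda>t\<in>carrier G. c * g t) = c * pairing G \<phi> g"
    by (simp add: pairing_def infsum_cmult_right')
  have "pairing G (\<lambda>t\<in>carrier G. c * \<phi> t) g = (\<Sum>\<^sub>\<infinity>t\<in>carrier G. c * (\<phi> t * g t))"
    unfolding pairing_def by (rule infsum_cong) simp
  then show "pairing G (\<lambda>t\<in>carrier G. c * \<phi> t) g = c * pairing G \<phi> g"
    by (simp add: pairing_def infsum_cmult_right')
qed

lemma pairing_indicator:
  assumes "s \<in> carrier G"
  shows "pairing G \<phi> (\<lambda>t\<in>carrier G. if t = s then 1 else 0) = \<phi> s"
    and "pairing G (\<lambda>t\<in>carrier G. if t = s then 1 else 0) g = g s"
    and "(\<lambda>t\<in>carrier G. if t = s then 1 else 0) \<in> carrier (ell1_Xd G d)"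
proof -
  have single: "(f has_sum f s) {s}" for f :: "'a \<Rightarrow> 'd :: {comm_monoid_add, topological_space}"
    using has_sum_finite[of "{s}" f] by simp
  have sum: "(f has_sum f s) (carrier G)" if "\<And>t. t \<in> carrier G - {s} \<Longrightarrow> f t = 0"
    for f :: "'a \<Rightarrow> 'd :: {comm_monoid_add, topological_space}"
    using single[of f] by (rule has_sum_cong_neutral[THEN iffD1, rotated -1]) (use that assms in auto)
  show "pairing G \<phi> (\<lambda>t\<in>carrier G. if t = s then 1 else 0) = \<phi> s"
    unfolding pairing_def
    using sum[of "\<lambda>t. \<phi> t * (\<lambda>t\<in>carrier G. if t = s then 1 else 0) t"] assms
    by (intro infsumI) auto
  show "pairing G (\<lambda>t\<in>carrier G. if t = s then 1 else 0) g = g s"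
    unfolding pairing_def
    using sum[of "\<lambda>t. (\<lambda>t\<in>carrier G. if t = s then 1 else 0) t * g t"] assms
    by (intro infsumI) auto
  show "(\<lambda>t\<in>carrier G. if t = s then 1 else 0) \<in> carrier (ell1_Xd G d)"
    using sum[of "\<lambda>t. if t = s then 1 else (0::real)"]
    by (intro ell1_Xd_restrictI[of "\<lambda>t. if t = s then 1 else 0"]) (auto simp: summable_on_def)
qed

lemma ell1_Xd_module: "Module.module complex_ring (ell1_Xd G d)"
proof -
  let ?V = "ell1_Xd G d"
  have ext: "(\<lambda>t\<in>carrier G. g t) = g" if "g \<in> carrier ?V" for g
    using that by (simp add: ell1_Xd_carrier extensional_restrict)
  have add: "(\<lambda>t\<in>carrier G. f t + g t) \<in> carrier ?V" if "f \<in> carrier ?V" "g \<in> carrier ?V" for f g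
    by (rule ell1_Xd_restrictI[OF summable_on_add, OF _ _ norm_triangle_ineq])
      (use that in \<open>simp_all add: ell1_Xd_carrier\<close>)
  have sm: "(\<lambda>t\<in>carrier G. c * g t) \<in> carrier ?V" if "g \<in> carrier ?V" for c g
    by (rule ell1_Xd_restrictI[of "\<lambda>t. cmod c * cmod (g t)"])
      (use that in \<open>auto simp: ell1_Xd_carrier norm_mult intro!: summable_on_cmult_right\<close>)
  have zero: "(\<lambda>t\<in>carrier G. 0) \<in> carrier ?V"
    by (rule ell1_Xd_restrictI[of "\<lambda>t. 0"]) auto
  have ag: "abelian_group ?V"
  proof (rule abelian_groupI)
    fix g assume g: "g \<in> carrier ?V"
    show "\<zero>\<^bsub>?V\<^esub> \<oplus>\<^bsub>?V\<^esub> g = g" using ext[OF g] by (simp cong: restrict_cong)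
    have "(\<lambda>t\<in>carrier G. (-1) * g t) \<oplus>\<^bsub>?V\<^esub> g = \<zero>\<^bsub>?V\<^esub>" by (simp cong: restrict_cong)
    then show "\<exists>f\<in>carrier ?V. f \<oplus>\<^bsub>?V\<^esub> g = \<zero>\<^bsub>?V\<^esub>" using sm[OF g] by blast
  qed (auto simp: add zero algebra_simps intro!: restrict_ext)
  show ?thesis
  proof (rule moduleI[OF cring_complex_ring ag])
    fix g assume g: "g \<in> carrier ?V"
    show "\<one>\<^bsub>complex_ring\<^esub> \<odot>\<^bsub>?V\<^esub> g = g" using ext[OF g] by simp
  qed (auto simp: sm algebra_simps intro!: restrict_ext)
qed

section \<open>The norm of X_d on l^1 and the functionals of multipliers\<close>

context group
begin

context
  fixes d :: nat
  assumes d: "2 \<le> d"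
begin

abbreviation "Md_ball \<equiv> {\<phi> \<in> Md G d. Md_norm G d \<phi> \<le> 1}"

lemma Md_bounded:
  assumes "\<phi> \<in> Md G d" "t \<in> carrier G"
  shows "cmod (\<phi> t) \<le> Md_norm G d \<phi>"
  using d by (intro norm_le_Md_norm assms) simp

lemma Md_ball_bounded:
  assumes "\<phi> \<in> Md_ball" "t \<in> carrier G"
  shows "cmod (\<phi> t) \<le> 1"
  using Md_bounded[of \<phi> t] assms by simp

lemma const_1_ball: "(\<lambda>t\<in>carrier G. 1) \<in> Md_ball"
  using const_1_Md[of d] Md_norm_const_1[of d] d by simp

text \<open>A multiplier in the ball is bounded by 1, so the l^1 norm of \<open>g\<close> is an
  upper bound for the pairings. Without it the supremum over an unbounded set would carry no
  information.\<close>

lemma pairing_le_vnorm: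
  assumes "\<phi> \<in> Md_ball" "g \<in> carrier (ell1_Xd G d)"
  shows "cmod (pairing G \<phi> g) \<le> vnorm (ell1_Xd G d) g"
  unfolding ell1_Xd_vnorm
proof (rule cSUP_upper[OF assms(1)])
  show "bdd_above ((\<lambda>\<phi>. cmod (pairing G \<phi> g)) ` Md_ball)"
  proof (rule bdd_aboveI2)
    fix \<phi> assume "\<phi> \<in> Md_ball"
    from pairing_summable(2)[OF Md_ball_bounded[OF this] assms(2)]
    show "cmod (pairing G \<phi> g) \<le> 1 * (\<Sum>\<^sub>\<infinity>t\<in>carrier G. cmod (g t))" .
  qed
qed

text \<open>The constant 1 lies in the ball, so the supremum is over a nonempty set and any upper
  bound dominates it.\<close>

lemma vnorm_ell1_le:
  assumes "\<And>\<phi>. \<phi> \<in> Md_ball \<Longrightarrow> cmod (pairing G \<phi> g) \<le> b"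
  shows "vnorm (ell1_Xd G d) g \<le> b"
  unfolding ell1_Xd_vnorm
proof (rule cSUP_least)
  show "Md_ball \<noteq> {}" using const_1_ball by blast
qed (rule assms)

text \<open>Definiteness is the axiom with content: it needs a multiplier supported at each single
  point. Homogeneity and the triangle inequality are inherited from the pairing.\<close>

lemma complex_normed_space_ell1: "complex_normed_space (ell1_Xd G d)"
proof -
  let ?V = "ell1_Xd G d"
  interpret V: Module.module complex_ring ?V by (rule ell1_Xd_module)
  have sm: "c \<odot>\<^bsub>?V\<^esub> g \<in> carrier ?V" if "g \<in> carrier ?V" for c g
    using that V.smult_closed[of c g] by simp
  have sm_le: "vnorm ?V (c \<odot>\<^bsub>?V\<^esub> g) \<le> cmod c * vnorm ?V g" if g: "g \<in> carrier ?V" for c g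
    by (rule vnorm_ell1_le) (simp add: pairing_smult norm_mult mult_left_mono pairing_le_vnorm[OF _ g])
  show ?thesis
  proof
    fix g assume g: "g \<in> carrier ?V" and 0: "vnorm ?V g = 0"
    have "g t = 0" if t: "t \<in> carrier G" for t
    proof -
      let ?\<delta> = "\<lambda>s\<in>carrier G. if s = t then 1 else (0::complex)"
      \<comment> \<open>The indicator of \<open>t\<close> need not lie in the ball itself, but a
        positive multiple does, and that is enough to annihilate \<open>g t\<close>.\<close>
      obtain K where K: "0 < K" and ball: "(\<lambda>s\<in>carrier G. of_real (inverse K) * ?\<delta> s) \<in> Md_ball"
        using Md_scale_unit_ball[OF _ indicator_Md[OF d t]] d by auto
      have "cmod (of_real (inverse K) * g t) \<le> 0"
        using pairing_le_vnorm[OF ball g] 0 by (simp only: pairing_smult(2) pairing_indicator(2)[OF t])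
      then show ?thesis using K by simp
    qed
    then show "g = \<zero>\<^bsub>?V\<^esub>"
      using g by (intro extensionalityI[of _ "carrier G"]) (auto simp: ell1_Xd_carrier)
  next
    fix c g assume g: "g \<in> carrier ?V"
    show "vnorm ?V (c \<odot>\<^bsub>?V\<^esub> g) = cmod c * vnorm ?V g"
    proof (rule antisym[OF sm_le[OF g]])
      show "cmod c * vnorm ?V g \<le> vnorm ?V (c \<odot>\<^bsub>?V\<^esub> g)"
      proof (cases "c = 0")
        case True
        have "0 \<le> cmod (pairing G (\<lambda>t\<in>carrier G. 1) (c \<odot>\<^bsub>?V\<^esub> g))" by simp
        also have "\<dots> \<le> vnorm ?V (c \<odot>\<^bsub>?V\<^esub> g)" by (rule pairing_le_vnorm[OF const_1_ball sm[OF g]])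
        finally show ?thesis using True by simp
      next
        case False
        \<comment> \<open>The converse estimate is \<open>sm_le\<close> applied to
          \<open>c \<odot> g\<close> and the scalar \<open>inverse c\<close>.\<close>
        have "inverse c \<odot>\<^bsub>?V\<^esub> (c \<odot>\<^bsub>?V\<^esub> g) = g"
          using V.smult_assoc1[of "inverse c" c g] V.smult_one[OF g] False g by (simp del: ell1_Xd_simps)
        then have "vnorm ?V g \<le> cmod (inverse c) * vnorm ?V (c \<odot>\<^bsub>?V\<^esub> g)"
          using sm_le[OF sm[OF g], of "inverse c" c] by simp
        then show ?thesis using False by (simp add: norm_divide field_simps)
      qed
    qed
  next
    fix f g assume f: "f \<in> carrier ?V" and g: "g \<in> carrier ?V"
    show "vnorm ?V (f \<oplus>\<^bsub>?V\<^esub> g) \<le> vnorm ?V f + vnorm ?V g"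
    proof (rule vnorm_ell1_le)
      fix \<phi> assume \<phi>: "\<phi> \<in> Md_ball"
      have "pairing G \<phi> (f \<oplus>\<^bsub>?V\<^esub> g) = pairing G \<phi> f + pairing G \<phi> g"
        unfolding ell1_Xd_simps by (rule pairing_add[OF Md_ball_bounded[OF \<phi>] f g])
      then show "cmod (pairing G \<phi> (f \<oplus>\<^bsub>?V\<^esub> g)) \<le> vnorm ?V f + vnorm ?V g"
        using norm_triangle_ineq[of "pairing G \<phi> f" "pairing G \<phi> g"]
          pairing_le_vnorm[OF \<phi> f] pairing_le_vnorm[OF \<phi> g] by simp
    qed
  qed
qed

text \<open>Pairing with the unit mass evaluates at \<open>\<one>\<close>: values there are at most
  1 in modulus on the ball, and the constant 1 attains the bound.\<close>

lemma vnorm_indicator_one: "vnorm (ell1_Xd G d) (\<lambda>t\<in>carrier G. if t = \<one> then 1 else 0) = 1"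
proof (rule antisym)
  show "vnorm (ell1_Xd G d) (\<lambda>t\<in>carrier G. if t = \<one> then 1 else 0) \<le> 1"
    by (rule vnorm_ell1_le) (simp only: pairing_indicator(1)[OF one_closed] Md_ball_bounded one_closed)
  show "1 \<le> vnorm (ell1_Xd G d) (\<lambda>t\<in>carrier G. if t = \<one> then 1 else 0)"
    using pairing_le_vnorm[OF const_1_ball pairing_indicator(3)[OF one_closed]]
    by (simp only: pairing_indicator(1)[OF one_closed]) simp
qed

text \<open>A scaled copy of \<open>\<phi>\<close> belongs to the ball, so the scaling factor is a
  bound for the functional.\<close>

lemma pairing_bounded_by:
  assumes \<phi>: "\<phi> \<in> Md G d"
  shows "\<exists>C. op_bounded_by (ell1_Xd G d) (complex_space id) C (pairing G \<phi>)"
proof -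
  obtain K where K: "0 < K" and ball: "(\<lambda>t\<in>carrier G. of_real (inverse K) * \<phi> t) \<in> Md_ball"
    using Md_scale_unit_ball[OF _ \<phi>] d by auto
  have "cmod (pairing G \<phi> g) \<le> K * vnorm (ell1_Xd G d) g" if g: "g \<in> carrier (ell1_Xd G d)" for g
  proof -
    have "cmod (of_real (inverse K) * pairing G \<phi> g) \<le> vnorm (ell1_Xd G d) g"
      using pairing_le_vnorm[OF ball g] by (simp only: pairing_smult(2))
    moreover have "cmod (of_real (inverse K) * pairing G \<phi> g) = inverse K * cmod (pairing G \<phi> g)"
      unfolding norm_mult norm_of_real using K by simp
    ultimately show ?thesis using K by (simp only:) (simp add: field_simps)
  qed
  then have "op_bounded_by (ell1_Xd G d) (complex_space id) K (pairing G \<phi>)"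
    unfolding op_bounded_by_def
    by (simp add: pairing_smult pairing_add[OF Md_bounded[OF \<phi>]])
  then show ?thesis by blast
qed

text \<open>Uniqueness of the extension resolves the \<open>THE\<close>; to recognise a functional
  it is enough to test it on l^1.\<close>

lemma Md_functional_eqI:
  assumes F: "F \<in> dual_space (Xd G d)"
    and eq: "\<And>g. g \<in> carrier (ell1_Xd G d) \<Longrightarrow> F (Xd_embed G d g) = pairing G \<phi> g"
  shows "Md_functional G d \<phi> = F"
proof -
  interpret V: complex_normed_space "ell1_Xd G d" by (rule complex_normed_space_ell1)
  show ?thesis
    unfolding Md_functional_def
  proof (rule the_equality)
    show "F \<in> dual_space (Xd G d) \<and> (\<forall>g\<in>carrier (ell1_Xd G d). F (Xd_embed G d g) = pairing G \<phi> g)"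
      using F eq by blast
    fix E assume E: "E \<in> dual_space (Xd G d) \<and>
        (\<forall>g\<in>carrier (ell1_Xd G d). E (Xd_embed G d g) = pairing G \<phi> g)"
    show "E = F"
      by (rule V.completion_functional_unique[OF _ F]) (use E eq in simp_all)
  qed
qed

lemma Md_functional:
  assumes \<phi>: "\<phi> \<in> Md G d"
  shows "Md_functional G d \<phi> \<in> dual_space (Xd G d)"
    and "g \<in> carrier (ell1_Xd G d) \<Longrightarrow> Md_functional G d \<phi> (Xd_embed G d g) = pairing G \<phi> g"
proof -
  interpret V: complex_normed_space "ell1_Xd G d" by (rule complex_normed_space_ell1)
  obtain C where "op_bounded_by (ell1_Xd G d) (complex_space id) C (pairing G \<phi>)"
    using pairing_bounded_by[OF \<phi>] by blast
  from V.completion_functional_exists[OF this]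
  obtain F where F: "F \<in> dual_space (Xd G d)"
    "\<And>g. g \<in> carrier (ell1_Xd G d) \<Longrightarrow> F (Xd_embed G d g) = pairing G \<phi> g" by blast
  then show "Md_functional G d \<phi> \<in> dual_space (Xd G d)"
    "g \<in> carrier (ell1_Xd G d) \<Longrightarrow> Md_functional G d \<phi> (Xd_embed G d g) = pairing G \<phi> g"
    using Md_functional_eqI[OF F] by auto
qed

lemma inj_on_Md_functional: "inj_on (Md_functional G d) (Md G d)"
proof (rule inj_onI)
  fix \<phi> \<psi> assume \<phi>: "\<phi> \<in> Md G d" and \<psi>: "\<psi> \<in> Md G d"
    and eq: "Md_functional G d \<phi> = Md_functional G d \<psi>"
  show "\<phi> = \<psi>"
  proof (rule extensionalityI)
    show "\<phi> \<in> extensional (carrier G)" "\<psi> \<in> extensional (carrier G)"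
      using \<phi> \<psi> by (auto simp: Md_def)
    fix s assume s: "s \<in> carrier G"
    show "\<phi> s = \<psi> s"
      using Md_functional(2)[OF \<phi> pairing_indicator(3)[OF s]]
        Md_functional(2)[OF \<psi> pairing_indicator(3)[OF s]]
      by (simp only: eq pairing_indicator(1)[OF s])
  qed
qed

end

end

section \<open>Restriction and extension by zero as adjoint maps\<close>

lemma pairing_extend_zero:
  assumes "\<Gamma> \<subseteq> carrier G"
  shows "pairing G (\<lambda>s\<in>carrier G. if s \<in> \<Gamma> then \<phi> s else 0) g =
    pairing (G\<lparr>carrier := \<Gamma>\<rparr>) \<phi> (restrict g \<Gamma>)"
  unfolding pairing_def by (rule infsum_cong_neutral) (use assms in auto)

theorem lemma2p1:
  fixes G :: "('g, 'b) monoid_scheme" and \<Gamma> :: "'g set" and d :: nat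
  assumes "group G" and "subgroup \<Gamma> G" and "2 \<le> d"
  shows "\<exists>\<Upsilon>. bounded_op (Xd G d) (Xd (G\<lparr>carrier := \<Gamma>\<rparr>) d) \<Upsilon> \<and>
    (\<forall>f\<in>group_algebra G.
       \<Upsilon> (Xd_embed G d f) = Xd_embed (G\<lparr>carrier := \<Gamma>\<rparr>) d (restrict f \<Gamma>)) \<and>
    opnorm (Xd G d) (Xd (G\<lparr>carrier := \<Gamma>\<rparr>) d) \<Upsilon> = 1 \<and>
    (\<forall>\<phi>\<in>Md (G\<lparr>carrier := \<Gamma>\<rparr>) d.
       Md_dual_map G (G\<lparr>carrier := \<Gamma>\<rparr>) d \<Upsilon> \<phi> \<in> Md G d \<and>
       (\<forall>s\<in>carrier G. Md_dual_map G (G\<lparr>carrier := \<Gamma>\<rparr>) d \<Upsilon> \<phi> s =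
          (if s \<in> \<Gamma> then \<phi> s else 0)))"
proof -
  interpret G: group G by fact
  let ?K = "G\<lparr>carrier := \<Gamma>\<rparr>"
  interpret K: group ?K using assms(2,1) by (rule subgroup.subgroup_is_group)
  have \<Gamma>: "\<Gamma> \<subseteq> carrier G" using assms(2) by (rule subgroup.subset)
  note d = \<open>2 \<le> d\<close>
  note normed = G.complex_normed_space_ell1[OF d] K.complex_normed_space_ell1[OF d]
  interpret V: complex_normed_space "ell1_Xd G d" by (rule normed)
  interpret W: complex_normed_space "ell1_Xd ?K d" by (rule normed)
  define ext where "ext \<phi> = (\<lambda>s\<in>carrier G. if s \<in> \<Gamma> then \<phi> s else 0)" for \<phi> :: "'g \<Rightarrow> complex"
  have ext: "ext \<phi> \<in> Md G d" "Md_norm G d (ext \<phi>) \<le> Md_norm ?K d \<phi>" if "\<phi> \<in> Md ?K d" for \<phi>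
    using G.Md_extend_zero[OF assms(2) d that] by (simp_all add: ext_def)
  have restrict_in: "restrict g \<Gamma> \<in> carrier (ell1_Xd ?K d)" if "g \<in> carrier (ell1_Xd G d)" for g
    using ell1_Xd_restrictI[of "\<lambda>t. cmod (g t)" ?K g] that \<Gamma>
    by (auto simp: ell1_Xd_carrier intro: summable_on_subset_banach)
  have T: "op_bounded_by (ell1_Xd G d) (ell1_Xd ?K d) 1 (\<lambda>g. restrict g \<Gamma>)"
    unfolding op_bounded_by_def
  proof (intro conjI ballI allI)
    fix g assume g: "g \<in> carrier (ell1_Xd G d)"
    have "vnorm (ell1_Xd ?K d) (restrict g \<Gamma>) \<le> vnorm (ell1_Xd G d) g"
    proof (rule K.vnorm_ell1_le[OF d])
      fix \<phi> assume \<phi>: "\<phi> \<in> {\<phi> \<in> Md ?K d. Md_norm ?K d \<phi> \<le> 1}"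
      \<comment> \<open>Each \<open>\<phi>\<close> tested in the norm over \<Gamma> has a
        counterpart tested in the norm over \<open>G\<close>, with the same pairing.\<close>
      then have "ext \<phi> \<in> {\<phi> \<in> Md G d. Md_norm G d \<phi> \<le> 1}" using ext[of \<phi>] by simp
      from G.pairing_le_vnorm[OF d this g]
      show "cmod (pairing ?K \<phi> (restrict g \<Gamma>)) \<le> vnorm (ell1_Xd G d) g"
        by (simp only: ext_def pairing_extend_zero[OF \<Gamma>])
    qed
    then show "vnorm (ell1_Xd ?K d) (restrict g \<Gamma>) \<le> 1 * vnorm (ell1_Xd G d) g" by simp
  qed (use restrict_in \<Gamma> in \<open>auto simp: Int_absorb1 intro!: restrict_ext\<close>)
  define \<Upsilon> where "\<Upsilon> = completion_map (ell1_Xd G d) (ell1_Xd ?K d) (\<lambda>g. restrict g \<Gamma>)"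
  have \<Upsilon>: "op_bounded_by (Xd G d) (Xd ?K d) 1 \<Upsilon>"
    unfolding \<Upsilon>_def by (rule completion_map_bounded_by[OF normed T])
  have \<Upsilon>_embed: "\<Upsilon> (Xd_embed G d g) = Xd_embed ?K d (restrict g \<Gamma>)"
    if "g \<in> carrier (ell1_Xd G d)" for g
    unfolding \<Upsilon>_def by (rule completion_map_embed[OF normed T that])
  have norm: "opnorm (Xd G d) (Xd ?K d) \<Upsilon> = 1"
  proof (rule antisym)
    show "opnorm (Xd G d) (Xd ?K d) \<Upsilon> \<le> 1" by (rule opnorm_le[OF \<Upsilon>]) simp
    let ?\<delta> = "\<lambda>t\<in>carrier G. if t = \<one>\<^bsub>G\<^esub> then 1 else (0::complex)"
    let ?\<delta>' = "\<lambda>t\<in>carrier ?K. if t = \<one>\<^bsub>?K\<^esub> then 1 else (0::complex)"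
    have \<delta>: "?\<delta> \<in> carrier (ell1_Xd G d)" and \<delta>': "?\<delta>' \<in> carrier (ell1_Xd ?K d)"
      by (rule pairing_indicator(3)[OF G.one_closed], rule pairing_indicator(3)[OF K.one_closed])
    have "restrict ?\<delta> \<Gamma> = ?\<delta>'" using \<Gamma> by (auto simp: restrict_def fun_eq_iff)
    then have "\<Upsilon> (Xd_embed G d ?\<delta>) = Xd_embed ?K d ?\<delta>'" using \<Upsilon>_embed[OF \<delta>] by (simp only:)
    then have "1 = vnorm (Xd ?K d) (\<Upsilon> (Xd_embed G d ?\<delta>))"
      using W.completion_embed_vnorm[OF \<delta>'] K.vnorm_indicator_one[OF d] by (simp only:)
    also have "\<dots> \<le> opnorm (Xd G d) (Xd ?K d) \<Upsilon> * vnorm (Xd G d) (Xd_embed G d ?\<delta>)"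
      using opnorm_bound(2)[OF V.completion_vnorm_nonneg op_bounded_by_imp_bounded_op[OF \<Upsilon>]]
        V.completion_embed_carrier[OF \<delta>] by (rule op_bounded_byD(4))
    also have "vnorm (Xd G d) (Xd_embed G d ?\<delta>) = 1"
      using V.completion_embed_vnorm[OF \<delta>] G.vnorm_indicator_one[OF d] by (simp only:)
    finally show "1 \<le> opnorm (Xd G d) (Xd ?K d) \<Upsilon>" by simp
  qed
  have dual: "Md_dual_map G ?K d \<Upsilon> \<phi> = ext \<phi>" if \<phi>: "\<phi> \<in> Md ?K d" for \<phi>
  proof -
    let ?F = "compose (carrier (Xd G d)) (Md_functional ?K d \<phi>) \<Upsilon>"
    obtain C where "op_bounded_by (Xd ?K d) (complex_space id) C (Md_functional ?K d \<phi>)"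
      using K.Md_functional(1)[OF d \<phi>] by (auto simp: dual_space_def bounded_op_iff_bounded_by)
    \<comment> \<open>Composition multiplies bounds and needs a nonnegative outer constant.\<close>
    then have "op_bounded_by (Xd ?K d) (complex_space id) \<bar>C\<bar> (Md_functional ?K d \<phi>)"
      by (rule op_bounded_by_mono) (auto intro: W.completion_vnorm_nonneg)
    from op_bounded_by_comp[OF \<Upsilon> this]
    have "op_bounded_by (Xd G d) (complex_space id) (\<bar>C\<bar> * 1) (\<lambda>x. Md_functional ?K d \<phi> (\<Upsilon> x))"
      by simp
    \<comment> \<open>\<open>compose\<close> is undefined off the carrier, so linearity carries over
      because sums and multiples stay in the completion.\<close>
    then have "op_bounded_by (Xd G d) (complex_space id) (\<bar>C\<bar> * 1) ?F"
      unfolding op_bounded_by_def by (simp add: compose_eq V.completion_closed)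
    then have F: "?F \<in> dual_space (Xd G d)"
      by (auto simp: dual_space_def compose_def dest: op_bounded_by_imp_bounded_op)
    have "?F (Xd_embed G d g) = pairing G (ext \<phi>) g" if g: "g \<in> carrier (ell1_Xd G d)" for g
    proof -
      have "?F (Xd_embed G d g) = Md_functional ?K d \<phi> (Xd_embed ?K d (restrict g \<Gamma>))"
        by (simp only: compose_eq[OF V.completion_embed_carrier[OF g]] \<Upsilon>_embed[OF g])
      also have "\<dots> = pairing ?K \<phi> (restrict g \<Gamma>)"
        by (rule K.Md_functional(2)[OF d \<phi> restrict_in[OF g]])
      also have "\<dots> = pairing G (ext \<phi>) g"
        by (simp only: ext_def pairing_extend_zero[OF \<Gamma>])
      finally show ?thesis .
    qed
    from G.Md_functional_eqI[OF d F this] have "Md_functional G d (ext \<phi>) = ?F" .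
    \<comment> \<open>\<open>ext \<phi>\<close> is a multiplier with functional \<open>?F\<close>,
      and by injectivity the only one, so it is what \<open>inv_into\<close> returns.\<close>
    then show ?thesis
      using inv_into_f_f[OF G.inj_on_Md_functional[OF d] ext(1)[OF \<phi>]] by (simp only: Md_dual_map_def)
  qed
  have "f \<in> carrier (ell1_Xd G d)" if "f \<in> group_algebra G" for f
  proof -
    have "(\<lambda>t. cmod (f t)) summable_on {t \<in> carrier G. f t \<noteq> 0}"
      using that by (intro summable_on_finite) (simp add: group_algebra_def)
    then have "(\<lambda>t. cmod (f t)) summable_on carrier G"
      by (rule summable_on_cong_neutral[THEN iffD1, rotated -1]) auto
    then show ?thesis using that by (simp add: group_algebra_def ell1_Xd_carrier)
  qed
  then have "\<forall>f\<in>group_algebra G. \<Upsilon> (Xd_embed G d f) = Xd_embed ?K d (restrict f \<Gamma>)"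
    using \<Upsilon>_embed by blast
  moreover have "Md_dual_map G ?K d \<Upsilon> \<phi> \<in> Md G d \<and>
      (\<forall>s\<in>carrier G. Md_dual_map G ?K d \<Upsilon> \<phi> s = (if s \<in> \<Gamma> then \<phi> s else 0))"
    if "\<phi> \<in> Md ?K d" for \<phi>
    unfolding dual[OF that] using ext(1)[OF that] by (simp add: ext_def)
  ultimately show ?thesis
    using norm op_bounded_by_imp_bounded_op[OF \<Upsilon>] by blast
qed

end
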